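(* Let $d\ge 1$ and $p=\frac{2(d+1)}{d-1}$ (with $p=\infty$ when $d=1$). There is a constant $C=C(d)$ such that for every $R\ge 1$ and every $\phi\in L^2(\mathbb{R}^d)$ satisfying $$\operatorname{supp}\widehat{\phi}\subset\{\xi\in\mathbb{R}^d:\ R-1\le|\xi|\le R+1\},$$ one has $$\|e^{it\Delta}\phi\|_{L^p_{t,x}(\mathbb{R}\times\mathbb{R}^d)}\le C\|\phi\|_{L^2(\mathbb{R}^d)}.$$
   Context: $\widehat{\phi}$ is the Fourier transform on $\mathbb{R}^d$. $e^{it\Delta}$ is the free Schrödinger propagator, i.e. the Fourier multiplier $\widehat{e^{it\Delta}\phi}(\xi)=e^{-it|\xi|^2}\widehat{\phi}(\xi)$ (up to the normalization of the Fourier transform). The constant $C$ is independent of $R$ and $\phi$. *)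

theory Defs
  imports "HOL-Analysis.Analysis"
begin

definition L2 :: "('a::euclidean_space \<Rightarrow> complex) \<Rightarrow> bool" where
  "L2 f \<longleftrightarrow> f \<in> borel_measurable lborel \<and> integrable lborel (\<lambda>x. (norm (f x))^2)"

definition L2norm :: "('a::euclidean_space \<Rightarrow> complex) \<Rightarrow> real" where
  "L2norm f = sqrt (integral\<^sup>L lborel (\<lambda>x. (norm (f x))^2))"

definition FT1 :: "('a::euclidean_space \<Rightarrow> complex) \<Rightarrow> 'a \<Rightarrow> complex" where
  "FT1 \<psi> \<xi> = integral\<^sup>L lborel (\<lambda>x. cis (- (x \<bullet> \<xi>)) * \<psi> x)"

text \<open>Fourier transform on L2, characterised weakly (multiplication formula):
  g is the Fourier transform of phi iff both are in L2 and
  integral g psi = integral phi (hat psi) for every psi in L1 \<inter> L2.\<close>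
definition is_fourier :: "('a::euclidean_space \<Rightarrow> complex) \<Rightarrow> ('a \<Rightarrow> complex) \<Rightarrow> bool" where
  "is_fourier \<phi> g \<longleftrightarrow> L2 \<phi> \<and> L2 g \<and>
     (\<forall>\<psi>. integrable lborel \<psi> \<and> L2 \<psi> \<longrightarrow>
        integral\<^sup>L lborel (\<lambda>\<xi>. g \<xi> * \<psi> \<xi>) = integral\<^sup>L lborel (\<lambda>x. \<phi> x * FT1 \<psi> x))"

definition schrod :: "real \<Rightarrow> ('a::euclidean_space \<Rightarrow> complex) \<Rightarrow> ('a \<Rightarrow> complex) \<Rightarrow> bool" where
  "schrod t \<phi> v \<longleftrightarrow> (\<exists>g. is_fourier \<phi> g \<and>
      is_fourier v (\<lambda>\<xi>. cis (- t * (norm \<xi>)^2) * g \<xi>))"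

end

theory Submission
  imports Defs "HOL-Probability.Characteristic_Functions"
begin

text \<open>Up to normalisation \<open>e\<^sup>i\<^sup>t\<^sup>\<Delta> \<phi>\<close> is the extension operator
  \<open>g \<mapsto> \<integral> exp (i (x \<bullet> \<xi> - t \<bar>\<xi>\<bar>\<^sup>2)) g \<xi> d\<xi>\<close>. Slicing in time is too lossy, because for times below
  \<open>1 / R\<close> the modulus hardly moves; instead space-time is sliced by one space coordinate \<open>s = x \<bullet> e\<close>.
  On a slice the \<open>T T\<^sup>*\<close> kernel with weight \<open>(e \<bullet> \<xi> / \<bar>\<xi>\<bar>)\<^sup>2\<close> on the annulus is bounded on \<open>L\<^sup>2\<close> by a multiple of
  \<open>1 / R\<close> (Plancherel and the change of variables \<open>e \<bullet> \<xi> \<mapsto> \<bar>\<xi>\<bar>\<^sup>2\<close>) and pointwise by a multiple of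
  \<open>(R / \<bar>s\<bar>) powr ((d - 1) / 2)\<close> (decay of the Fourier transform of the sphere, obtained from an energy
  estimate for the Bessel equation). Real interpolation gives \<open>L\<^sup>p\<^sup>'\<close> to \<open>L\<^sup>p\<close> norm \<open>C \<bar>s\<bar> powr (- 2 / p)\<close>:
  the powers of \<open>R\<close> cancel exactly at \<open>p = 2 (d + 1) / (d - 1)\<close>, and the Hardy-Littlewood-Sobolev
  inequality sums the slices. The weights add up to \<open>1\<close> over an orthonormal basis of directions \<open>e\<close>.\<close>

section \<open>Isometries and slices of Lebesgue measure\<close>

text \<open>The exponents are organised by \<alpha> = (d - 1) / (d + 1): then p = 2 / \<alpha>, and
  its dual exponent is q = 2 / (2 - \<alpha>). With \<sigma> = (d - 1) / 2 one has \<sigma> (1 -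
  \<alpha>) = \<alpha>, so the powers of R contributed by the two slice bounds are R^\<alpha> and
  R^(-\<alpha>), and for d \<ge> 2 the remaining power of |s| satisfies 0 < \<alpha> < 1, as
  fractional integration requires. The pointwise kernel bound uses no cancellation in the radial
  direction: it is the bound for one sphere times the thickness of the annulus, so bounded thickness
  is what makes it uniform. The parametrisation of a slice degenerates where \<xi> is orthogonal to
  e, hence the weights. Interpolation is carried out on the bilinear form rather than on the
  operator: both functions are decomposed into level sets, on which the two bounds involve only the
  measures of the sets, and the double integral over levels gives the strong bound at once. In
  dimension one \<alpha> would be 0; there Cauchy-Schwarz on a frequency set of bounded measure
  gives the supremum bound.\<close>

lemma nn_integral_lborel_translate:
  fixes f :: "'a::euclidean_space \<Rightarrow> ennreal"
  assumes [measurable]: "f \<in> borel_measurable borel"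
  shows "(\<integral>\<^sup>+x. f (x + c) \<partial>lborel) = (\<integral>\<^sup>+x. f x \<partial>lborel)"
proof -
  have "(\<integral>\<^sup>+x. f x \<partial>lborel) = (\<integral>\<^sup>+x. f x \<partial>distr lborel borel ((+) c))"
    by (simp add: lborel_distr_plus)
  also have "\<dots> = (\<integral>\<^sup>+x. f (c + x) \<partial>lborel)"
    by (rule nn_integral_distr) auto
  finally show ?thesis by (simp add: add.commute)
qed

text \<open>For a translation invariant \<open>\<mu>\<close> and \<open>B\<close> the unit ball, Fubini applied to
  \<open>1\<^sub>A (x) 1\<^sub>B (y - x)\<close> gives \<open>\<mu> A \<cdot> \<lambda> B = \<lambda> A \<cdot> \<mu> B\<close>, and an isometry preserves \<open>B\<close>.\<close>
lemma lborel_distr_isometry: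
  fixes T :: "'a::euclidean_space \<Rightarrow> 'a"
  assumes lin: "linear T" and nrm: "\<And>x. norm (T x) = norm x"
  shows "distr lborel borel T = lborel"
proof -
  interpret linear T by fact
  have contT: "continuous_on UNIV T" by (simp add: lin linear_continuous_on linear_conv_bounded_linear[symmetric])
  have T[measurable]: "T \<in> borel_measurable borel"
    using contT by (rule borel_measurable_continuous_onI)
  have "inj T"
    by (rule injI) (metis diff eq_iff_diff_eq_0 norm_eq_zero nrm)
  then have "surj T" using lin linear_injective_imp_surjective by blast
  then have S: "T (inv T y) = y" for y by (simp add: surj_f_inv_f)
  let ?B = "cball (0::'a) 1"
  have [measurable]: "?B \<in> sets borel" by (simp add: borel_closed)
  have B: "emeasure lborel ?B \<noteq> 0" "emeasure lborel ?B \<noteq> \<infinity>"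
    using content_cball_pos[of 1 "0::'a"] emeasure_lborel_cball_finite[of "0::'a" 1]
    by (auto simp: measure_def)
  show ?thesis
  proof (rule measure_eqI)
    fix A assume "A \<in> sets (distr lborel borel T)"
    then have A[measurable]: "A \<in> sets borel" by simp
    let ?f = "\<lambda>x y. indicator A (T x) * indicator ?B (y - T x) :: ennreal"
    have "(\<integral>\<^sup>+x. \<integral>\<^sup>+y. ?f x y \<partial>lborel \<partial>lborel) = (\<integral>\<^sup>+x. indicator A (T x) * emeasure lborel ?B \<partial>lborel)"
    proof (rule nn_integral_cong)
      fix x
      have "(\<integral>\<^sup>+y. ?f x y \<partial>lborel) = indicator A (T x) * (\<integral>\<^sup>+y. indicator ?B (y + - T x) \<partial>lborel)"
        by (subst nn_integral_cmult) auto
      also have "(\<integral>\<^sup>+y. indicator ?B (y + - T x) \<partial>lborel) = emeasure lborel ?B"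
        by (subst nn_integral_lborel_translate) auto
      finally show "(\<integral>\<^sup>+y. ?f x y \<partial>lborel) = indicator A (T x) * emeasure lborel ?B" .
    qed
    also have "\<dots> = emeasure (distr lborel borel T) A * emeasure lborel ?B"
      by (subst nn_integral_multc) (auto simp: nn_integral_distr[symmetric, of T lborel borel "indicator A"])
    finally have 1: "(\<integral>\<^sup>+x. \<integral>\<^sup>+y. ?f x y \<partial>lborel \<partial>lborel) = emeasure (distr lborel borel T) A * emeasure lborel ?B" .
    have "(\<integral>\<^sup>+x. \<integral>\<^sup>+y. ?f x y \<partial>lborel \<partial>lborel) = (\<integral>\<^sup>+y. \<integral>\<^sup>+x. ?f x y \<partial>lborel \<partial>lborel)"
      by (rule lborel_pair.Fubini') measurable
    \<comment> \<open>Shifting x by a preimage of y turns \<open>y - T x\<close> into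
      \<open>- T x\<close>, whose norm is that of x, and moves y into the argument of A.\<close>
    also have "\<dots> = (\<integral>\<^sup>+y. \<integral>\<^sup>+x. indicator A (T x + y) * indicator ?B x \<partial>lborel \<partial>lborel)"
    proof (rule nn_integral_cong)
      fix y
      have "(\<integral>\<^sup>+x. ?f x y \<partial>lborel) = (\<integral>\<^sup>+x. ?f (x + inv T y) y \<partial>lborel)"
        by (rule nn_integral_lborel_translate[symmetric]) measurable
      also have "\<dots> = (\<integral>\<^sup>+x. indicator A (T x + y) * indicator ?B x \<partial>lborel)"
        by (rule nn_integral_cong) (auto simp: add S nrm indicator_def)
      finally show "(\<integral>\<^sup>+x. ?f x y \<partial>lborel) = \<dots>" .
    qed
    also have "\<dots> = (\<integral>\<^sup>+x. \<integral>\<^sup>+y. indicator A (T x + y) * indicator ?B x \<partial>lborel \<partial>lborel)"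
      by (rule lborel_pair.Fubini') measurable
    also have "\<dots> = (\<integral>\<^sup>+x. emeasure lborel A * indicator ?B x \<partial>lborel)"
    proof (rule nn_integral_cong)
      fix x
      have "(\<integral>\<^sup>+y. indicator A (T x + y) * indicator ?B x \<partial>lborel) = (\<integral>\<^sup>+y. indicator A (y + T x) \<partial>lborel) * indicator ?B x"
        by (subst nn_integral_multc) (auto simp: add_ac)
      also have "(\<integral>\<^sup>+y. indicator A (y + T x) \<partial>lborel) = emeasure lborel A"
        by (subst nn_integral_lborel_translate) auto
      finally show "(\<integral>\<^sup>+y. indicator A (T x + y) * indicator ?B x \<partial>lborel) = emeasure lborel A * indicator ?B x" .
    qed
    also have "\<dots> = emeasure lborel A * emeasure lborel ?B"
      by (subst nn_integral_cmult) auto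
    finally show "emeasure (distr lborel borel T) A = emeasure lborel A"
      using 1 B by (auto simp: ennreal_mult_cancel_left mult.commute[of _ "emeasure lborel ?B"])
  qed simp
qed

text \<open>Exchanges \<open>t\<close> with the \<open>e\<close>-component of \<open>x\<close>. For \<open>(t, x) = coord_swap e (s, y)\<close> the phase
  \<open>x \<bullet> \<xi> - t \<bar>\<xi>\<bar>\<^sup>2\<close> becomes \<open>s (\<xi> \<bullet> e) + y \<bullet> zeta e \<xi>\<close> with \<open>zeta\<close> as below.\<close>
definition coord_swap :: "'a \<Rightarrow> real \<times> 'a \<Rightarrow> real \<times> 'a::euclidean_space" where
  "coord_swap e z = (snd z \<bullet> e, snd z + (fst z - snd z \<bullet> e) *\<^sub>R e)"

lemma measurable_fst_borel[measurable]:
  "fst \<in> borel_measurable (borel :: ('a::euclidean_space \<times> 'b::euclidean_space) measure)"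
  and measurable_snd_borel[measurable]:
  "snd \<in> borel_measurable (borel :: ('a::euclidean_space \<times> 'b::euclidean_space) measure)"
  by (auto intro!: borel_measurable_continuous_onI continuous_intros)

lemma coord_swap_measurable[measurable]: "coord_swap e \<in> borel_measurable borel"
  unfolding coord_swap_def by (intro borel_measurable_continuous_onI continuous_intros)

lemma lborel_distr_coord_swap:
  assumes e: "norm e = 1"
  shows "distr lborel borel (coord_swap e) = (lborel :: (real \<times> 'a::euclidean_space) measure)"
proof (rule lborel_distr_isometry)
  show "linear (coord_swap e)"
    by (rule linearI) (auto simp: coord_swap_def algebra_simps)
  fix z :: "real \<times> 'a"
  have ee: "e \<bullet> e = 1" using e by (simp add: norm_eq_1)
  show "norm (coord_swap e z) = norm z"
    unfolding norm_eq_sqrt_inner coord_swap_def inner_prod_def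
    by (simp add: ee inner_add_left inner_add_right inner_commute algebra_simps power2_eq_square)
qed

lemma nn_integral_coord_swap:
  assumes "norm e = 1" and [measurable]: "f \<in> borel_measurable borel"
  shows "(\<integral>\<^sup>+z. f (coord_swap e z) \<partial>lborel) = (\<integral>\<^sup>+z. f z \<partial>(lborel :: (real \<times> 'a::euclidean_space) measure))"
  by (subst (2) lborel_distr_coord_swap[OF assms(1), symmetric]) (simp add: nn_integral_distr)

text \<open>Fubini along the lines in direction e, without splitting off the orthogonal complement:
  an extra real variable of total mass 1 is added, and \<open>coord_swap\<close> exchanges it with
  the e-coordinate of x. Afterwards \<kappa> only averages over the base point on each line.\<close>

lemma nn_integral_slice:
  fixes f :: "'a::euclidean_space \<Rightarrow> ennreal" and \<kappa> :: "real \<Rightarrow> ennreal"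
  assumes e: "norm e = 1" and [measurable]: "f \<in> borel_measurable borel" "\<kappa> \<in> borel_measurable borel"
    and \<kappa>: "(\<integral>\<^sup>+s. \<kappa> s \<partial>lborel) = 1"
  shows "(\<integral>\<^sup>+x. f x \<partial>lborel) = (\<integral>\<^sup>+x. \<kappa> (x \<bullet> e) * (\<integral>\<^sup>+s. f (x + (s - x \<bullet> e) *\<^sub>R e) \<partial>lborel) \<partial>lborel)"
proof -
  let ?F = "\<lambda>z. \<kappa> (fst z) * f (snd z)"
  have "(\<integral>\<^sup>+x. f x \<partial>lborel) = (\<integral>\<^sup>+s. \<integral>\<^sup>+x. \<kappa> s * f x \<partial>lborel \<partial>lborel)"
    by (simp add: nn_integral_cmult nn_integral_multc \<kappa>)
  also have "\<dots> = (\<integral>\<^sup>+z. ?F z \<partial>lborel)"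
    unfolding lborel_prod[symmetric]
    by (subst lborel.nn_integral_fst[symmetric]) (auto simp: lborel_prod)
  also have "\<dots> = (\<integral>\<^sup>+z. ?F (coord_swap e z) \<partial>lborel)"
    by (rule nn_integral_coord_swap[symmetric]) (use e in auto)
  also have "\<dots> = (\<integral>\<^sup>+x. \<integral>\<^sup>+s. ?F (coord_swap e (s,x)) \<partial>lborel \<partial>lborel)"
    unfolding lborel_prod[symmetric]
    by (subst lborel_pair.nn_integral_snd[symmetric]) (auto simp: lborel_prod)
  also have "\<dots> = (\<integral>\<^sup>+x. \<kappa> (x \<bullet> e) * (\<integral>\<^sup>+s. f (x + (s - x \<bullet> e) *\<^sub>R e) \<partial>lborel) \<partial>lborel)"
    by (simp add: coord_swap_def nn_integral_cmult)
  finally show ?thesis .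
qed

section \<open>The change of variables on a slice\<close>

lemma nn_integral_square_le:
  fixes h :: "real \<Rightarrow> ennreal"
  assumes [measurable]: "h \<in> borel_measurable borel"
  shows "(\<integral>\<^sup>+s. ennreal (2 * \<bar>s\<bar>) * h (s\<^sup>2) \<partial>lborel) \<le> 2 * (\<integral>\<^sup>+s. h s \<partial>lborel)"
proof -
  \<comment> \<open>Substitution on \<open>{0..real n}\<close>, followed by monotone convergence
    below; the negative half-line is then reflected onto the positive one, hence the factor
    2.\<close>
  have fin: "(\<integral>\<^sup>+s. ennreal (2 * s) * h (s\<^sup>2) * indicator {0..real n} s \<partial>lborel) \<le> (\<integral>\<^sup>+s. h s \<partial>lborel)" if n: "n > 0" for n
  proof -
    have "(\<integral>\<^sup>+s. h s * indicator {0\<^sup>2..(real n)\<^sup>2} s \<partial>lborel) = (\<integral>\<^sup>+s. h (s\<^sup>2) * ennreal (2 * s) * indicator {0..real n} s \<partial>lborel)"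
      by (rule nn_integral_substitution_aux[where g'="\<lambda>x. 2 * x"])
        (use n in \<open>auto intro!: derivative_eq_intros continuous_intros\<close>)
    then have "(\<integral>\<^sup>+s. ennreal (2 * s) * h (s\<^sup>2) * indicator {0..real n} s \<partial>lborel) = (\<integral>\<^sup>+s. h s * indicator {0\<^sup>2..(real n)\<^sup>2} s \<partial>lborel)"
      by (simp add: mult_ac)
    also have "\<dots> \<le> (\<integral>\<^sup>+s. h s \<partial>lborel)"
      by (rule nn_integral_mono) (auto simp: indicator_def)
    finally show ?thesis .
  qed
  let ?g = "\<lambda>s. ennreal (2 * s) * h (s\<^sup>2)"
  have "(\<integral>\<^sup>+s. ?g s * indicator {0..} s \<partial>lborel) = (\<integral>\<^sup>+s. (SUP n. ?g s * indicator {0..real (Suc n)} s) \<partial>lborel)"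
  proof (rule nn_integral_cong, rule antisym)
    fix s :: real
    obtain n where n: "s \<le> real n" using real_arch_simple by blast
    show "?g s * indicator {0..} s \<le> (SUP n. ?g s * indicator {0..real (Suc n)} s)"
      by (rule SUP_upper2[of n]) (use n in \<open>auto simp: indicator_def\<close>)
    show "(SUP n. ?g s * indicator {0..real (Suc n)} s) \<le> ?g s * indicator {0..} s"
      by (rule SUP_least) (auto simp: indicator_def)
  qed
  also have "\<dots> = (SUP n. \<integral>\<^sup>+s. ?g s * indicator {0..real (Suc n)} s \<partial>lborel)"
    by (rule nn_integral_monotone_convergence_SUP) (auto simp: incseq_def le_fun_def indicator_def)
  also have "\<dots> \<le> (\<integral>\<^sup>+s. h s \<partial>lborel)" by (rule SUP_least) (rule fin, simp)
  finally have half: "(\<integral>\<^sup>+s. ?g s * indicator {0..} s \<partial>lborel) \<le> (\<integral>\<^sup>+s. h s \<partial>lborel)" .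
  have "(\<integral>\<^sup>+s. ennreal (2 * \<bar>s\<bar>) * h (s\<^sup>2) \<partial>lborel)
      \<le> (\<integral>\<^sup>+s. ?g s * indicator {0..} s + ?g (-s) * indicator {0..} (-s) \<partial>lborel)"
    by (rule nn_integral_mono) (auto simp: indicator_def)
  also have "\<dots> = (\<integral>\<^sup>+s. ?g s * indicator {0..} s \<partial>lborel) + (\<integral>\<^sup>+s. ?g (-s) * indicator {0..} (-s) \<partial>lborel)"
    by (rule nn_integral_add) auto
  also have "(\<integral>\<^sup>+s. ?g (-s) * indicator {0..} (-s) \<partial>lborel) = (\<integral>\<^sup>+s. ?g s * indicator {0..} s \<partial>distr lborel borel uminus)"
    by (subst nn_integral_distr) auto
  finally have "(\<integral>\<^sup>+s. ennreal (2 * \<bar>s\<bar>) * h (s\<^sup>2) \<partial>lborel)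
     \<le> (\<integral>\<^sup>+s. ?g s * indicator {0..} s \<partial>lborel) + (\<integral>\<^sup>+s. ?g s * indicator {0..} s \<partial>lborel)"
    unfolding lborel_distr_uminus .
  also have "\<dots> \<le> 2 * (\<integral>\<^sup>+s. h s \<partial>lborel)"
    using add_mono[OF half half] by (simp only: mult_2)
  finally show ?thesis .
qed

text \<open>Split orthogonally to e and along e, this is (\<xi>', \<xi>_e) \<mapsto> (\<xi>', -
  |\<xi>|^2): the frequency dual to the slice variable y, whose e-component is the time.\<close>

definition zeta :: "'a \<Rightarrow> 'a \<Rightarrow> 'a::euclidean_space" where
  "zeta e \<xi> = \<xi> - (\<xi> \<bullet> e + (norm \<xi>)\<^sup>2) *\<^sub>R e"

lemma zeta_measurable[measurable]: "zeta e \<in> borel_measurable borel"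
  unfolding zeta_def by measurable

text \<open>On a line in direction e the map is \<open>s \<mapsto> - (s\<^sup>2) - c\<close>, where
  c is the squared norm of the part orthogonal to e. So the Jacobian is 2 |\<xi> \<bullet> e|, and
  each value is taken at most twice.\<close>

lemma nn_integral_zeta_le:
  fixes \<Phi> :: "'a::euclidean_space \<Rightarrow> ennreal"
  assumes e: "norm e = 1" and [measurable]: "\<Phi> \<in> borel_measurable borel"
  shows "(\<integral>\<^sup>+\<xi>. ennreal (2 * \<bar>\<xi> \<bullet> e\<bar>) * \<Phi> (zeta e \<xi>) \<partial>lborel) \<le> 2 * (\<integral>\<^sup>+\<eta>. \<Phi> \<eta> \<partial>lborel)"
proof -
  have ee: "e \<bullet> e = 1" using e by (simp add: norm_eq_1)
  define \<kappa> :: "real \<Rightarrow> ennreal" where "\<kappa> = indicator {0..1}"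
  have [measurable]: "\<kappa> \<in> borel_measurable borel" by (simp add: \<kappa>_def)
  have \<kappa>: "(\<integral>\<^sup>+s. \<kappa> s \<partial>lborel) = 1" by (simp add: \<kappa>_def)
  have inner: "(\<integral>\<^sup>+s. ennreal (2 * \<bar>(x + (s - x \<bullet> e) *\<^sub>R e) \<bullet> e\<bar>) * \<Phi> (zeta e (x + (s - x \<bullet> e) *\<^sub>R e)) \<partial>lborel)
      \<le> 2 * (\<integral>\<^sup>+s. \<Phi> (x + (s - x \<bullet> e) *\<^sub>R e) \<partial>lborel)" (is "?L \<le> ?R") for x
  proof -
    define c where "c = (norm x)\<^sup>2 - (x \<bullet> e)\<^sup>2"
    define h where "h = (\<lambda>\<tau>. \<Phi> (x + (\<tau> - x \<bullet> e) *\<^sub>R e))"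
    have [measurable]: "h \<in> borel_measurable borel" unfolding h_def by measurable
    have nrm: "(norm (x + (s - x \<bullet> e) *\<^sub>R e))\<^sup>2 = c + s\<^sup>2" for s
      unfolding c_def power2_norm_eq_inner
      by (simp add: inner_add_left inner_add_right ee inner_commute algebra_simps power2_eq_square)
    have "?L = (\<integral>\<^sup>+s. ennreal (2 * \<bar>s\<bar>) * h (- (s\<^sup>2) - c) \<partial>lborel)"
    proof (rule nn_integral_cong)
      fix s
      have "(x + (s - x \<bullet> e) *\<^sub>R e) \<bullet> e = s" by (simp add: inner_add_left ee)
      moreover have "zeta e (x + (s - x \<bullet> e) *\<^sub>R e) = x + ((- (s\<^sup>2) - c) - x \<bullet> e) *\<^sub>R e"
        unfolding zeta_def nrm by (simp add: inner_add_left ee algebra_simps)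
      ultimately show "ennreal (2 * \<bar>(x + (s - x \<bullet> e) *\<^sub>R e) \<bullet> e\<bar>) * \<Phi> (zeta e (x + (s - x \<bullet> e) *\<^sub>R e)) =
         ennreal (2 * \<bar>s\<bar>) * h (- (s\<^sup>2) - c)"
        by (simp add: h_def)
    qed
    also have "\<dots> \<le> 2 * (\<integral>\<^sup>+s. h (- s - c) \<partial>lborel)"
      by (rule nn_integral_square_le[where h="\<lambda>s. h (- s - c)"]) measurable
    also have "(\<integral>\<^sup>+s. h (- s - c) \<partial>lborel) = (\<integral>\<^sup>+s. h s \<partial>lborel)"
      using nn_integral_real_affine[of h "-1" "-c"] by (simp add: algebra_simps)
    finally show ?thesis by (simp add: h_def)
  qed
  have "(\<integral>\<^sup>+\<xi>. ennreal (2 * \<bar>\<xi> \<bullet> e\<bar>) * \<Phi> (zeta e \<xi>) \<partial>lborel) =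
     (\<integral>\<^sup>+x. \<kappa> (x \<bullet> e) * (\<integral>\<^sup>+s. ennreal (2 * \<bar>(x + (s - x \<bullet> e) *\<^sub>R e) \<bullet> e\<bar>) * \<Phi> (zeta e (x + (s - x \<bullet> e) *\<^sub>R e)) \<partial>lborel) \<partial>lborel)"
    by (rule nn_integral_slice[OF e _ _ \<kappa>]) measurable
  also have "\<dots> \<le> (\<integral>\<^sup>+x. 2 * (\<kappa> (x \<bullet> e) * (\<integral>\<^sup>+s. \<Phi> (x + (s - x \<bullet> e) *\<^sub>R e) \<partial>lborel)) \<partial>lborel)"
  proof (rule nn_integral_mono)
    fix x
    show "\<kappa> (x \<bullet> e) * (\<integral>\<^sup>+s. ennreal (2 * \<bar>(x + (s - x \<bullet> e) *\<^sub>R e) \<bullet> e\<bar>) * \<Phi> (zeta e (x + (s - x \<bullet> e) *\<^sub>R e)) \<partial>lborel)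
      \<le> 2 * (\<kappa> (x \<bullet> e) * (\<integral>\<^sup>+s. \<Phi> (x + (s - x \<bullet> e) *\<^sub>R e) \<partial>lborel))"
      using mult_left_mono[OF inner[of x], of "\<kappa> (x \<bullet> e)"] by (simp only: mult.left_commute) simp
  qed
  also have "\<dots> = 2 * (\<integral>\<^sup>+\<eta>. \<Phi> \<eta> \<partial>lborel)"
    by (subst nn_integral_cmult) (auto simp: nn_integral_slice[OF e _ _ \<kappa>, of \<Phi>])
  finally show ?thesis .
qed

section \<open>Polar coordinates\<close>

lemma nn_integral_powr_to_inf:
  fixes c \<gamma> :: real
  assumes "c > 0" "\<gamma> < -1"
  shows "(\<integral>\<^sup>+b. ennreal (b powr \<gamma>) * indicator {c..} b \<partial>lborel) = ennreal (- (c powr (\<gamma>+1)) / (\<gamma>+1))"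
  by (rule nn_integral_has_integral_lebesgue'[OF _ has_integral_powr_to_inf[OF assms(2,1)]]) auto

lemma nn_integral_lborel_scale:
  fixes f :: "'a::euclidean_space \<Rightarrow> ennreal"
  assumes [measurable]: "f \<in> borel_measurable borel" and c: "c > 0"
  shows "(\<integral>\<^sup>+x. f x \<partial>lborel) = ennreal (c ^ DIM('a)) * (\<integral>\<^sup>+x. f (c *\<^sub>R x) \<partial>lborel)"
proof -
  have "(\<integral>\<^sup>+x. f x \<partial>lborel) = (\<integral>\<^sup>+x. f x \<partial>density (distr lborel borel (\<lambda>x. 0 + c *\<^sub>R x)) (\<lambda>_. ennreal (\<bar>c\<bar> ^ DIM('a))))"
    using lborel_affine[of c "0::'a"] c by simp
  also have "\<dots> = ennreal (c ^ DIM('a)) * (\<integral>\<^sup>+x. f (c *\<^sub>R x) \<partial>lborel)"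
    using c by (subst nn_integral_density) (auto simp: nn_integral_distr nn_integral_cmult)
  finally show ?thesis .
qed

lemma measurable_cis[measurable]: "cis \<in> borel_measurable borel"
  unfolding cis_conv_exp[abs_def] by measurable

lemma norm_squared_eq_sum: "(norm z)\<^sup>2 = (\<Sum>b\<in>Basis. (z \<bullet> b)\<^sup>2)"
  unfolding power2_norm_eq_inner by (subst euclidean_inner) (simp add: power2_eq_square)

text \<open>The cone measure on the unit sphere: surface measure divided by the dimension.\<close>
definition sphere_measure :: "'a::euclidean_space measure" where
  "sphere_measure = distr (density lborel (indicator (cball 0 1))) borel sgn"

lemma measurable_sgn[measurable]: "sgn \<in> borel_measurable (borel :: 'a::euclidean_space measure)"
  unfolding sgn_div_norm[abs_def] by measurable

lemma sets_sphere_measure[measurable_cong, simp]: "sets sphere_measure = sets borel"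
  and space_sphere_measure[simp]: "space sphere_measure = UNIV"
  by (auto simp: sphere_measure_def)

lemma nn_integral_sphere_measure:
  assumes [measurable]: "f \<in> borel_measurable borel"
  shows "(\<integral>\<^sup>+\<omega>. f \<omega> \<partial>sphere_measure) = (\<integral>\<^sup>+\<eta>. indicator (cball 0 1) \<eta> * f (sgn \<eta>) \<partial>lborel)"
proof -
  have [measurable]: "cball 0 1 \<in> sets (borel :: 'a measure)" by (simp add: borel_closed)
  show ?thesis unfolding sphere_measure_def
    by (subst nn_integral_distr) (auto simp: nn_integral_density)
qed

lemma finite_measure_sphere_measure: "finite_measure (sphere_measure :: 'a::euclidean_space measure)"
proof
  have [measurable]: "cball 0 1 \<in> sets (borel :: 'a measure)" by (simp add: borel_closed)
  have "emeasure sphere_measure (UNIV :: 'a set) = emeasure lborel (cball 0 1 :: 'a set)"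
    unfolding sphere_measure_def by (subst emeasure_distr) (auto simp: emeasure_density)
  then show "emeasure sphere_measure (space (sphere_measure :: 'a measure)) \<noteq> \<infinity>"
    using emeasure_lborel_cball_finite[of "0::'a" 1] by auto
qed

interpretation sph: finite_measure "sphere_measure :: 'a::euclidean_space measure"
  by (rule finite_measure_sphere_measure)

interpretation sph_pair: pair_sigma_finite "lborel :: 'a::euclidean_space measure" "sphere_measure :: 'b::euclidean_space measure" ..

lemma AE_sphere_measure_norm: "AE \<omega> in (sphere_measure :: 'a::euclidean_space measure). norm \<omega> = 1"
proof -
  have [measurable]: "cball 0 1 \<in> sets (borel :: 'a measure)" by (simp add: borel_closed)
  show ?thesis unfolding sphere_measure_def
    using AE_lborel_singleton[of "0::'a"]
    by (subst AE_distr_iff) (auto simp: AE_density norm_sgn elim: eventually_mono)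
qed

text \<open>The sphere integral is written over the unit ball in \<eta>, where only
  \<open>sgn \<eta>\<close> enters. Substituting \<open>r = norm \<eta> * s\<close> turns
  \<open>r *\<^sub>R sgn \<eta>\<close> into \<open>s *\<^sub>R \<eta>\<close>, and rescaling to
  \<open>y = s *\<^sub>R \<eta>\<close> frees f from s. The condition |\<eta>| \<le> 1 becomes s
  \<ge> |y|, and the integral of s^(-d-1) over that range cancels the factors left over.\<close>

lemma nn_integral_polar:
  fixes f :: "'a::euclidean_space \<Rightarrow> ennreal"
  assumes [measurable]: "f \<in> borel_measurable borel"
  shows "(\<integral>\<^sup>+\<xi>. f \<xi> \<partial>lborel) = (\<integral>\<^sup>+r. \<integral>\<^sup>+\<omega>. ennreal (indicator {0<..} r * real DIM('a) * r ^ (DIM('a) - 1)) * f (r *\<^sub>R \<omega>) \<partial>sphere_measure \<partial>lborel)"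
proof -
  let ?d = "DIM('a)"
  let ?B = "cball (0::'a) 1"
  have [measurable]: "?B \<in> sets borel" by (simp add: borel_closed)
  define p where "p r = ennreal (indicator {0<..} r * real ?d * r ^ (?d - 1))" for r :: real
  have [measurable]: "p \<in> borel_measurable borel" unfolding p_def by measurable
  have dpos: "?d > 0" by simp
  have "(\<integral>\<^sup>+r. \<integral>\<^sup>+\<omega>. p r * f (r *\<^sub>R \<omega>) \<partial>sphere_measure \<partial>lborel)
      = (\<integral>\<^sup>+r. \<integral>\<^sup>+\<eta>. indicator ?B \<eta> * (p r * f (r *\<^sub>R sgn \<eta>)) \<partial>lborel \<partial>lborel)"
    by (intro nn_integral_cong nn_integral_sphere_measure) measurable
  also have "\<dots> = (\<integral>\<^sup>+\<eta>. \<integral>\<^sup>+r. indicator ?B \<eta> * (p r * f (r *\<^sub>R sgn \<eta>)) \<partial>lborel \<partial>lborel)"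
    by (rule lborel_pair.Fubini') measurable
  also have "\<dots> = (\<integral>\<^sup>+\<eta>. \<integral>\<^sup>+s. p s * (indicator ?B \<eta> * ennreal (norm \<eta> ^ ?d) * f (s *\<^sub>R \<eta>)) \<partial>lborel \<partial>lborel)"
  proof (rule nn_integral_cong_AE)
    show "AE \<eta> in lborel. (\<integral>\<^sup>+r. indicator ?B \<eta> * (p r * f (r *\<^sub>R sgn \<eta>)) \<partial>lborel) = (\<integral>\<^sup>+s. p s * (indicator ?B \<eta> * ennreal (norm \<eta> ^ ?d) * f (s *\<^sub>R \<eta>)) \<partial>lborel)"
      using AE_lborel_singleton[of "0::'a"]
    proof (rule eventually_mono)
      fix \<eta> :: 'a assume \<eta>: "\<eta> \<noteq> 0"
      have "(\<integral>\<^sup>+r. indicator ?B \<eta> * (p r * f (r *\<^sub>R sgn \<eta>)) \<partial>lborel)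
        = ennreal (norm \<eta>) * (\<integral>\<^sup>+s. indicator ?B \<eta> * (p (norm \<eta> * s) * f ((norm \<eta> * s) *\<^sub>R sgn \<eta>)) \<partial>lborel)"
        by (subst nn_integral_real_affine[where c="norm \<eta>" and t=0]) (use \<eta> in auto)
      also have "\<dots> = (\<integral>\<^sup>+s. p s * (indicator ?B \<eta> * ennreal (norm \<eta> ^ ?d) * f (s *\<^sub>R \<eta>)) \<partial>lborel)"
      proof (subst nn_integral_cmult[symmetric], measurable, rule nn_integral_cong)
        fix s
        have "ennreal (norm \<eta>) * p (norm \<eta> * s) = p s * ennreal (norm \<eta> ^ ?d)"
        proof (cases "s > 0")
          case True
          have "norm \<eta> ^ ?d = norm \<eta> * norm \<eta> ^ (?d - 1)" using dpos by (metis power_minus_mult mult.commute)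
          then show ?thesis using True \<eta>
            by (simp add: p_def ennreal_mult[symmetric] power_mult_distrib mult_ac)
        next
          case False
          then have "\<not> norm \<eta> * s > 0" by (simp add: zero_less_mult_iff)
          then show ?thesis using False by (simp add: p_def)
        qed
        moreover have "(norm \<eta> * s) *\<^sub>R sgn \<eta> = s *\<^sub>R \<eta>" using \<eta> by (simp add: sgn_div_norm)
        ultimately show "ennreal (norm \<eta>) * (indicator ?B \<eta> * (p (norm \<eta> * s) * f ((norm \<eta> * s) *\<^sub>R sgn \<eta>))) =
          p s * (indicator ?B \<eta> * ennreal (norm \<eta> ^ ?d) * f (s *\<^sub>R \<eta>))"
          by (metis (no_types, lifting) mult.assoc mult.left_commute)
      qed
      finally show "(\<integral>\<^sup>+r. indicator ?B \<eta> * (p r * f (r *\<^sub>R sgn \<eta>)) \<partial>lborel) = (\<integral>\<^sup>+s. p s * (indicator ?B \<eta> * ennreal (norm \<eta> ^ ?d) * f (s *\<^sub>R \<eta>)) \<partial>lborel)" .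
    qed
  qed
  also have "\<dots> = (\<integral>\<^sup>+s. \<integral>\<^sup>+\<eta>. p s * (indicator ?B \<eta> * ennreal (norm \<eta> ^ ?d) * f (s *\<^sub>R \<eta>)) \<partial>lborel \<partial>lborel)"
    by (rule lborel_pair.Fubini') measurable
  also have "\<dots> = (\<integral>\<^sup>+s. \<integral>\<^sup>+y. f y * (ennreal (norm y ^ ?d * ?d) * (ennreal (s powr (- real ?d - 1)) * indicator {norm y..} s * indicator {0<..} s)) \<partial>lborel \<partial>lborel)"
  proof (rule nn_integral_cong)
    fix s :: real
    show "(\<integral>\<^sup>+\<eta>. p s * (indicator ?B \<eta> * ennreal (norm \<eta> ^ ?d) * f (s *\<^sub>R \<eta>)) \<partial>lborel) =
      (\<integral>\<^sup>+y. f y * (ennreal (norm y ^ ?d * ?d) * (ennreal (s powr (- real ?d - 1)) * indicator {norm y..} s * indicator {0<..} s)) \<partial>lborel)"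
    proof (cases "s > 0")
      case False then show ?thesis by (simp add: p_def)
    next
      case True
      have [measurable]: "(\<lambda>y::'a. indicator {norm y..} s :: ennreal) \<in> borel_measurable borel"
        unfolding indicator_def by (simp cong: if_cong)
      have "(\<integral>\<^sup>+y. f y * (ennreal (norm y ^ ?d * ?d) * (ennreal (s powr (- real ?d - 1)) * indicator {norm y..} s * indicator {0<..} s)) \<partial>lborel)
        = ennreal (s ^ ?d) * (\<integral>\<^sup>+\<eta>. f (s *\<^sub>R \<eta>) * (ennreal (norm (s *\<^sub>R \<eta>) ^ ?d * ?d) * (ennreal (s powr (- real ?d - 1)) * indicator {norm (s *\<^sub>R \<eta>)..} s * indicator {0<..} s)) \<partial>lborel)"
        by (rule nn_integral_lborel_scale) (use True in auto)
      also have "\<dots> = (\<integral>\<^sup>+\<eta>. p s * (indicator ?B \<eta> * ennreal (norm \<eta> ^ ?d) * f (s *\<^sub>R \<eta>)) \<partial>lborel)"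
      proof (subst nn_integral_cmult[symmetric], measurable, rule nn_integral_cong)
        fix \<eta> :: 'a
        have "s ^ ?d * (s ^ ?d * s powr (- real ?d - 1)) = s powr (real ?d + real ?d + (- real ?d - 1))"
          unfolding powr_add using True by (simp add: powr_realpow)
        also have "real ?d + real ?d + (- real ?d - 1) = real (?d - 1)" using dpos by (simp add: of_nat_diff)
        finally have e: "s ^ ?d * (s ^ ?d * s powr (- real ?d - 1)) = s ^ (?d - 1)" using True by (simp add: powr_realpow del: of_nat_diff)
        have I: "indicator {norm (s *\<^sub>R \<eta>)..} s = (indicator ?B \<eta> :: ennreal)"
          using True by (auto simp: indicator_def)
        have J: "ennreal (s ^ ?d) * (ennreal (norm (s *\<^sub>R \<eta>) ^ ?d * ?d) * ennreal (s powr (- real ?d - 1))) = p s * ennreal (norm \<eta> ^ ?d)"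
        proof -
          have "s ^ ?d * (norm (s *\<^sub>R \<eta>) ^ ?d * ?d * s powr (- real ?d - 1)) = (s ^ ?d * (s ^ ?d * s powr (- real ?d - 1))) * (?d * norm \<eta> ^ ?d)"
            using True by (simp add: power_mult_distrib mult_ac)
          also have "\<dots> = (?d * s ^ (?d - 1)) * norm \<eta> ^ ?d" unfolding e by (simp add: mult_ac)
          finally show ?thesis unfolding p_def using True by (simp add: ennreal_mult[symmetric])
        qed
        have "ennreal (s ^ ?d) * (f (s *\<^sub>R \<eta>) * (ennreal (norm (s *\<^sub>R \<eta>) ^ ?d * ?d) * (ennreal (s powr (- real ?d - 1)) * indicator {norm (s *\<^sub>R \<eta>)..} s * indicator {0<..} s))) =
           (ennreal (s ^ ?d) * (ennreal (norm (s *\<^sub>R \<eta>) ^ ?d * ?d) * ennreal (s powr (- real ?d - 1)))) * (indicator {norm (s *\<^sub>R \<eta>)..} s * f (s *\<^sub>R \<eta>))"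
          using True by (simp only: mult_ac indicator_simps greaterThan_iff mult_1_left mult_1_right simp_thms if_True)
        then show "ennreal (s ^ ?d) * (f (s *\<^sub>R \<eta>) * (ennreal (norm (s *\<^sub>R \<eta>) ^ ?d * ?d) * (ennreal (s powr (- real ?d - 1)) * indicator {norm (s *\<^sub>R \<eta>)..} s * indicator {0<..} s))) = p s * (indicator ?B \<eta> * ennreal (norm \<eta> ^ ?d) * f (s *\<^sub>R \<eta>))"
          unfolding I J by (simp only: mult_ac)
      qed
      finally show ?thesis ..
    qed
  qed
  also have "\<dots> = (\<integral>\<^sup>+y. \<integral>\<^sup>+s. f y * (ennreal (norm y ^ ?d * ?d) * (ennreal (s powr (- real ?d - 1)) * indicator {norm y..} s * indicator {0<..} s)) \<partial>lborel \<partial>lborel)"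
    by (rule lborel_pair.Fubini') (simp add: indicator_def case_prod_unfold cong: if_cong)
  also have "\<dots> = (\<integral>\<^sup>+y. f y \<partial>lborel)"
  proof (rule nn_integral_cong_AE)
    show "AE y in lborel. (\<integral>\<^sup>+s. f y * (ennreal (norm y ^ ?d * ?d) * (ennreal (s powr (- real ?d - 1)) * indicator {norm y..} s * indicator {0<..} s)) \<partial>lborel) = f y"
      using AE_lborel_singleton[of "0::'a"]
    proof (rule eventually_mono)
      fix y :: 'a assume y: "y \<noteq> 0"
      have "(\<integral>\<^sup>+s. f y * (ennreal (norm y ^ ?d * ?d) * (ennreal (s powr (- real ?d - 1)) * indicator {norm y..} s * indicator {0<..} s)) \<partial>lborel) =
        (\<integral>\<^sup>+s. f y * (ennreal (norm y ^ ?d * ?d) * (ennreal (s powr (- real ?d - 1)) * indicator {norm y..} s)) \<partial>lborel)"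
      proof (rule nn_integral_cong)
        fix s :: real
        have "0 < s" if "norm y \<le> s" using that y zero_less_norm_iff[of y] by linarith
        then show "f y * (ennreal (norm y ^ ?d * ?d) * (ennreal (s powr (- real ?d - 1)) * indicator {norm y..} s * indicator {0<..} s)) =
          f y * (ennreal (norm y ^ ?d * ?d) * (ennreal (s powr (- real ?d - 1)) * indicator {norm y..} s))"
          by (cases "norm y \<le> s") simp_all
      qed
      also have "\<dots> = f y * (ennreal (norm y ^ ?d * ?d) * (\<integral>\<^sup>+s. ennreal (s powr (- real ?d - 1)) * indicator {norm y..} s \<partial>lborel))"
        by (simp add: nn_integral_cmult)
      also have "(\<integral>\<^sup>+s. ennreal (s powr (- real ?d - 1)) * indicator {norm y..} s \<partial>lborel) = ennreal (norm y powr (- real ?d) / ?d)"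
        by (subst nn_integral_powr_to_inf) (use y in auto)
      also have "ennreal (norm y ^ ?d * ?d) * ennreal (norm y powr (- real ?d) / ?d) = 1"
        using y by (simp add: ennreal_mult[symmetric] powr_minus powr_realpow)
      finally show "(\<integral>\<^sup>+s. f y * (ennreal (norm y ^ ?d * ?d) * (ennreal (s powr (- real ?d - 1)) * indicator {norm y..} s * indicator {0<..} s)) \<partial>lborel) = f y"
        by simp
    qed
  qed
  finally show ?thesis by (simp add: p_def)
qed

text \<open>\<open>nn_integral_polar\<close> says that a weighted product measure has Lebesgue
  measure as its image under \<open>(r, \<omega>) \<mapsto> r *\<^sub>R \<omega>\<close>; complex
  integrands are transported through this equality of measures.\<close>

lemma integral_polar:
  fixes f :: "'a::euclidean_space \<Rightarrow> complex"
  assumes f: "integrable lborel f"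
  shows "(\<integral>\<xi>. f \<xi> \<partial>lborel) = (\<integral>r. (\<integral>\<omega>. (indicator {0<..} r * real DIM('a) * r ^ (DIM('a) - 1)) *\<^sub>R f (r *\<^sub>R \<omega>) \<partial>sphere_measure) \<partial>lborel)"
proof -
  have [measurable]: "f \<in> borel_measurable borel" using f borel_measurable_integrable by force
  define p where "p r = indicator {0<..} r * real DIM('a) * r ^ (DIM('a) - 1)" for r :: real
  have [measurable]: "p \<in> borel_measurable borel" unfolding p_def by measurable
  have p0: "p r \<ge> 0" for r by (auto simp: p_def indicator_def)
  define Q where "Q = density (lborel \<Otimes>\<^sub>M (sphere_measure :: 'a measure)) (\<lambda>z. ennreal (p (fst z)))"
  have [measurable]: "(\<lambda>z. fst z *\<^sub>R snd z) \<in> borel_measurable (lborel \<Otimes>\<^sub>M (sphere_measure :: 'a measure))"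
    by measurable
  have Q: "distr Q borel (\<lambda>z. fst z *\<^sub>R snd z) = (lborel :: 'a measure)"
  proof (rule measure_eqI)
    fix A assume "A \<in> sets (distr Q borel (\<lambda>z. fst z *\<^sub>R snd z :: 'a))"
    then have [measurable]: "A \<in> sets borel" by simp
    have "emeasure (distr Q borel (\<lambda>z. fst z *\<^sub>R snd z)) A = (\<integral>\<^sup>+z. indicator A (fst z *\<^sub>R snd z) \<partial>Q)"
      by (subst nn_integral_indicator[symmetric], simp) (subst nn_integral_distr, auto simp: Q_def)
    also have "\<dots> = (\<integral>\<^sup>+z. ennreal (p (fst z)) * indicator A (fst z *\<^sub>R snd z) \<partial>(lborel \<Otimes>\<^sub>M sphere_measure))"
      unfolding Q_def by (rule nn_integral_density) measurable
    also have "\<dots> = (\<integral>\<^sup>+r. \<integral>\<^sup>+\<omega>. ennreal (p r) * indicator A (r *\<^sub>R \<omega>) \<partial>sphere_measure \<partial>lborel)"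
      by (subst sph.nn_integral_fst[symmetric]) auto
    also have "\<dots> = emeasure lborel A" unfolding p_def by (subst nn_integral_polar[symmetric]) auto
    finally show "emeasure (distr Q borel (\<lambda>z. fst z *\<^sub>R snd z)) A = emeasure lborel A" .
  qed simp
  have i1: "integrable Q (\<lambda>z. f (fst z *\<^sub>R snd z))"
    using f unfolding Q[symmetric] by (subst (asm) integrable_distr_eq) (auto simp: Q_def)
  then have i2: "integrable (lborel \<Otimes>\<^sub>M sphere_measure) (\<lambda>z. p (fst z) *\<^sub>R f (fst z *\<^sub>R snd z))"
    unfolding Q_def by (subst (asm) integrable_density) (auto simp: p0)
  have "(\<integral>\<xi>. f \<xi> \<partial>lborel) = (\<integral>z. f (fst z *\<^sub>R snd z) \<partial>Q)"
    by (subst Q[symmetric], rule integral_distr) (auto simp: Q_def)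
  also have "\<dots> = (\<integral>z. p (fst z) *\<^sub>R f (fst z *\<^sub>R snd z) \<partial>(lborel \<Otimes>\<^sub>M sphere_measure))"
    unfolding Q_def by (rule integral_density) (auto simp: p0)
  also have "\<dots> = (\<integral>r. (\<integral>\<omega>. p r *\<^sub>R f (r *\<^sub>R \<omega>) \<partial>sphere_measure) \<partial>lborel)"
    using sph_pair.integral_fst'[OF i2] by simp
  finally show ?thesis by (simp add: p_def)
qed

lemma integral_sphere_measure_isometry:
  fixes f :: "'a::euclidean_space \<Rightarrow> complex" and T :: "'a \<Rightarrow> 'a"
  assumes lin: "linear T" and nrm: "\<And>x. norm (T x) = norm x" and [measurable]: "f \<in> borel_measurable borel"
  shows "(\<integral>\<omega>. f (T \<omega>) \<partial>sphere_measure) = (\<integral>\<omega>. f \<omega> \<partial>sphere_measure)"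
proof -
  have [measurable]: "cball 0 1 \<in> sets (borel :: 'a measure)" by (simp add: borel_closed)
  have T[measurable]: "T \<in> borel_measurable borel"
    by (intro borel_measurable_continuous_onI linear_continuous_on) (simp add: lin linear_conv_bounded_linear[symmetric])
  have eq: "(\<integral>\<omega>. g \<omega> \<partial>sphere_measure) = (\<integral>\<eta>. indicator (cball 0 1) \<eta> *\<^sub>R g (sgn \<eta>) \<partial>lborel)"
    if [measurable]: "g \<in> borel_measurable borel" for g :: "'a \<Rightarrow> complex"
    unfolding sphere_measure_def
    by (subst integral_distr, simp, simp, subst integral_density[where g="indicator (cball 0 1)", simplified ennreal_indicator]) auto
  have "(\<integral>\<omega>. f \<omega> \<partial>sphere_measure) = (\<integral>\<eta>. indicator (cball 0 1) \<eta> *\<^sub>R f (sgn \<eta>) \<partial>lborel)"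
    by (rule eq) simp
  also have "\<dots> = (\<integral>\<eta>. indicator (cball 0 1) \<eta> *\<^sub>R f (sgn \<eta>) \<partial>distr lborel borel T)"
    unfolding lborel_distr_isometry[OF lin nrm] ..
  also have "\<dots> = (\<integral>\<eta>. indicator (cball 0 1) (T \<eta>) *\<^sub>R f (sgn (T \<eta>)) \<partial>lborel)"
    by (rule integral_distr) auto
  also have "\<dots> = (\<integral>\<eta>. indicator (cball 0 1) \<eta> *\<^sub>R f (T (sgn \<eta>)) \<partial>lborel)"
    by (rule Bochner_Integration.integral_cong) (auto simp: indicator_def nrm sgn_div_norm linear_cmul[OF lin])
  also have "\<dots> = (\<integral>\<omega>. f (T \<omega>) \<partial>sphere_measure)"
    by (rule eq[symmetric]) simp
  finally show ?thesis ..
qed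

text \<open>The phase \<alpha> is free, so a shift by \<open>pi/2\<close> lets the same lemma
  differentiate sines. A second-order Taylor bound, integrated over the finite measure, shows that
  the difference quotient converges with error at most \<open>K * \<bar>k\<bar>\<close>.\<close>

lemma has_real_derivative_integral_cos:
  fixes \<alpha> \<beta> \<gamma> :: "'b \<Rightarrow> real"
  assumes "finite_measure M" and [measurable]: "\<alpha> \<in> borel_measurable M" "\<beta> \<in> borel_measurable M" "\<gamma> \<in> borel_measurable M"
    and \<beta>: "AE z in M. \<bar>\<beta> z\<bar> \<le> b" and \<gamma>: "AE z in M. \<bar>\<gamma> z\<bar> \<le> c" and b: "b \<ge> 0" "c \<ge> 0"
  shows "((\<lambda>h. \<integral>z. \<gamma> z * cos (\<alpha> z + h * \<beta> z) \<partial>M) has_real_derivative (\<integral>z. - (\<gamma> z * \<beta> z * sin (\<alpha> z + h * \<beta> z)) \<partial>M)) (at h)"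
proof -
  interpret finite_measure M by fact
  define F where "F h = (\<integral>z. \<gamma> z * cos (\<alpha> z + h * \<beta> z) \<partial>M)" for h
  define D where "D = (\<integral>z. - (\<gamma> z * \<beta> z * sin (\<alpha> z + h * \<beta> z)) \<partial>M)"
  define K where "K = c * b\<^sup>2 * measure M (space M)"
  have i1: "integrable M (\<lambda>z. \<gamma> z * cos (\<alpha> z + h * \<beta> z))" for h
  proof (rule integrable_const_bound[of _ c])
    show "AE z in M. norm (\<gamma> z * cos (\<alpha> z + h * \<beta> z)) \<le> c" using \<gamma>
    proof eventually_elim
      fix z assume "\<bar>\<gamma> z\<bar> \<le> c"
      from mult_mono[OF this abs_cos_le_one[of "\<alpha> z + h * \<beta> z"]] b
      show "norm (\<gamma> z * cos (\<alpha> z + h * \<beta> z)) \<le> c" by (simp add: abs_mult)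
    qed
  qed simp
  have i2: "integrable M (\<lambda>z. - (\<gamma> z * \<beta> z * sin (\<alpha> z + h * \<beta> z)))"
  proof (rule integrable_const_bound[of _ "c * b"])
    show "AE z in M. norm (- (\<gamma> z * \<beta> z * sin (\<alpha> z + h * \<beta> z))) \<le> c * b" using \<gamma> \<beta>
    proof eventually_elim
      fix z assume "\<bar>\<gamma> z\<bar> \<le> c" "\<bar>\<beta> z\<bar> \<le> b"
      from mult_mono[OF mult_mono[OF this] abs_sin_le_one[of "\<alpha> z + h * \<beta> z"]] b
      show "norm (- (\<gamma> z * \<beta> z * sin (\<alpha> z + h * \<beta> z))) \<le> c * b" by (simp add: abs_mult)
    qed
  qed simp
  have taylor: "\<bar>cos (y + z) - cos y + z * sin y\<bar> \<le> z\<^sup>2" for y z :: real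
  proof -
    have "cos (y + z) - cos y + z * sin y = Re (cis y * (iexp z - (\<Sum>k\<le>1. (\<i> * z) ^ k / fact k)))"
      by (simp add: cis_conv_exp[symmetric] cos_add algebra_simps)
    also have "\<bar>\<dots>\<bar> \<le> norm (cis y * (iexp z - (\<Sum>k\<le>1. (\<i> * z) ^ k / fact k)))"
      by (rule abs_Re_le_cmod)
    also have "\<dots> \<le> \<bar>z\<bar> ^ Suc 1 / fact (Suc 1)"
      unfolding norm_mult norm_cis mult_1 by (rule iexp_approx1)
    also have "\<dots> \<le> z\<^sup>2" by (simp add: power2_eq_square)
    finally show ?thesis .
  qed
  have est: "\<bar>F (h + k) - F h - k * D\<bar> \<le> K * k\<^sup>2" for k
  proof -
    have "F (h + k) - F h - k * D = (\<integral>z. \<gamma> z * cos (\<alpha> z + (h + k) * \<beta> z) - \<gamma> z * cos (\<alpha> z + h * \<beta> z) - k * - (\<gamma> z * \<beta> z * sin (\<alpha> z + h * \<beta> z)) \<partial>M)"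
      unfolding F_def D_def using i1 i2 by simp
    also have "\<bar>\<dots>\<bar> \<le> (\<integral>z. c * b\<^sup>2 * k\<^sup>2 \<partial>M)"
    proof (rule order_trans[OF integral_abs_bound], rule integral_mono_AE)
      show "integrable M (\<lambda>z. \<bar>\<gamma> z * cos (\<alpha> z + (h + k) * \<beta> z) - \<gamma> z * cos (\<alpha> z + h * \<beta> z) - k * - (\<gamma> z * \<beta> z * sin (\<alpha> z + h * \<beta> z))\<bar>)"
        using i1 i2 by (intro integrable_abs Bochner_Integration.integrable_diff integrable_mult_right) auto
      show "AE z in M. \<bar>\<gamma> z * cos (\<alpha> z + (h + k) * \<beta> z) - \<gamma> z * cos (\<alpha> z + h * \<beta> z) - k * - (\<gamma> z * \<beta> z * sin (\<alpha> z + h * \<beta> z))\<bar> \<le> c * b\<^sup>2 * k\<^sup>2"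
        using \<beta> \<gamma>
      proof eventually_elim
        fix z assume z: "\<bar>\<beta> z\<bar> \<le> b" "\<bar>\<gamma> z\<bar> \<le> c"
        have "\<gamma> z * cos (\<alpha> z + (h + k) * \<beta> z) - \<gamma> z * cos (\<alpha> z + h * \<beta> z) - k * - (\<gamma> z * \<beta> z * sin (\<alpha> z + h * \<beta> z))
          = \<gamma> z * (cos ((\<alpha> z + h * \<beta> z) + k * \<beta> z) - cos (\<alpha> z + h * \<beta> z) + (k * \<beta> z) * sin (\<alpha> z + h * \<beta> z))"
          by (simp add: algebra_simps)
        also have "\<bar>\<dots>\<bar> \<le> c * (k * \<beta> z)\<^sup>2"
          unfolding abs_mult[of "\<gamma> z"] by (rule mult_mono[OF z(2) taylor]) (use b in auto)
        also have "\<dots> \<le> c * (b\<^sup>2 * k\<^sup>2)"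
          using mult_right_mono[OF power_mono[OF z(1), of 2], of "k\<^sup>2"] b
          by (intro mult_left_mono) (auto simp: power_mult_distrib mult.commute)
        finally show "\<bar>\<gamma> z * cos (\<alpha> z + (h + k) * \<beta> z) - \<gamma> z * cos (\<alpha> z + h * \<beta> z) - k * - (\<gamma> z * \<beta> z * sin (\<alpha> z + h * \<beta> z))\<bar> \<le> c * b\<^sup>2 * k\<^sup>2"
          by (simp only: mult.assoc)
      qed
      show "integrable M (\<lambda>z. c * b\<^sup>2 * k\<^sup>2)" by (rule integrable_const)
    qed
    also have "\<dots> = K * k\<^sup>2" unfolding lebesgue_integral_const K_def by (simp only: real_scaleR_def mult_ac)
    finally show ?thesis .
  qed
  have "(F has_real_derivative D) (at h)"
    unfolding DERIV_def
  proof (rule LIM_zero_cancel, rule tendsto_rabs_zero_cancel, rule tendsto_sandwich)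
    show "\<forall>\<^sub>F k in at 0. 0 \<le> \<bar>(F (h + k) - F h) / k - D\<bar>" by simp
    show "\<forall>\<^sub>F k in at 0. \<bar>(F (h + k) - F h) / k - D\<bar> \<le> K * \<bar>k\<bar>"
    proof (rule eventually_at_filter[THEN iffD2], rule always_eventually, intro allI impI)
      fix k :: real assume k: "k \<noteq> 0"
      have "\<bar>(F (h + k) - F h) / k - D\<bar> = \<bar>F (h + k) - F h - k * D\<bar> / \<bar>k\<bar>"
        using k by (subst abs_divide[symmetric]) (simp add: diff_divide_distrib)
      also have "\<dots> \<le> K * k\<^sup>2 / \<bar>k\<bar>" by (rule divide_right_mono[OF est]) simp
      also have "\<dots> = K * \<bar>k\<bar>" using k by (simp add: power2_eq_square abs_if)
      finally show "\<bar>(F (h + k) - F h) / k - D\<bar> \<le> K * \<bar>k\<bar>" .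
    qed
    show "((\<lambda>k. K * \<bar>k\<bar>) \<longlongrightarrow> 0) (at 0)" by (auto intro!: tendsto_eq_intros)
  qed simp
  then show ?thesis by (simp add: F_def[abs_def] D_def)
qed

section \<open>Oscillatory integrals over the sphere\<close>

text \<open>The reflection in the hyperplane orthogonal to \<open>x - y\<close>. Besides being an
  isometry it is symmetric, which lets it pass from the frequency to the integration variable on the
  sphere.\<close>

lemma isometry_norm_eq:
  fixes x y :: "'a::euclidean_space"
  assumes xy: "norm x = norm y"
  obtains T where "linear T" "\<And>z. norm (T z) = norm z" "\<And>z. T x \<bullet> z = x \<bullet> T z" "T x = y"
proof (cases "x = y")
  case True
  then show ?thesis using that[of id] by (auto intro: linear_id[unfolded id_def] simp: id_def)
next
  case False
  define v where "v = x - y"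
  define T where "T z = z - (2 * (z \<bullet> v) / (v \<bullet> v)) *\<^sub>R v" for z
  have v: "v \<bullet> v \<noteq> 0" using False by (simp add: v_def)
  have xx: "x \<bullet> x = y \<bullet> y" using xy by (metis power2_norm_eq_inner)
  have vv: "v \<bullet> v = 2 * (x \<bullet> v)" by (simp add: v_def inner_diff_left inner_diff_right xx inner_commute)
  show ?thesis
  proof (rule that[of T])
    show "linear T" by (rule linearI) (auto simp: T_def inner_add_left algebra_simps add_divide_distrib)
    show "norm (T z) = norm z" for z
    proof -
      have "T z \<bullet> T z = z \<bullet> z - 2 * (2 * (z \<bullet> v) / (v \<bullet> v)) * (z \<bullet> v) + (2 * (z \<bullet> v) / (v \<bullet> v))\<^sup>2 * (v \<bullet> v)"
        by (simp add: T_def inner_diff_left inner_diff_right inner_commute power2_eq_square algebra_simps)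
      also have "\<dots> = z \<bullet> z" using v by (simp add: field_simps power2_eq_square)
      finally show ?thesis by (simp add: norm_eq_sqrt_inner)
    qed
    show "T x \<bullet> z = x \<bullet> T z" for z
      by (simp add: T_def inner_diff_left inner_diff_right inner_commute)
    show "T x = y" using v vv by (simp add: T_def) (simp add: v_def)
  qed
qed

text \<open>The Fourier transform of the cone measure, whose sine part vanishes by symmetry: up to a
  constant it is |x|^(1 - d/2) times the Bessel function of order d/2 - 1 at |x|.\<close>

definition sphere_cos :: "'a::euclidean_space \<Rightarrow> real" where
  "sphere_cos x = (\<integral>\<omega>. cos (x \<bullet> \<omega>) \<partial>sphere_measure)"

text \<open>Minus the second derivative of \<open>sphere_cos\<close> in direction v. The square is
  the angular factor of the weight attached to the slicing direction v.\<close>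

definition sphere_cos2 :: "'a::euclidean_space \<Rightarrow> 'a \<Rightarrow> real" where
  "sphere_cos2 v x = (\<integral>\<omega>. (v \<bullet> \<omega>)\<^sup>2 * cos (x \<bullet> \<omega>) \<partial>sphere_measure)"

lemma sphere_cos_norm_cong:
  fixes x y :: "'a::euclidean_space"
  assumes "norm x = norm y"
  shows "sphere_cos x = sphere_cos y"
proof -
  obtain T where T: "linear T" "\<And>z. norm (T z) = norm z" "\<And>z. T x \<bullet> z = x \<bullet> T z" "T x = y"
    using isometry_norm_eq[OF assms] by blast
  have "complex_of_real (sphere_cos y) = (\<integral>\<omega>. of_real (cos (x \<bullet> T \<omega>)) \<partial>sphere_measure)"
    by (simp add: sphere_cos_def T(3)[symmetric] T(4))
  also have "\<dots> = (\<integral>\<omega>. of_real (cos (x \<bullet> \<omega>)) \<partial>sphere_measure)"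
    by (rule integral_sphere_measure_isometry[OF T(1,2)]) measurable
  also have "\<dots> = complex_of_real (sphere_cos x)" by (simp add: sphere_cos_def)
  finally show ?thesis by simp
qed

text \<open>The integrand is odd under \<open>\<omega> \<mapsto> - \<omega>\<close>, which preserves
  the measure; hence the weighted transform of the sphere is real.\<close>

lemma integral_sphere_sin_eq_0:
  fixes x v :: "'a::euclidean_space"
  shows "(\<integral>\<omega>. (v \<bullet> \<omega>)\<^sup>2 * sin (x \<bullet> \<omega>) \<partial>sphere_measure) = 0" (is "?I = 0")
proof -
  have "(\<integral>\<omega>. complex_of_real ((v \<bullet> (- \<omega>))\<^sup>2 * sin (x \<bullet> (- \<omega>))) \<partial>sphere_measure) = (\<integral>\<omega>. of_real ((v \<bullet> \<omega>)\<^sup>2 * sin (x \<bullet> \<omega>)) \<partial>sphere_measure)"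
    by (rule integral_sphere_measure_isometry[of uminus "\<lambda>\<omega>. of_real ((v \<bullet> \<omega>)\<^sup>2 * sin (x \<bullet> \<omega>))"]) (auto intro: linear_uminus)
  then have "complex_of_real (\<integral>\<omega>. ((v \<bullet> (- \<omega>))\<^sup>2 * sin (x \<bullet> (- \<omega>))) \<partial>sphere_measure) = of_real ?I"
    by (simp only: integral_complex_of_real)
  then show ?thesis by simp
qed

lemma AE_sphere_inner_le: "AE \<omega> in sphere_measure. \<bar>v \<bullet> \<omega>\<bar> \<le> norm (v :: 'a::euclidean_space)"
  using AE_sphere_measure_norm
proof eventually_elim
  fix \<omega> :: 'a assume "norm \<omega> = 1"
  then show "\<bar>v \<bullet> \<omega>\<bar> \<le> norm v" using Cauchy_Schwarz_ineq2[of v \<omega>] by simp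
qed

lemma sphere_cos_has_derivative:
  fixes x v :: "'a::euclidean_space"
  shows "((\<lambda>h. sphere_cos (x + h *\<^sub>R v)) has_real_derivative (\<integral>\<omega>. - ((v \<bullet> \<omega>) * sin ((x + h *\<^sub>R v) \<bullet> \<omega>)) \<partial>sphere_measure)) (at h)"
  using has_real_derivative_integral_cos[OF finite_measure_sphere_measure, of "\<lambda>\<omega>. x \<bullet> \<omega>" "\<lambda>\<omega>. v \<bullet> \<omega>" "\<lambda>_. 1" "norm v" 1 h]
    AE_sphere_inner_le[of v]
  by (simp add: sphere_cos_def[abs_def] inner_add_left)

lemma cos_add_pi_half: "cos (a + pi/2 + b) = - sin (a + b)" and sin_add_pi_half: "sin (a + pi/2 + b) = cos (a + b)" for a b :: real
  unfolding cos_add sin_add by simp_all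

lemma sphere_cos_has_derivative2:
  fixes x v :: "'a::euclidean_space"
  shows "((\<lambda>h. \<integral>\<omega>. - ((v \<bullet> \<omega>) * sin ((x + h *\<^sub>R v) \<bullet> \<omega>)) \<partial>sphere_measure) has_real_derivative - sphere_cos2 v (x + h *\<^sub>R v)) (at h)"
  using has_real_derivative_integral_cos[OF finite_measure_sphere_measure, of "\<lambda>\<omega>. x \<bullet> \<omega> + pi/2" "\<lambda>\<omega>. v \<bullet> \<omega>" "\<lambda>\<omega>. v \<bullet> \<omega>" "norm v" "norm v" h]
    AE_sphere_inner_le[of v]
  by (simp add: sphere_cos2_def[abs_def] inner_add_left cos_add_pi_half sin_add_pi_half power2_eq_square)

section \<open>The radial profile and the Bessel equation\<close>

context
  fixes e :: "'a::euclidean_space"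
  assumes e: "norm e = 1"
begin

definition radial0 :: "real \<Rightarrow> real" where "radial0 r = sphere_cos (r *\<^sub>R e)"
definition radial1 :: "real \<Rightarrow> real" where "radial1 r = (\<integral>\<omega>. - ((e \<bullet> \<omega>) * sin ((r *\<^sub>R e) \<bullet> \<omega>)) \<partial>sphere_measure)"
definition radial2 :: "real \<Rightarrow> real" where "radial2 r = - sphere_cos2 e (r *\<^sub>R e)"

lemma radial_has_derivative: "(radial0 has_real_derivative radial1 r) (at r)" "(radial1 has_real_derivative radial2 r) (at r)"
  using sphere_cos_has_derivative[of 0 e r] sphere_cos_has_derivative2[of e 0 r]
  unfolding radial0_def[abs_def] radial1_def[abs_def] radial2_def by (simp_all only: add_0_left)

lemma sphere_cos_radial0: "sphere_cos (x::'a) = radial0 (norm x)"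
  unfolding radial0_def by (rule sphere_cos_norm_cong) (simp add: e)

text \<open>Both sides are the second derivative of \<open>sphere_cos (x + h v)\<close> at \<open>h = 0\<close>.\<close>
lemma sphere_cos2_radial:
  assumes x: "x \<noteq> (0::'a)"
  shows "- sphere_cos2 v x = radial2 (norm x) * (x \<bullet> v)\<^sup>2 / (norm x)\<^sup>2 + radial1 (norm x) * ((v \<bullet> v) / norm x - (x \<bullet> v)\<^sup>2 / norm x ^ 3)"
proof -
  define \<rho> where "\<rho> h = norm (x + h *\<^sub>R v)" for h
  define \<rho>' where "\<rho>' h = ((x + h *\<^sub>R v) \<bullet> v) / \<rho> h" for h
  define D1 where "D1 h = (\<integral>\<omega>. - ((v \<bullet> \<omega>) * sin ((x + h *\<^sub>R v) \<bullet> \<omega>)) \<partial>sphere_measure)" for h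
  have \<rho>0: "\<rho> 0 = norm x" "\<rho> 0 > 0" using x by (auto simp: \<rho>_def)
  have d\<rho>: "(\<rho> has_real_derivative \<rho>' h) (at h)" if "\<rho> h > 0" for h
  proof -
    have sq: "\<rho> h = sqrt ((x + h *\<^sub>R v) \<bullet> (x + h *\<^sub>R v))" for h by (simp add: \<rho>_def norm_eq_sqrt_inner)
    have pos: "(x + h *\<^sub>R v) \<bullet> (x + h *\<^sub>R v) > 0" using that by (simp add: \<rho>_def)
    have "((\<lambda>h. (x + h *\<^sub>R v) \<bullet> (x + h *\<^sub>R v)) has_real_derivative 2 * ((x + h *\<^sub>R v) \<bullet> v)) (at h)"
      unfolding inner_add_left inner_add_right inner_scaleR_left inner_scaleR_right
      by (auto intro!: derivative_eq_intros simp: inner_commute)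
    from DERIV_chain2[OF DERIV_real_sqrt[OF pos] this]
    show ?thesis unfolding \<rho>'_def sq by (simp add: field_simps)
  qed
  have ev: "eventually (\<lambda>h. \<rho> h > 0) (at 0)" "eventually (\<lambda>h. \<rho> h > 0) (nhds 0)"
  proof -
    have "isCont \<rho> 0" unfolding \<rho>_def by (intro continuous_intros)
    then have "(\<rho> \<longlongrightarrow> \<rho> 0) (nhds 0)" by (simp add: continuous_at tendsto_at_iff_tendsto_nhds)
    then show "eventually (\<lambda>h. \<rho> h > 0) (nhds 0)" using \<rho>0(2) by (rule order_tendstoD)
    then show "eventually (\<lambda>h. \<rho> h > 0) (at 0)" by (simp add: eventually_at_filter eventually_mono)
  qed
  have first: "D1 h = radial1 (\<rho> h) * \<rho>' h" if "\<rho> h > 0" for h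
  proof -
    have "((\<lambda>h. radial0 (\<rho> h)) has_real_derivative radial1 (\<rho> h) * \<rho>' h) (at h)"
      by (rule DERIV_chain2[OF radial_has_derivative(1) d\<rho>[OF that]])
    moreover have "((\<lambda>h. radial0 (\<rho> h)) has_real_derivative D1 h) (at h)"
      using sphere_cos_has_derivative[of x v h] by (simp add: D1_def sphere_cos_radial0 \<rho>_def)
    ultimately show ?thesis using DERIV_unique by blast
  qed
  have "(D1 has_real_derivative - sphere_cos2 v (x + 0 *\<^sub>R v)) (at 0)"
    unfolding D1_def by (rule sphere_cos_has_derivative2)
  \<comment> \<open>The identity \<open>first\<close> is available only near h = 0, where \<rho>
    stays positive; the derivative at 0 sees no more than that.\<close>
  then have "((\<lambda>h. radial1 (\<rho> h) * \<rho>' h) has_real_derivative - sphere_cos2 v x) (at 0)"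
    by (subst (asm) DERIV_cong_ev[OF refl _ refl, of _ "\<lambda>h. radial1 (\<rho> h) * \<rho>' h"]) (use ev(2) first in \<open>auto elim: eventually_mono\<close>)
  moreover have "((\<lambda>h. radial1 (\<rho> h) * \<rho>' h) has_real_derivative
      radial1 (\<rho> 0) * ((v \<bullet> v * \<rho> 0 - (x \<bullet> v) * \<rho>' 0) / (\<rho> 0 * \<rho> 0)) + radial2 (\<rho> 0) * \<rho>' 0 * \<rho>' 0) (at 0)"
  proof (rule DERIV_mult'[OF DERIV_chain2[OF radial_has_derivative(2) d\<rho>[OF \<rho>0(2)]]])
    have "((\<lambda>h. (x + h *\<^sub>R v) \<bullet> v) has_real_derivative v \<bullet> v) (at 0)"
      unfolding inner_add_left inner_scaleR_left by (auto intro!: derivative_eq_intros)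
    from DERIV_divide[OF this d\<rho>[OF \<rho>0(2)]] \<rho>0(2)
    show "(\<rho>' has_real_derivative (v \<bullet> v * \<rho> 0 - (x \<bullet> v) * \<rho>' 0) / (\<rho> 0 * \<rho> 0)) (at 0)"
      unfolding \<rho>'_def[abs_def] by simp
  qed
  ultimately have "- sphere_cos2 v x = radial1 (\<rho> 0) * ((v \<bullet> v * \<rho> 0 - (x \<bullet> v) * \<rho>' 0) / (\<rho> 0 * \<rho> 0)) + radial2 (\<rho> 0) * \<rho>' 0 * \<rho>' 0"
    using DERIV_unique by blast
  then show ?thesis using x unfolding \<rho>0(1) by (simp add: \<rho>'_def \<rho>0(1) field_simps power2_eq_square power3_eq_cube)
qed

text \<open>\<open>sphere_cos2_radial\<close> is summed over an orthonormal basis. As the squares (b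
  \<bullet> \<omega>)^2 add up to 1 on the sphere, one side becomes minus the function itself, and
  the other is the Laplacian of a radial function: this is the Helmholtz equation.\<close>

lemma radial_ode:
  assumes r: "r > 0"
  shows "radial2 r = - radial0 r - (real DIM('a) - 1) / r * radial1 r"
proof -
  define x where "x = r *\<^sub>R e"
  have x: "norm x = r" "x \<noteq> 0" using r e by (auto simp: x_def)
  have int: "integrable sphere_measure (\<lambda>\<omega>. (v \<bullet> \<omega>)\<^sup>2 * cos (x \<bullet> \<omega>))" for v
  proof (rule sph.integrable_const_bound[of _ "(norm v)\<^sup>2 * 1"])
    show "AE \<omega> in sphere_measure. norm ((v \<bullet> \<omega>)\<^sup>2 * cos (x \<bullet> \<omega>)) \<le> (norm v)\<^sup>2 * 1"
      using AE_sphere_inner_le[of v]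
    proof eventually_elim
      fix \<omega> :: 'a assume "\<bar>v \<bullet> \<omega>\<bar> \<le> norm v"
      then have "\<bar>v \<bullet> \<omega>\<bar>\<^sup>2 \<le> (norm v)\<^sup>2" by (intro power_mono) auto
      then show "norm ((v \<bullet> \<omega>)\<^sup>2 * cos (x \<bullet> \<omega>)) \<le> (norm v)\<^sup>2 * 1"
        unfolding norm_mult by (intro mult_mono) auto
    qed
  qed measurable
  have "(\<Sum>b\<in>Basis. sphere_cos2 b x) = (\<integral>\<omega>. (\<Sum>b\<in>Basis. (b \<bullet> \<omega>)\<^sup>2 * cos (x \<bullet> \<omega>)) \<partial>sphere_measure)"
    unfolding sphere_cos2_def using int by (subst Bochner_Integration.integral_sum) auto
  also have "\<dots> = (\<integral>\<omega>. cos (x \<bullet> \<omega>) \<partial>sphere_measure)"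
  proof (rule integral_cong_AE)
    show "AE \<omega> in sphere_measure. (\<Sum>b\<in>Basis. (b \<bullet> \<omega>)\<^sup>2 * cos (x \<bullet> \<omega>)) = cos (x \<bullet> \<omega>)"
      using AE_sphere_measure_norm
      by eventually_elim (simp add: sum_distrib_right[symmetric] norm_squared_eq_sum[symmetric] inner_commute[of _ "_ :: 'a"] flip: norm_squared_eq_sum)
  qed measurable
  also have "\<dots> = radial0 r" using sphere_cos_radial0[of x] x by (simp add: sphere_cos_def)
  finally have "- radial0 r = (\<Sum>b\<in>Basis. - sphere_cos2 b x)" by (simp add: sum_negf)
  also have "\<dots> = (\<Sum>b\<in>Basis. radial2 r / r\<^sup>2 * (x \<bullet> b)\<^sup>2 + (radial1 r / r - radial1 r / r ^ 3 * (x \<bullet> b)\<^sup>2))"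
    using r by (intro sum.cong refl) (simp add: sphere_cos2_radial[OF x(2)] x(1) algebra_simps)
  also have "\<dots> = radial2 r / r\<^sup>2 * (norm x)\<^sup>2 + (real DIM('a) * (radial1 r / r) - radial1 r / r ^ 3 * (norm x)\<^sup>2)"
    by (simp only: sum.distrib sum_subtractf sum_distrib_left[symmetric] norm_squared_eq_sum[symmetric] sum_constant)
  also have "\<dots> = radial2 r + (real DIM('a) - 1) / r * radial1 r"
    unfolding x(1) using r by (simp add: power2_eq_square power3_eq_cube field_simps)
  finally show ?thesis by simp
qed

end

lemma abs_integral_sphere_le:
  fixes f :: "'a::euclidean_space \<Rightarrow> real"
  assumes "AE \<omega> in sphere_measure. \<bar>f \<omega>\<bar> \<le> c" "c \<ge> 0"
  shows "\<bar>\<integral>\<omega>. f \<omega> \<partial>sphere_measure\<bar> \<le> c * measure sphere_measure (UNIV :: 'a set)"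
proof -
  have "\<bar>\<integral>\<omega>. f \<omega> \<partial>sphere_measure\<bar> \<le> (\<integral>\<omega>. \<bar>f \<omega>\<bar> \<partial>sphere_measure)" by (rule integral_abs_bound)
  also have "\<dots> \<le> (\<integral>\<omega>. c \<partial>(sphere_measure :: 'a measure))"
    by (rule integral_mono_AE') (use assms in auto)
  finally show ?thesis by (simp add: mult.commute)
qed

text \<open>In terms of \<open>W = r powr \<sigma> * radial0\<close> with \<open>\<sigma> = (d - 1) / 2\<close> the differential equation reads
  \<open>W'' = - W + \<sigma> (\<sigma> - 1) W / r\<^sup>2\<close>, so \<open>(W\<^sup>2 + W'\<^sup>2) exp (\<bar>\<sigma> (\<sigma> - 1)\<bar> / r)\<close> decreases.\<close>
lemma sphere_cos2_decay:
  "\<exists>C\<ge>0. \<forall>v x :: 'a::euclidean_space. norm v = 1 \<longrightarrow> x \<noteq> 0 \<longrightarrow>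
    \<bar>sphere_cos2 v x\<bar> \<le> C * norm x powr (- ((real DIM('a) - 1) / 2))"
proof -
  obtain e :: 'a where "e \<in> Basis" using nonempty_Basis by blast
  then have e: "norm e = 1" by simp
  define w0 where "w0 = radial0 e"
  define w1 where "w1 = radial1 e"
  define w2 where "w2 = radial2 e"
  note d0 = radial_has_derivative(1)[OF e, folded w0_def w1_def]
  note d1 = radial_has_derivative(2)[OF e, folded w1_def w2_def]
  define \<sigma> where "\<sigma> = (real DIM('a) - 1) / 2"
  have \<sigma>: "\<sigma> \<ge> 0" by (simp add: \<sigma>_def Suc_leI)
  have ode: "w2 r = - w0 r - 2 * \<sigma> / r * w1 r" if "r > 0" for r
  proof -
    have "2 * \<sigma> = real DIM('a) - 1" by (simp add: \<sigma>_def)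
    then show ?thesis using radial_ode[OF e that] by (simp only: w0_def w1_def w2_def)
  qed
  define S where "S = measure sphere_measure (UNIV :: 'a set)"
  have S: "S \<ge> 0" by (simp add: S_def)
  define k where "k = \<sigma> * (\<sigma> - 1)"
  define W where "W r = r powr \<sigma> * w0 r" for r
  define W1 where "W1 r = r powr \<sigma> * (w1 r + \<sigma> / r * w0 r)" for r
  have dW: "(W has_real_derivative W1 r) (at r)" if r: "r > 0" for r
  proof -
    have "r powr (\<sigma> - 1) = r powr \<sigma> / r" using r by (simp add: powr_diff)
    then show ?thesis unfolding W_def[abs_def] W1_def using r
      by (auto intro!: derivative_eq_intros d0 simp: algebra_simps)
  qed
  have dW1: "(W1 has_real_derivative - W r + k / r\<^sup>2 * W r) (at r)" if r: "r > 0" for r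
  proof -
    have p: "r powr (\<sigma> - 1) = r powr \<sigma> / r" using r by (simp add: powr_diff)
    have "((\<lambda>r. r powr \<sigma> * (w1 r + \<sigma> / r * w0 r)) has_real_derivative
      (\<sigma> * r powr (\<sigma> - 1)) * (w1 r + \<sigma> / r * w0 r) + r powr \<sigma> * (w2 r + (\<sigma> / r * w1 r - \<sigma> / r\<^sup>2 * w0 r))) (at r)"
    proof -
      have "((\<lambda>r. \<sigma> / r * w0 r) has_real_derivative (0 * r - \<sigma> * 1) / (r * r) * w0 r + w1 r * (\<sigma> / r)) (at r)"
        by (intro DERIV_mult DERIV_divide DERIV_const DERIV_ident d0) (use r in simp)
      then have "((\<lambda>r. \<sigma> / r * w0 r) has_real_derivative \<sigma> / r * w1 r - \<sigma> / r\<^sup>2 * w0 r) (at r)"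
        by (rule DERIV_cong) (simp add: power2_eq_square)
      from DERIV_mult[OF has_real_derivative_powr[OF r, of \<sigma>] DERIV_add[OF d1 this]]
      show ?thesis by (rule DERIV_cong) (simp add: mult.commute)
    qed
    also have "(\<sigma> * r powr (\<sigma> - 1)) * (w1 r + \<sigma> / r * w0 r) + r powr \<sigma> * (w2 r + (\<sigma> / r * w1 r - \<sigma> / r\<^sup>2 * w0 r)) = - W r + k / r\<^sup>2 * W r"
      unfolding p ode[OF r] W_def k_def using r by (simp add: field_simps power2_eq_square)
    finally show ?thesis by (simp add: W1_def[abs_def])
  qed
  define E where "E r = ((W r)\<^sup>2 + (W1 r)\<^sup>2) * exp (\<bar>k\<bar> / r)" for r
  have dE: "\<exists>y. (E has_real_derivative y) (at r) \<and> y \<le> 0" if r: "r > 0" for r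
  proof (intro exI conjI)
    show "(E has_real_derivative (2 * W r * W1 r + 2 * W1 r * (- W r + k / r\<^sup>2 * W r)) * exp (\<bar>k\<bar> / r)
        + ((W r)\<^sup>2 + (W1 r)\<^sup>2) * (exp (\<bar>k\<bar> / r) * (- (\<bar>k\<bar> / r\<^sup>2)))) (at r)"
      unfolding E_def[abs_def] using r
      by (auto intro!: derivative_eq_intros dW dW1 simp: power2_eq_square mult_ac)
    \<comment> \<open>The products W W' of the harmonic oscillator cancel. What remains is 2 k W W'
      / r^2, and the derivative of the exponential contributes
      \<open>- \<bar>k\<bar> / r\<^sup>2\<close> times
      \<open>(W r)\<^sup>2 + (W1 r)\<^sup>2\<close>, which dominates it.\<close>
    have "(2 * W r * W1 r + 2 * W1 r * (- W r + k / r\<^sup>2 * W r)) * exp (\<bar>k\<bar> / r)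
        + ((W r)\<^sup>2 + (W1 r)\<^sup>2) * (exp (\<bar>k\<bar> / r) * (- (\<bar>k\<bar> / r\<^sup>2))) =
        exp (\<bar>k\<bar> / r) / r\<^sup>2 * (k * (2 * W r * W1 r) - \<bar>k\<bar> * ((W r)\<^sup>2 + (W1 r)\<^sup>2))"
      using r by (simp add: field_simps)
    also have "\<dots> \<le> 0"
    proof (rule mult_nonneg_nonpos)
      have "k * (2 * W r * W1 r) \<le> \<bar>k\<bar> * \<bar>2 * W r * W1 r\<bar>"
        by (metis abs_ge_self abs_mult)
      also have "\<dots> \<le> \<bar>k\<bar> * ((W r)\<^sup>2 + (W1 r)\<^sup>2)"
        using sum_squares_bound[of "\<bar>W r\<bar>" "\<bar>W1 r\<bar>"] by (intro mult_left_mono) (auto simp: abs_mult)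
      finally show "k * (2 * W r * W1 r) - \<bar>k\<bar> * ((W r)\<^sup>2 + (W1 r)\<^sup>2) \<le> 0" by simp
    qed simp
    finally show "(2 * W r * W1 r + 2 * W1 r * (- W r + k / r\<^sup>2 * W r)) * exp (\<bar>k\<bar> / r)
        + ((W r)\<^sup>2 + (W1 r)\<^sup>2) * (exp (\<bar>k\<bar> / r) * (- (\<bar>k\<bar> / r\<^sup>2))) \<le> 0" .
  qed
  define K where "K = sqrt (E 1)"
  have WK: "\<bar>W r\<bar> \<le> K" "\<bar>W1 r\<bar> \<le> K" if r: "r \<ge> 1" for r
  proof -
    have "E r \<le> E 1" by (rule DERIV_nonpos_imp_nonincreasing[OF r]) (use dE in auto)
    moreover have "((W r)\<^sup>2 + (W1 r)\<^sup>2) * 1 \<le> E r"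
      unfolding E_def by (rule mult_left_mono) (use r in auto)
    ultimately have le: "(W r)\<^sup>2 + (W1 r)\<^sup>2 \<le> E 1" by simp
    have "(W r)\<^sup>2 \<le> E 1" "(W1 r)\<^sup>2 \<le> E 1" using le zero_le_power2[of "W r"] zero_le_power2[of "W1 r"] by linarith+
    from this[THEN real_sqrt_le_mono] show "\<bar>W r\<bar> \<le> K" "\<bar>W1 r\<bar> \<le> K" by (simp_all add: K_def)
  qed
  have K: "K \<ge> 0" using WK(1)[of 1] by simp
  define C1 where "C1 = K * (1 + \<sigma>)"
  define C2 where "C2 = K + 2 * \<sigma> * C1"
  have C12: "C1 \<ge> 0" "C2 \<ge> 0" using K \<sigma> by (auto simp: C1_def C2_def)
  \<comment> \<open>w1 is recovered from W1 by subtracting the term with \<sigma> / r, and w2 from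
    the differential equation; for r \<ge> 1 the factors 1 / r are at most 1.\<close>
  have bd: "\<bar>w1 r\<bar> \<le> C1 * r powr (-\<sigma>)" "\<bar>w2 r\<bar> \<le> C2 * r powr (-\<sigma>)" if r: "r \<ge> 1" for r
  proof -
    have r0: "r > 0" using r by simp
    have inv: "r powr (-\<sigma>) * r powr \<sigma> = 1" using r by (simp add: powr_add[symmetric])
    have pp: "r powr (-\<sigma>) \<ge> 0" by simp
    have "w0 r = r powr (-\<sigma>) * W r" unfolding W_def using inv by (simp add: mult.assoc[symmetric])
    then have b0: "\<bar>w0 r\<bar> \<le> K * r powr (-\<sigma>)"
      using mult_left_mono[OF WK(1)[OF r] pp] by (simp add: abs_mult mult.commute)
    have ir: "\<sigma> / r \<le> \<sigma>" "\<sigma> / r \<ge> 0" using r \<sigma> mult_left_mono[of 1 r \<sigma>] by (auto simp: field_simps)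
    have "w1 r + \<sigma> / r * w0 r = r powr (-\<sigma>) * W1 r" unfolding W1_def using inv by (simp add: mult.assoc[symmetric])
    then have "\<bar>w1 r + \<sigma> / r * w0 r\<bar> \<le> K * r powr (-\<sigma>)"
      using mult_left_mono[OF WK(2)[OF r] pp] by (simp add: abs_mult mult.commute)
    moreover have "\<bar>\<sigma> / r * w0 r\<bar> \<le> \<sigma> * (K * r powr (-\<sigma>))"
      unfolding abs_mult using ir b0 \<sigma> by (intro mult_mono) auto
    ultimately have "\<bar>w1 r\<bar> \<le> K * r powr (-\<sigma>) + \<sigma> * (K * r powr (-\<sigma>))" by linarith
    then show b1: "\<bar>w1 r\<bar> \<le> C1 * r powr (-\<sigma>)" by (simp add: C1_def algebra_simps)
    have "\<bar>2 * (\<sigma> / r) * w1 r\<bar> \<le> (2 * \<sigma>) * (C1 * r powr (-\<sigma>))"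
      unfolding abs_mult using ir b1 \<sigma> by (intro mult_mono) auto
    then have "\<bar>w2 r\<bar> \<le> K * r powr (-\<sigma>) + (2 * \<sigma>) * (C1 * r powr (-\<sigma>))"
    proof -
      have "w2 r = - w0 r - (2 * (\<sigma> / r) * w1 r)" using ode[OF r0] by simp
      moreover assume "\<bar>2 * (\<sigma> / r) * w1 r\<bar> \<le> (2 * \<sigma>) * (C1 * r powr (-\<sigma>))"
      ultimately show ?thesis using b0 by linarith
    qed
    then show "\<bar>w2 r\<bar> \<le> C2 * r powr (-\<sigma>)" by (simp add: C2_def algebra_simps)
  qed
  define C where "C = C1 + C2 + S"
  have "\<bar>sphere_cos2 v x\<bar> \<le> C * norm x powr (-\<sigma>)" if v: "norm v = 1" and x: "x \<noteq> 0" for v x :: 'a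
  proof (cases "norm x \<ge> 1")
    case True
    define r where "r = norm x"
    have r: "r \<ge> 1" using True by (simp add: r_def)
    \<comment> \<open>q is the squared cosine of the angle between x and v: the second derivative is
      w2 on the radial part of v and w1 / r on its tangential part.\<close>
    define q where "q = (x \<bullet> v)\<^sup>2 / r\<^sup>2"
    have "\<bar>x \<bullet> v\<bar> \<le> r" using Cauchy_Schwarz_ineq2[of x v] v by (simp add: r_def)
    then have "\<bar>x \<bullet> v\<bar>\<^sup>2 \<le> r\<^sup>2" by (rule power_mono) simp
    then have q: "0 \<le> q" "q \<le> 1" using r by (auto simp: q_def)
    have vv: "v \<bullet> v = 1" using v by (simp add: norm_eq_1)
    have "- sphere_cos2 v x = w2 r * q + w1 r * ((1 - q) / r)"
      using sphere_cos2_radial[OF e x, of v] r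
      by (simp add: w1_def w2_def r_def[symmetric] q_def vv power2_eq_square power3_eq_cube diff_divide_distrib)
    moreover have "\<bar>w2 r * q\<bar> \<le> \<bar>w2 r\<bar> * 1" unfolding abs_mult using q by (intro mult_mono) auto
    moreover have "\<bar>w1 r * ((1 - q) / r)\<bar> \<le> \<bar>w1 r\<bar> * 1"
      unfolding abs_mult using q r by (intro mult_mono) (auto simp: field_simps)
    ultimately have "\<bar>sphere_cos2 v x\<bar> \<le> \<bar>w2 r\<bar> + \<bar>w1 r\<bar>" by linarith
    also have "\<dots> \<le> C2 * r powr (-\<sigma>) + C1 * r powr (-\<sigma>)" by (intro add_mono bd r)
    also have "\<dots> \<le> C * r powr (-\<sigma>)" using S by (simp add: C_def algebra_simps)
    finally show ?thesis by (simp add: r_def)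
  next
    case False
    \<comment> \<open>Near the origin the total mass is a sufficient bound, since there the
      nonpositive power of |x| is at least 1.\<close>
    have "\<bar>sphere_cos2 v x\<bar> \<le> 1 * S"
      unfolding sphere_cos2_def S_def
    proof (rule abs_integral_sphere_le)
      show "AE \<omega> in sphere_measure. \<bar>(v \<bullet> \<omega>)\<^sup>2 * cos (x \<bullet> \<omega>)\<bar> \<le> 1"
        using AE_sphere_inner_le[of v]
      proof eventually_elim
        fix \<omega> assume "\<bar>v \<bullet> \<omega>\<bar> \<le> norm v"
        then have "\<bar>v \<bullet> \<omega>\<bar>\<^sup>2 \<le> 1\<^sup>2" unfolding v by (rule power_mono) simp
        then have "\<bar>(v \<bullet> \<omega>)\<^sup>2\<bar> * \<bar>cos (x \<bullet> \<omega>)\<bar> \<le> 1 * 1" by (intro mult_mono) auto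
        then show "\<bar>(v \<bullet> \<omega>)\<^sup>2 * cos (x \<bullet> \<omega>)\<bar> \<le> 1" by (simp add: abs_mult)
      qed
    qed simp
    also have "\<dots> \<le> C * norm x powr (-\<sigma>)"
    proof -
      have "norm x powr 0 \<le> norm x powr (-\<sigma>)"
        by (rule powr_mono') (use False x \<sigma> in auto)
      then have "1 \<le> norm x powr (-\<sigma>)" using x by simp
      then have "S * 1 \<le> C * norm x powr (-\<sigma>)"
        by (intro mult_mono) (use S C12 in \<open>auto simp: C_def\<close>)
      then show ?thesis by simp
    qed
    finally show ?thesis .
  qed
  then show ?thesis using C12 S unfolding \<sigma>_def C_def by (intro exI[of _ "C1 + C2 + S"]) auto
qed

section \<open>Decay of the kernel of a slice\<close>

lemma sphere_cis_integral:
  fixes v x :: "'a::euclidean_space"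
  assumes v: "norm v = 1"
  shows "(\<integral>\<omega>. of_real ((v \<bullet> \<omega>)\<^sup>2) * cis (x \<bullet> \<omega>) \<partial>sphere_measure) = complex_of_real (sphere_cos2 v x)"
proof -
  have le: "AE \<omega> in sphere_measure. (v \<bullet> \<omega>)\<^sup>2 \<le> 1"
    using AE_sphere_inner_le[of v]
  proof eventually_elim
    fix \<omega> assume "\<bar>v \<bullet> \<omega>\<bar> \<le> norm v"
    then have "\<bar>v \<bullet> \<omega>\<bar>\<^sup>2 \<le> 1\<^sup>2" unfolding v by (rule power_mono) simp
    then show "(v \<bullet> \<omega>)\<^sup>2 \<le> 1" by simp
  qed
  have int: "integrable sphere_measure (\<lambda>\<omega>. of_real ((v \<bullet> \<omega>)\<^sup>2) * cis (x \<bullet> \<omega>))"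
    by (rule sph.integrable_const_bound[of _ 1]) (use le in \<open>auto simp: norm_mult norm_power elim: eventually_mono\<close>)
  show ?thesis
  proof (rule complex_eqI)
    show "Re (\<integral>\<omega>. of_real ((v \<bullet> \<omega>)\<^sup>2) * cis (x \<bullet> \<omega>) \<partial>sphere_measure) = Re (complex_of_real (sphere_cos2 v x))"
      by (subst integral_Re[OF int, symmetric]) (simp add: sphere_cos2_def)
    show "Im (\<integral>\<omega>. of_real ((v \<bullet> \<omega>)\<^sup>2) * cis (x \<bullet> \<omega>) \<partial>sphere_measure) = Im (complex_of_real (sphere_cos2 v x))"
      by (subst integral_Im[OF int, symmetric]) (simp add: integral_sphere_sin_eq_0[simplified])
  qed
qed

text \<open>Vanishing of the weight on \<open>\<xi> \<bullet> e = 0\<close> compensates the degenerate Jacobian of \<open>zeta e\<close> there.\<close>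
definition annulus_weight :: "real \<Rightarrow> real \<Rightarrow> 'a \<Rightarrow> 'a::euclidean_space \<Rightarrow> real" where
  "annulus_weight a b e \<xi> = of_bool (a \<le> norm \<xi> \<and> norm \<xi> \<le> b) * (e \<bullet> sgn \<xi>)\<^sup>2"

lemma annulus_weight_measurable[measurable]: "annulus_weight a b e \<in> borel_measurable borel"
  unfolding annulus_weight_def of_bool_def by measurable

lemma annulus_weight_bounds:
  assumes e: "norm e = 1"
  shows "0 \<le> annulus_weight a b e \<xi>" "annulus_weight a b e \<xi> \<le> indicator (cball 0 b) \<xi>"
proof -
  have "\<bar>e \<bullet> sgn \<xi>\<bar> \<le> 1" using Cauchy_Schwarz_ineq2[of e "sgn \<xi>"] e by (cases "\<xi> = 0") (auto simp: norm_sgn)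
  then have "\<bar>e \<bullet> sgn \<xi>\<bar>\<^sup>2 \<le> 1\<^sup>2" by (rule power_mono) simp
  then show "annulus_weight a b e \<xi> \<le> indicator (cball 0 b) \<xi>"
    by (auto simp: annulus_weight_def indicator_def)
qed (simp add: annulus_weight_def)

text \<open>In polar coordinates the time phase depends on the radius only and has modulus 1, while
  the weight depends on the direction apart from the cutoff in the radius. So the sphere of radius r
  contributes a multiple of r^(d-1) \<open>sphere_cos2 e (r *\<^sub>R x)\<close>. With 2 \<sigma> =
  d - 1 this is of size at most (r / |x|)^\<sigma>, and r runs over an interval of length b - a. The
  distance of the slices enters through |x| \<ge> |s|.\<close>

lemma kernel_decay:
  "\<exists>C\<ge>0. \<forall>a b s. \<forall>e z :: 'a::euclidean_space. norm e = 1 \<longrightarrow> 0 \<le> a \<longrightarrow> a \<le> b \<longrightarrow> s \<noteq> 0 \<longrightarrow>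
    norm (\<integral>\<xi>. of_real (annulus_weight a b e \<xi>) * cis (s * (\<xi> \<bullet> e) + z \<bullet> zeta e \<xi>) \<partial>lborel)
    \<le> C * (b - a) * b powr ((real DIM('a) - 1) / 2) * \<bar>s\<bar> powr (- ((real DIM('a) - 1) / 2))"
proof -
  define \<sigma> where "\<sigma> = (real DIM('a) - 1) / 2"
  have \<sigma>: "\<sigma> \<ge> 0" "2 * \<sigma> = real (DIM('a) - 1)" by (simp_all add: \<sigma>_def Suc_leI of_nat_diff)
  obtain C0 where C0: "C0 \<ge> 0" "\<And>v x :: 'a. norm v = 1 \<Longrightarrow> x \<noteq> 0 \<Longrightarrow> \<bar>sphere_cos2 v x\<bar> \<le> C0 * norm x powr (-\<sigma>)"
    using sphere_cos2_decay[where 'a='a] unfolding \<sigma>_def by blast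
  define C where "C = real DIM('a) * C0"
  have "norm (\<integral>\<xi>. of_real (annulus_weight a b e \<xi>) * cis (s * (\<xi> \<bullet> e) + z \<bullet> zeta e \<xi>) \<partial>lborel)
    \<le> C * (b - a) * b powr \<sigma> * \<bar>s\<bar> powr (-\<sigma>)"
    if e: "norm e = 1" and ab: "0 \<le> a" "a \<le> b" and s: "s \<noteq> 0" for a b s and e z :: 'a
  proof -
    have ee: "e \<bullet> e = 1" using e by (simp add: norm_eq_1)
    \<comment> \<open>The swap is undone: t and x are the time and space coordinates that belong to
      (s, z), and the e-component of x is s.\<close>
    define t where "t = z \<bullet> e"
    define x where "x = z + (s - t) *\<^sub>R e"
    have "x \<bullet> e = s" by (simp add: x_def t_def inner_add_left ee)
    then have xs: "norm x \<ge> \<bar>s\<bar>" using Cauchy_Schwarz_ineq2[of x e] e by simp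
    then have x0: "x \<noteq> 0" using s by auto
    have ph: "s * (\<xi> \<bullet> e) + z \<bullet> zeta e \<xi> = x \<bullet> \<xi> - t * (norm \<xi>)\<^sup>2" for \<xi>
      by (simp add: zeta_def x_def t_def inner_add_left inner_diff_right algebra_simps inner_commute)
    define f where "f \<xi> = complex_of_real (annulus_weight a b e \<xi>) * cis (x \<bullet> \<xi> - t * (norm \<xi>)\<^sup>2)" for \<xi>
    have [measurable]: "cball (0::'a) b \<in> sets borel" by (simp add: borel_closed)
    have fint: "integrable lborel f"
    proof (rule Bochner_Integration.integrable_bound)
      show "integrable lborel (indicator (cball (0::'a) b) :: 'a \<Rightarrow> real)"
        using emeasure_lborel_cball_finite[of "0::'a" b] by (subst integrable_indicator_iff) auto
      show "f \<in> borel_measurable lborel" unfolding f_def by measurable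
      show "AE \<xi> in lborel. norm (f \<xi>) \<le> norm (indicator (cball 0 b) \<xi> :: real)"
        using annulus_weight_bounds[OF e, of a b] by (auto simp: f_def norm_mult)
    qed
    define p where "p r = indicator {0<..} r * real DIM('a) * r ^ (DIM('a) - 1)" for r :: real
    define Bd where "Bd = C * b powr \<sigma> * \<bar>s\<bar> powr (-\<sigma>)"
    have Bd: "Bd \<ge> 0" using C0 by (simp add: Bd_def C_def)
    have inner: "norm (\<integral>\<omega>. p r *\<^sub>R f (r *\<^sub>R \<omega>) \<partial>sphere_measure) \<le> Bd * indicator {a..b} r" for r
    proof (cases "r > 0 \<and> a \<le> r \<and> r \<le> b")
      case False
      have "p r *\<^sub>R f (r *\<^sub>R \<omega>) = 0" if "norm \<omega> = 1" for \<omega>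
        using False that by (auto simp: p_def f_def annulus_weight_def)
      then have "(\<integral>\<omega>. p r *\<^sub>R f (r *\<^sub>R \<omega>) \<partial>sphere_measure) = (\<integral>\<omega>. 0 \<partial>(sphere_measure :: 'a measure))"
      proof (intro integral_cong_AE)
        show "AE \<omega> in sphere_measure. p r *\<^sub>R f (r *\<^sub>R \<omega>) = 0"
          using AE_sphere_measure_norm[where 'a='a] by eventually_elim fact
      qed (auto simp: f_def)
      then have "norm (\<integral>\<omega>. p r *\<^sub>R f (r *\<^sub>R \<omega>) \<partial>sphere_measure) = 0" by simp
      then show ?thesis using Bd by (simp only:) (simp add: indicator_def)
    next
      case True
      have "(\<integral>\<omega>. p r *\<^sub>R f (r *\<^sub>R \<omega>) \<partial>sphere_measure) = (\<integral>\<omega>. (of_real (p r) * cis (- t * r\<^sup>2)) * (of_real ((e \<bullet> \<omega>)\<^sup>2) * cis ((r *\<^sub>R x) \<bullet> \<omega>)) \<partial>sphere_measure)"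
      proof (rule integral_cong_AE)
        show "AE \<omega> in sphere_measure. p r *\<^sub>R f (r *\<^sub>R \<omega>) = (of_real (p r) * cis (- t * r\<^sup>2)) * (of_real ((e \<bullet> \<omega>)\<^sup>2) * cis ((r *\<^sub>R x) \<bullet> \<omega>))"
          using AE_sphere_measure_norm[where 'a='a]
        proof eventually_elim
          fix \<omega> :: 'a assume \<omega>: "norm \<omega> = 1"
          have "cis ((r *\<^sub>R x) \<bullet> \<omega> + - (t * r\<^sup>2)) = cis ((r *\<^sub>R x) \<bullet> \<omega>) * cis (- (t * r\<^sup>2))" by (simp only: cis_mult)
          then show "p r *\<^sub>R f (r *\<^sub>R \<omega>) = (of_real (p r) * cis (- t * r\<^sup>2)) * (of_real ((e \<bullet> \<omega>)\<^sup>2) * cis ((r *\<^sub>R x) \<bullet> \<omega>))"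
            using True \<omega> by (simp add: f_def annulus_weight_def sgn_div_norm scaleR_conv_of_real mult_ac)
        qed
      qed (auto simp: f_def)
      also have "\<dots> = (of_real (p r) * cis (- t * r\<^sup>2)) * of_real (sphere_cos2 e (r *\<^sub>R x))"
        by (simp only: Bochner_Integration.integral_mult_right_zero sphere_cis_integral[OF e])
      also have "norm \<dots> = p r * \<bar>sphere_cos2 e (r *\<^sub>R x)\<bar>"
      proof -
        have "p r \<ge> 0" by (simp add: p_def indicator_def)
        then show ?thesis by (simp add: norm_mult)
      qed
      also have "\<dots> \<le> p r * (C0 * norm (r *\<^sub>R x) powr (-\<sigma>))"
        by (rule mult_left_mono, rule C0(2)) (use e x0 True in \<open>auto simp: p_def\<close>)
      also have "\<dots> = C * (r powr \<sigma> * norm x powr (-\<sigma>))"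
      proof -
        have "r ^ (DIM('a) - 1) = r powr (2 * \<sigma>)" unfolding \<sigma>(2) by (rule powr_realpow[symmetric]) (use True in simp)
        then have "r ^ (DIM('a) - 1) * r powr (-\<sigma>) = r powr \<sigma>" by (simp add: powr_add[symmetric])
        then show ?thesis using True by (simp add: p_def C_def powr_mult mult_ac)
      qed
      also have "\<dots> \<le> C * (b powr \<sigma> * \<bar>s\<bar> powr (-\<sigma>))"
      proof (intro mult_left_mono mult_mono)
        show "r powr \<sigma> \<le> b powr \<sigma>" by (rule powr_mono2) (use True \<sigma>(1) in auto)
        show "norm x powr (-\<sigma>) \<le> \<bar>s\<bar> powr (-\<sigma>)" by (rule powr_mono2') (use s xs \<sigma>(1) in auto)
      qed (use C0 in \<open>auto simp: C_def\<close>)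
      finally show ?thesis using True by (simp add: Bd_def mult_ac)
    qed
    have "norm (\<integral>\<xi>. f \<xi> \<partial>lborel) = norm (\<integral>r. (\<integral>\<omega>. p r *\<^sub>R f (r *\<^sub>R \<omega>) \<partial>sphere_measure) \<partial>lborel)"
      unfolding integral_polar[OF fint] p_def ..
    also have "\<dots> \<le> (\<integral>r. norm (\<integral>\<omega>. p r *\<^sub>R f (r *\<^sub>R \<omega>) \<partial>sphere_measure) \<partial>lborel)"
      by (rule integral_norm_bound)
    also have "\<dots> \<le> (\<integral>r. Bd * indicator {a..b} r \<partial>lborel)"
    proof (rule integral_mono_AE')
      show "integrable lborel (\<lambda>r. Bd * indicator {a..b} r)"
        by (intro integrable_mult_right integrable_real_indicator) (auto simp: emeasure_lborel_Icc_eq)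
    qed (use inner Bd in auto)
    also have "\<dots> = Bd * (b - a)" using ab by simp
    finally show ?thesis unfolding ph f_def[symmetric] by (simp add: Bd_def mult_ac)
  qed
  then show ?thesis unfolding \<sigma>_def using C0(1) by (intro exI[of _ C]) (auto simp: C_def)
qed

section \<open>Gaussians and the Plancherel inequality\<close>

lemma norm_integral_le_nn_integral:
  fixes f :: "'b \<Rightarrow> complex"
  shows "ennreal (norm (\<integral>x. f x \<partial>M)) \<le> (\<integral>\<^sup>+x. ennreal (norm (f x)) \<partial>M)"
  by (cases "integrable M f") (auto simp: integral_norm_bound_ennreal not_integrable_integral_eq)

lemma integral_lborel_translate:
  fixes f :: "'a::euclidean_space \<Rightarrow> complex"
  assumes [measurable]: "f \<in> borel_measurable borel"
  shows "(\<integral>x. f (x + c) \<partial>lborel) = (\<integral>x. f x \<partial>lborel)"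
proof -
  have "(\<integral>x. f x \<partial>lborel) = (\<integral>x. f x \<partial>distr lborel borel ((+) c))"
    by (simp add: lborel_distr_plus)
  also have "\<dots> = (\<integral>x. f (c + x) \<partial>lborel)"
    by (rule integral_distr) auto
  finally show ?thesis by (simp add: add.commute)
qed

lemma integral_lborel_scale:
  fixes f :: "'a::euclidean_space \<Rightarrow> complex"
  assumes [measurable]: "f \<in> borel_measurable borel" and c: "c > 0"
  shows "(\<integral>x. f x \<partial>lborel) = of_real (c ^ DIM('a)) * (\<integral>x. f (c *\<^sub>R x) \<partial>lborel)"
proof -
  have "(\<integral>x. f x \<partial>lborel) = (\<integral>x. f x \<partial>density (distr lborel borel (\<lambda>x. 0 + c *\<^sub>R x)) (\<lambda>_. ennreal (\<bar>c\<bar> ^ DIM('a))))"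
    using lborel_affine[of c "0::'a"] c by simp
  also have "\<dots> = of_real (c ^ DIM('a)) * (\<integral>x. f (c *\<^sub>R x) \<partial>lborel)"
    using c by (subst integral_density) (auto simp: integral_distr scaleR_conv_of_real)
  finally show ?thesis .
qed

lemma integral_lborel_coord_prod:
  fixes f :: "'a::euclidean_space \<Rightarrow> real \<Rightarrow> complex"
  assumes "\<And>b. b \<in> Basis \<Longrightarrow> integrable lborel (f b)"
  shows "(\<integral>x. (\<Prod>b\<in>Basis. f b (x \<bullet> b)) \<partial>lborel) = (\<Prod>b\<in>Basis. (\<integral>x. f b x \<partial>lborel))"
proof -
  interpret product_sigma_finite "\<lambda>_::'a. lborel :: real measure" ..
  have [measurable]: "\<And>b. b \<in> Basis \<Longrightarrow> f b \<in> borel_measurable borel"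
    using assms borel_measurable_integrable by force
  have "(\<integral>x. (\<Prod>b\<in>Basis. f b (x \<bullet> b)) \<partial>lborel) =
    (\<integral>x. (\<Prod>b\<in>Basis. f b ((\<Sum>c\<in>Basis. x c *\<^sub>R c) \<bullet> b)) \<partial>(\<Pi>\<^sub>M b\<in>Basis. lborel))"
    by (subst lborel_eq, subst integral_distr) auto
  also have "\<dots> = (\<integral>x. (\<Prod>b\<in>Basis. f b (x b)) \<partial>(\<Pi>\<^sub>M b\<in>Basis. lborel))"
    by (rule Bochner_Integration.integral_cong) (auto intro!: prod.cong)
  also have "\<dots> = (\<Prod>b\<in>Basis. (\<integral>x. f b x \<partial>lborel))"
    by (rule product_integral_prod) (use assms in auto)
  finally show ?thesis .
qed

lemma measurable_cnj[measurable]: "cnj \<in> borel_measurable borel"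
  by (intro borel_measurable_continuous_onI continuous_intros)

text \<open>The standard normal density, of total mass 1. As a cutoff it takes the value
  \<open>1 / sqrt (2 * pi) ^ DIM('a)\<close> at the origin, a constant that reappears whenever the
  cutoff is removed.\<close>

definition gauss :: "'a::euclidean_space \<Rightarrow> real" where
  "gauss z = exp (- (norm z)\<^sup>2 / 2) / (sqrt (2 * pi)) ^ DIM('a)"

lemma gauss_eq_prod: "gauss z = (\<Prod>b\<in>Basis. std_normal_density (z \<bullet> b))"
proof -
  have "(\<Prod>b\<in>Basis. std_normal_density (z \<bullet> b)) = (\<Prod>b\<in>Basis. exp (- (z \<bullet> b)\<^sup>2 / 2) / sqrt (2 * pi))"
    by (simp add: normal_density_def)
  also have "\<dots> = exp (\<Sum>b\<in>Basis. - (z \<bullet> b)\<^sup>2 / 2) / (sqrt (2 * pi)) ^ DIM('a)"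
    by (simp add: prod_dividef exp_sum)
  also have "(\<Sum>b\<in>Basis. - (z \<bullet> b)\<^sup>2 / 2) = - (norm z)\<^sup>2 / 2"
    by (simp add: norm_squared_eq_sum[of z] sum_negf sum_divide_distrib)
  finally show ?thesis by (simp add: gauss_def)
qed

lemma gauss_pos: "gauss z > 0" by (simp add: gauss_def)

lemma gauss_measurable[measurable]: "gauss \<in> borel_measurable borel"
  unfolding gauss_def by measurable

lemma nn_integral_gauss: "(\<integral>\<^sup>+z. ennreal (gauss z) \<partial>(lborel :: 'a::euclidean_space measure)) = 1"
proof -
  have "(\<integral>\<^sup>+z. ennreal (gauss z) \<partial>(lborel :: 'a measure)) = (\<integral>\<^sup>+z. (\<Prod>b\<in>Basis. ennreal (std_normal_density (z \<bullet> b))) \<partial>(lborel :: 'a measure))"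
    by (simp add: gauss_eq_prod prod_ennreal)
  also have "\<dots> = (\<Prod>b\<in>(Basis::'a set). (\<integral>\<^sup>+x. ennreal (std_normal_density x) \<partial>lborel))"
    by (rule nn_integral_lborel_prod) auto
  also have "\<dots> = 1" by (simp add: nn_integral_eq_integral)
  finally show ?thesis .
qed

lemma integrable_gauss: "integrable lborel gauss"
  by (rule integrableI_nonneg) (auto simp: nn_integral_gauss less_imp_le[OF gauss_pos])

lemma integrable_gauss_scaled:
  assumes \<epsilon>: "\<epsilon> > 0"
  shows "integrable lborel (\<lambda>\<xi>::'a::euclidean_space. gauss (\<epsilon> *\<^sub>R \<xi>))"
proof (rule integrableI_nonneg)
  have "(\<integral>\<^sup>+\<xi>. ennreal (gauss (\<epsilon> *\<^sub>R \<xi>)) \<partial>(lborel :: 'a measure)) = ennreal ((1/\<epsilon>) ^ DIM('a)) * (\<integral>\<^sup>+\<xi>. ennreal (gauss (\<epsilon> *\<^sub>R ((1/\<epsilon>) *\<^sub>R \<xi>))) \<partial>(lborel :: 'a measure))"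
    by (rule nn_integral_lborel_scale) (use \<epsilon> in auto)
  also have "\<dots> < \<infinity>" using \<epsilon> by (simp add: nn_integral_gauss)
  finally show "(\<integral>\<^sup>+\<xi>. ennreal (gauss (\<epsilon> *\<^sub>R \<xi>)) \<partial>(lborel :: 'a measure)) < \<infinity>" .
qed (auto simp: less_imp_le[OF gauss_pos])

text \<open>Density and exponential both factor over the coordinates, which reduces the claim to the
  characteristic function of the standard normal distribution.\<close>

lemma fourier_gauss: "(\<integral>z. cis (z \<bullet> x) * of_real (gauss z) \<partial>lborel) = of_real (exp (- (norm x)\<^sup>2 / 2))"
proof -
  have 1: "(\<integral>s. cis (s * t) * of_real (std_normal_density s) \<partial>lborel) = of_real (exp (- t\<^sup>2 / 2))" for t :: real
  proof -
    have "char std_normal_distribution t = (\<integral>s. std_normal_density s *\<^sub>R cis (t * s) \<partial>lborel)"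
      unfolding char_def by (subst integral_density) (auto simp: cis_conv_exp mult_ac)
    then show ?thesis unfolding char_std_normal_distribution
      by (simp add: scaleR_conv_of_real mult_ac)
  qed
  have cs: "cis (\<Sum>b\<in>B. g b) = (\<Prod>b\<in>B. cis (g b))" for B and g :: "'a \<Rightarrow> real"
    by (induction B rule: infinite_finite_induct) (auto simp: cis_mult[symmetric])
  have "(\<integral>z. cis (z \<bullet> x) * of_real (gauss z) \<partial>lborel)
     = (\<integral>z. (\<Prod>b\<in>Basis. cis ((z \<bullet> b) * (x \<bullet> b)) * of_real (std_normal_density (z \<bullet> b))) \<partial>lborel)"
    by (simp add: gauss_eq_prod prod.distrib cs[symmetric] euclidean_inner[of _ x])
  also have "\<dots> = (\<Prod>b\<in>Basis. (\<integral>s. cis (s * (x \<bullet> b)) * of_real (std_normal_density s) \<partial>lborel))"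
    by (rule integral_lborel_coord_prod)
       (auto intro!: Bochner_Integration.integrable_bound[OF integrable_normal_density[of 1 0]] simp: norm_mult)
  also have "\<dots> = (\<Prod>b\<in>Basis. of_real (exp (- (x \<bullet> b)\<^sup>2 / 2)))" unfolding 1 ..
  also have "\<dots> = of_real (exp (\<Sum>b\<in>Basis. - (x \<bullet> b)\<^sup>2 / 2))" by (simp add: exp_sum)
  also have "(\<Sum>b\<in>Basis. - (x \<bullet> b)\<^sup>2 / 2) = - (norm x)\<^sup>2 / 2"
    by (simp add: norm_squared_eq_sum[of x] sum_negf sum_divide_distrib)
  finally show ?thesis .
qed

lemma fourier_gauss_scaled:
  fixes x :: "'a::euclidean_space"
  assumes "\<epsilon> > 0"
  shows "(\<integral>\<xi>. cis (\<xi> \<bullet> x) * of_real (gauss (\<epsilon> *\<^sub>R \<xi>)) \<partial>lborel)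
    = of_real (exp (- (norm x)\<^sup>2 / (2 * \<epsilon>\<^sup>2)) / \<epsilon> ^ DIM('a))"
proof -
  have "(\<integral>\<xi>. cis (\<xi> \<bullet> x) * of_real (gauss (\<epsilon> *\<^sub>R \<xi>)) \<partial>lborel) =
     of_real ((1/\<epsilon>) ^ DIM('a)) * (\<integral>z. cis (z \<bullet> (x /\<^sub>R \<epsilon>)) * of_real (gauss z) \<partial>lborel)"
    using assms by (subst integral_lborel_scale[where c="1/\<epsilon>"]) (auto simp: divide_inverse_commute)
  also have "\<dots> = of_real ((1/\<epsilon>) ^ DIM('a)) * of_real (exp (- (norm (x /\<^sub>R \<epsilon>))\<^sup>2 / 2))"
    unfolding fourier_gauss ..
  finally show ?thesis using assms by (simp add: power_divide field_simps power_mult_distrib)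
qed

text \<open>For \<open>k x y = cis (x \<bullet> y)\<close> this is the multiplication formula of the
  Fourier transform; with the phase of a slice as kernel it passes from the extension operator to
  its dual.\<close>

lemma integral_kernel_swap:
  fixes g :: "'a::euclidean_space \<Rightarrow> complex" and f :: "'b::euclidean_space \<Rightarrow> complex" and k :: "'a \<Rightarrow> 'b \<Rightarrow> complex"
  assumes g: "integrable lborel g" and f: "integrable lborel f"
    and [measurable]: "(\<lambda>z. k (fst z) (snd z)) \<in> borel_measurable (borel \<Otimes>\<^sub>M borel)"
    and k: "\<And>x y. norm (k x y) \<le> 1"
  shows "(\<integral>x. g x * (\<integral>y. k x y * f y \<partial>lborel) \<partial>lborel) = (\<integral>y. f y * (\<integral>x. k x y * g x \<partial>lborel) \<partial>lborel)"
proof -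
  have [measurable]: "g \<in> borel_measurable borel" "f \<in> borel_measurable borel"
    using f g borel_measurable_integrable by force+
  have [measurable]: "(\<lambda>y. k x y) \<in> borel_measurable borel" "(\<lambda>x. k x y) \<in> borel_measurable borel" for x y
    using measurable_compose[OF measurable_Pair1'[of x borel borel], of "\<lambda>z. k (fst z) (snd z)" borel]
      measurable_compose[OF measurable_Pair2'[of y borel borel], of "\<lambda>z. k (fst z) (snd z)" borel] by auto
  have kf: "integrable lborel (\<lambda>y. k x y * f y)" for x
    by (rule Bochner_Integration.integrable_bound[OF f]) (auto simp: norm_mult intro!: AE_I2 mult_left_le_one_le k)
  have kg: "integrable lborel (\<lambda>x. k x y * g x)" for y
    by (rule Bochner_Integration.integrable_bound[OF g]) (auto simp: norm_mult intro!: AE_I2 mult_left_le_one_le k)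
  have "integrable (lborel \<Otimes>\<^sub>M lborel) (\<lambda>z. norm (g (fst z)) * norm (f (snd z)))"
    by (rule lborel_pair.Fubini_integrable) (use f g in auto)
  then have int: "integrable (lborel \<Otimes>\<^sub>M lborel) (\<lambda>z. g (fst z) * (k (fst z) (snd z) * f (snd z)))"
    by (rule Bochner_Integration.integrable_bound)
       (auto simp: norm_mult intro!: AE_I2 mult_left_mono mult_left_le_one_le k)
  have "(\<integral>x. g x * (\<integral>y. k x y * f y \<partial>lborel) \<partial>lborel) = (\<integral>x. (\<integral>y. g x * (k x y * f y) \<partial>lborel) \<partial>lborel)"
    using kf by simp
  also have "\<dots> = (\<integral>y. (\<integral>x. g x * (k x y * f y) \<partial>lborel) \<partial>lborel)"
    by (rule lborel_pair.Fubini_integral[symmetric]) (use int in \<open>simp add: case_prod_unfold\<close>)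
  also have "\<dots> = (\<integral>y. (\<integral>x. f y * (k x y * g x) \<partial>lborel) \<partial>lborel)"
    by (simp add: mult_ac)
  also have "\<dots> = (\<integral>y. f y * (\<integral>x. k x y * g x \<partial>lborel) \<partial>lborel)"
    using kg by simp
  finally show ?thesis .
qed

lemma cis_kernel_measurable[measurable]:
  "(\<lambda>z. cis (fst z \<bullet> snd z)) \<in> borel_measurable (borel \<Otimes>\<^sub>M (borel :: 'a::euclidean_space measure))"
  by measurable

lemma FT1_measurable[measurable]:
  fixes \<psi> :: "'a::euclidean_space \<Rightarrow> complex"
  assumes [measurable]: "\<psi> \<in> borel_measurable borel"
  shows "FT1 \<psi> \<in> borel_measurable borel"
  unfolding FT1_def[abs_def] cis_conv_exp
  by (rule lborel.borel_measurable_lebesgue_integral) (simp add: case_prod_unfold)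

lemma norm_FT1_le:
  assumes "integrable lborel \<psi>"
  shows "norm (FT1 \<psi> \<xi>) \<le> (\<integral>x. norm (\<psi> x) \<partial>lborel)"
  unfolding FT1_def by (rule integral_norm_bound[THEN order_trans]) (simp add: norm_mult)

text \<open>The Gaussian cutoff \<open>gauss (\<epsilon> \<xi>)\<close> turns \<open>\<bar>FT1 \<psi>\<bar>\<^sup>2\<close> into a double integral of
  \<open>\<psi>\<close> against an explicit positive kernel.\<close>
lemma Plancherel_gauss_le:
  fixes \<psi> :: "'a::euclidean_space \<Rightarrow> complex"
  assumes int: "integrable lborel \<psi>" and \<epsilon>: "\<epsilon> > 0"
  shows "(\<integral>\<^sup>+\<xi>. ennreal (gauss (\<epsilon> *\<^sub>R \<xi>) * (norm (FT1 \<psi> \<xi>))\<^sup>2) \<partial>lborel)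
    \<le> ennreal (sqrt (2 * pi) ^ DIM('a)) * (\<integral>\<^sup>+x. ennreal ((norm (\<psi> x))\<^sup>2) \<partial>lborel)"
proof -
  have m[measurable]: "\<psi> \<in> borel_measurable borel" using int borel_measurable_integrable by force
  \<comment> \<open>K is the Fourier transform of the cutoff
    \<open>gauss (\<epsilon> *\<^sub>R \<xi>)\<close>. Its mass does not depend on \<epsilon>, so
    the estimate survives the limit in which the cutoff disappears.\<close>
  define K where "K z = exp (- (norm z)\<^sup>2 / (2 * \<epsilon>\<^sup>2)) / \<epsilon> ^ DIM('a)" for z :: 'a
  have [measurable]: "K \<in> borel_measurable borel" unfolding K_def by measurable
  have K0: "K z \<ge> 0" for z using \<epsilon> by (simp add: K_def)
  have Kint: "(\<integral>\<^sup>+z. ennreal (K z) \<partial>lborel) = ennreal (sqrt (2 * pi) ^ DIM('a))"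
  proof -
    have "(\<integral>\<^sup>+z. ennreal (K z) \<partial>lborel) = ennreal (\<epsilon> ^ DIM('a)) * (\<integral>\<^sup>+z. ennreal (K (\<epsilon> *\<^sub>R z)) \<partial>lborel)"
      by (rule nn_integral_lborel_scale) (use \<epsilon> in auto)
    also have "(\<integral>\<^sup>+z. ennreal (K (\<epsilon> *\<^sub>R z)) \<partial>lborel) = (\<integral>\<^sup>+z. ennreal (sqrt (2 * pi) ^ DIM('a) / \<epsilon> ^ DIM('a)) * ennreal (gauss z) \<partial>(lborel :: 'a measure))"
      using \<epsilon> by (intro nn_integral_cong) (simp add: ennreal_mult[symmetric] less_imp_le[OF gauss_pos] K_def gauss_def power_mult_distrib)
    also have "\<dots> = ennreal (sqrt (2 * pi) ^ DIM('a) / \<epsilon> ^ DIM('a))"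
      by (simp add: nn_integral_cmult nn_integral_gauss)
    finally show ?thesis using \<epsilon> by (simp add: ennreal_mult[symmetric])
  qed
  have gint: "integrable lborel (\<lambda>\<xi>::'a. gauss (\<epsilon> *\<^sub>R \<xi>))" using \<epsilon> by (rule integrable_gauss_scaled)
  define G where "G \<xi> = complex_of_real (gauss (\<epsilon> *\<^sub>R \<xi>))" for \<xi> :: 'a
  have G: "integrable lborel G" unfolding G_def using gint by simp
  have [measurable]: "G \<in> borel_measurable borel" unfolding G_def by measurable
  define L where "L = (\<integral>x. norm (\<psi> x) \<partial>lborel)"
  have FL: "norm (FT1 \<psi> \<xi>) \<le> L" for \<xi> unfolding L_def by (rule norm_FT1_le[OF int])
  have GF: "integrable lborel (\<lambda>\<xi>. G \<xi> * cnj (FT1 \<psi> \<xi>))"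
  proof (rule Bochner_Integration.integrable_bound[OF integrable_mult_right[OF gint, of L]])
    show "AE \<xi> in lborel. norm (G \<xi> * cnj (FT1 \<psi> \<xi>)) \<le> norm (L * gauss (\<epsilon> *\<^sub>R \<xi>))"
    proof (rule AE_I2)
      fix \<xi> :: 'a
      have "norm (G \<xi> * cnj (FT1 \<psi> \<xi>)) = norm (FT1 \<psi> \<xi>) * gauss (\<epsilon> *\<^sub>R \<xi>)"
        using gauss_pos[of "\<epsilon> *\<^sub>R \<xi>"] by (simp add: G_def norm_mult)
      also have "\<dots> \<le> L * gauss (\<epsilon> *\<^sub>R \<xi>)" by (rule mult_right_mono[OF FL less_imp_le[OF gauss_pos]])
      finally show "norm (G \<xi> * cnj (FT1 \<psi> \<xi>)) \<le> norm (L * gauss (\<epsilon> *\<^sub>R \<xi>))" by simp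
    qed
  qed measurable
  have cint: "integrable lborel (\<lambda>x. cnj (\<psi> x))" using int by simp
  have cnjFT: "cnj (FT1 \<psi> \<xi>) = (\<integral>y. cis (y \<bullet> \<xi>) * cnj (\<psi> y) \<partial>lborel)" for \<xi>
    unfolding FT1_def by (subst Bochner_Integration.integral_cnj[symmetric]) (simp add: cis_cnj)
  have inner: "(\<integral>\<xi>. cis (- (x \<bullet> \<xi>)) * (G \<xi> * cnj (FT1 \<psi> \<xi>)) \<partial>lborel) = (\<integral>y. cnj (\<psi> y) * of_real (K (y - x)) \<partial>lborel)" for x
  proof -
    have "(\<integral>\<xi>. cis (- (x \<bullet> \<xi>)) * (G \<xi> * cnj (FT1 \<psi> \<xi>)) \<partial>lborel) =
      (\<integral>\<xi>. (cis (- (x \<bullet> \<xi>)) * G \<xi>) * (\<integral>y. cis (y \<bullet> \<xi>) * cnj (\<psi> y) \<partial>lborel) \<partial>lborel)"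
      unfolding cnjFT by (simp add: mult_ac)
    also have "\<dots> = (\<integral>y. cnj (\<psi> y) * (\<integral>\<xi>. cis (y \<bullet> \<xi>) * (cis (- (x \<bullet> \<xi>)) * G \<xi>) \<partial>lborel) \<partial>lborel)"
    proof (rule integral_kernel_swap[OF _ cint])
      show "integrable lborel (\<lambda>\<xi>. cis (- (x \<bullet> \<xi>)) * G \<xi>)"
        by (rule Bochner_Integration.integrable_bound[OF G]) (auto simp: norm_mult cis_conv_exp)
    qed (auto simp: cis_conv_exp)
    also have "\<dots> = (\<integral>y. cnj (\<psi> y) * of_real (K (y - x)) \<partial>lborel)"
    proof (rule Bochner_Integration.integral_cong[OF refl])
      fix y
      have "(\<integral>\<xi>. cis (y \<bullet> \<xi>) * (cis (- (x \<bullet> \<xi>)) * G \<xi>) \<partial>lborel) = (\<integral>\<xi>. cis (\<xi> \<bullet> (y - x)) * G \<xi> \<partial>lborel)"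
        by (simp add: mult.assoc[symmetric] cis_mult inner_diff_right inner_commute)
      also have "\<dots> = of_real (K (y - x))"
        unfolding G_def fourier_gauss_scaled[OF \<epsilon>] by (simp add: K_def)
      finally show "cnj (\<psi> y) * (\<integral>\<xi>. cis (y \<bullet> \<xi>) * (cis (- (x \<bullet> \<xi>)) * G \<xi>) \<partial>lborel) = cnj (\<psi> y) * of_real (K (y - x))"
        by simp
    qed
    finally show ?thesis .
  qed
  have "(\<integral>\<xi>. of_real (gauss (\<epsilon> *\<^sub>R \<xi>) * (norm (FT1 \<psi> \<xi>))\<^sup>2) \<partial>lborel) = (\<integral>\<xi>. (G \<xi> * cnj (FT1 \<psi> \<xi>)) * FT1 \<psi> \<xi> \<partial>lborel)"
    by (rule Bochner_Integration.integral_cong) (simp_all only: G_def of_real_mult complex_norm_square mult_ac)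
  also have "\<dots> = (\<integral>x. \<psi> x * (\<integral>\<xi>. cis (- (x \<bullet> \<xi>)) * (G \<xi> * cnj (FT1 \<psi> \<xi>)) \<partial>lborel) \<partial>lborel)"
    unfolding FT1_def[of \<psi> "_"] by (subst integral_kernel_swap[OF GF[unfolded FT1_def] int]) (auto simp: cis_conv_exp)
  also have "\<dots> = (\<integral>x. \<psi> x * (\<integral>y. cnj (\<psi> y) * of_real (K (y - x)) \<partial>lborel) \<partial>lborel)"
    unfolding inner ..
  finally have E: "of_real (\<integral>\<xi>. gauss (\<epsilon> *\<^sub>R \<xi>) * (norm (FT1 \<psi> \<xi>))\<^sup>2 \<partial>lborel) = (\<integral>x. \<psi> x * (\<integral>y. cnj (\<psi> y) * of_real (K (y - x)) \<partial>lborel) \<partial>lborel)"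
    by (simp only: integral_complex_of_real)
  have int2: "integrable lborel (\<lambda>\<xi>. gauss (\<epsilon> *\<^sub>R \<xi>) * (norm (FT1 \<psi> \<xi>))\<^sup>2)"
  proof (rule Bochner_Integration.integrable_bound[OF integrable_mult_left[OF gint, of "L\<^sup>2"]])
    show "AE \<xi> in lborel. norm (gauss (\<epsilon> *\<^sub>R \<xi>) * (norm (FT1 \<psi> \<xi>))\<^sup>2) \<le> norm (gauss (\<epsilon> *\<^sub>R \<xi>) * L\<^sup>2)"
    proof (rule AE_I2)
      fix \<xi> :: 'a
      have "gauss (\<epsilon> *\<^sub>R \<xi>) * (norm (FT1 \<psi> \<xi>))\<^sup>2 \<le> gauss (\<epsilon> *\<^sub>R \<xi>) * L\<^sup>2"
        by (intro mult_left_mono power_mono FL) (simp_all add: less_imp_le[OF gauss_pos])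
      then show "norm (gauss (\<epsilon> *\<^sub>R \<xi>) * (norm (FT1 \<psi> \<xi>))\<^sup>2) \<le> norm (gauss (\<epsilon> *\<^sub>R \<xi>) * L\<^sup>2)"
        using gauss_pos[of "\<epsilon> *\<^sub>R \<xi>"] by simp
    qed
  qed measurable
  have "(\<integral>\<^sup>+\<xi>. ennreal (gauss (\<epsilon> *\<^sub>R \<xi>) * (norm (FT1 \<psi> \<xi>))\<^sup>2) \<partial>lborel) = ennreal (\<integral>\<xi>. gauss (\<epsilon> *\<^sub>R \<xi>) * (norm (FT1 \<psi> \<xi>))\<^sup>2 \<partial>lborel)"
    by (rule nn_integral_eq_integral[OF int2]) (auto simp: less_imp_le[OF gauss_pos])
  also have "\<dots> \<le> ennreal (norm (complex_of_real (\<integral>\<xi>. gauss (\<epsilon> *\<^sub>R \<xi>) * (norm (FT1 \<psi> \<xi>))\<^sup>2 \<partial>lborel)))"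
    by (rule ennreal_leI) simp
  also have "\<dots> \<le> (\<integral>\<^sup>+x. \<integral>\<^sup>+y. ennreal (norm (\<psi> x) * norm (\<psi> y) * K (y - x)) \<partial>lborel \<partial>lborel)"
    unfolding E
  proof (rule order_trans[OF norm_integral_le_nn_integral], rule nn_integral_mono)
    fix x
    have "ennreal (norm (\<integral>y. cnj (\<psi> y) * of_real (K (y - x)) \<partial>lborel)) \<le> (\<integral>\<^sup>+y. ennreal (norm (cnj (\<psi> y) * of_real (K (y - x)))) \<partial>lborel)"
      by (rule norm_integral_le_nn_integral)
    then have "ennreal (norm (\<psi> x)) * ennreal (norm (\<integral>y. cnj (\<psi> y) * of_real (K (y - x)) \<partial>lborel))
       \<le> ennreal (norm (\<psi> x)) * (\<integral>\<^sup>+y. ennreal (norm (cnj (\<psi> y) * of_real (K (y - x)))) \<partial>lborel)"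
      by (rule mult_left_mono) simp
    also have "\<dots> = (\<integral>\<^sup>+y. ennreal (norm (\<psi> x) * norm (\<psi> y) * K (y - x)) \<partial>lborel)"
      by (subst nn_integral_cmult[symmetric]) (auto simp: norm_mult ennreal_mult K0 mult.assoc)
    finally show "ennreal (norm (\<psi> x * (\<integral>y. cnj (\<psi> y) * of_real (K (y - x)) \<partial>lborel))) \<le> (\<integral>\<^sup>+y. ennreal (norm (\<psi> x) * norm (\<psi> y) * K (y - x)) \<partial>lborel)"
      by (simp add: norm_mult ennreal_mult)
  qed
  \<comment> \<open>Schur's argument: the arithmetic-geometric inequality splits the product so that
    in each half one variable meets only K and integrates to its mass; since K is even, the two
    halves are equal.\<close>
  also have "\<dots> \<le> (\<integral>\<^sup>+x. \<integral>\<^sup>+y. ennreal ((norm (\<psi> x))\<^sup>2 / 2 * K (y - x)) + ennreal ((norm (\<psi> y))\<^sup>2 / 2 * K (y - x)) \<partial>lborel \<partial>lborel)"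
  proof (intro nn_integral_mono)
    fix x y
    have "norm (\<psi> x) * norm (\<psi> y) \<le> (norm (\<psi> x))\<^sup>2 / 2 + (norm (\<psi> y))\<^sup>2 / 2"
      using sum_squares_bound[of "norm (\<psi> x)" "norm (\<psi> y)"] by simp
    from mult_right_mono[OF this K0[of "y - x"]]
    have "norm (\<psi> x) * norm (\<psi> y) * K (y - x) \<le> (norm (\<psi> x))\<^sup>2 / 2 * K (y - x) + (norm (\<psi> y))\<^sup>2 / 2 * K (y - x)"
      by (simp only: distrib_right)
    from ennreal_leI[OF this]
    show "ennreal (norm (\<psi> x) * norm (\<psi> y) * K (y - x)) \<le> ennreal ((norm (\<psi> x))\<^sup>2 / 2 * K (y - x)) + ennreal ((norm (\<psi> y))\<^sup>2 / 2 * K (y - x))"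
      by (simp add: K0 ennreal_plus)
  qed
  also have "\<dots> = (\<integral>\<^sup>+x. \<integral>\<^sup>+y. ennreal ((norm (\<psi> x))\<^sup>2 / 2 * K (y - x)) \<partial>lborel \<partial>lborel) + (\<integral>\<^sup>+x. \<integral>\<^sup>+y. ennreal ((norm (\<psi> y))\<^sup>2 / 2 * K (y - x)) \<partial>lborel \<partial>lborel)"
    by (simp add: nn_integral_add)
  also have "(\<integral>\<^sup>+x. \<integral>\<^sup>+y. ennreal ((norm (\<psi> y))\<^sup>2 / 2 * K (y - x)) \<partial>lborel \<partial>lborel) = (\<integral>\<^sup>+y. \<integral>\<^sup>+x. ennreal ((norm (\<psi> y))\<^sup>2 / 2 * K (y - x)) \<partial>lborel \<partial>lborel)"
    by (rule lborel_pair.Fubini') (simp add: case_prod_unfold)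
  also have "(\<integral>\<^sup>+y. \<integral>\<^sup>+x. ennreal ((norm (\<psi> y))\<^sup>2 / 2 * K (y - x)) \<partial>lborel \<partial>lborel) = (\<integral>\<^sup>+x. \<integral>\<^sup>+y. ennreal ((norm (\<psi> x))\<^sup>2 / 2 * K (y - x)) \<partial>lborel \<partial>lborel)"
    by (simp add: K_def norm_minus_commute)
  also have "(\<integral>\<^sup>+x. \<integral>\<^sup>+y. ennreal ((norm (\<psi> x))\<^sup>2 / 2 * K (y - x)) \<partial>lborel \<partial>lborel) =
      (\<integral>\<^sup>+x. ennreal ((norm (\<psi> x))\<^sup>2 / 2) * ennreal (sqrt (2 * pi) ^ DIM('a)) \<partial>lborel)"
  proof (rule nn_integral_cong)
    fix x
    have "(\<integral>\<^sup>+y. ennreal ((norm (\<psi> x))\<^sup>2 / 2 * K (y - x)) \<partial>lborel) = ennreal ((norm (\<psi> x))\<^sup>2 / 2) * (\<integral>\<^sup>+y. ennreal (K (y + - x)) \<partial>lborel)"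
    proof -
      have "ennreal ((norm (\<psi> x))\<^sup>2 / 2 * K (y - x)) = ennreal ((norm (\<psi> x))\<^sup>2 / 2) * ennreal (K (y + - x))" for y
        using K0[of "y - x"] by (subst ennreal_mult[symmetric]) auto
      then show ?thesis by (simp only:) (rule nn_integral_cmult, measurable)
    qed
    also have "(\<integral>\<^sup>+y. ennreal (K (y + - x)) \<partial>lborel) = ennreal (sqrt (2 * pi) ^ DIM('a))"
      unfolding Kint[symmetric] by (rule nn_integral_lborel_translate) measurable
    finally show "(\<integral>\<^sup>+y. ennreal ((norm (\<psi> x))\<^sup>2 / 2 * K (y - x)) \<partial>lborel) = ennreal ((norm (\<psi> x))\<^sup>2 / 2) * ennreal (sqrt (2 * pi) ^ DIM('a))" .
  qed
  also have "\<dots> + \<dots> = ennreal (sqrt (2 * pi) ^ DIM('a)) * (\<integral>\<^sup>+x. ennreal ((norm (\<psi> x))\<^sup>2) \<partial>lborel)"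
  proof -
    let ?Y = "\<integral>\<^sup>+x. ennreal ((norm (\<psi> x))\<^sup>2 / 2) \<partial>lborel"
    have "?Y + ?Y = (\<integral>\<^sup>+x. ennreal ((norm (\<psi> x))\<^sup>2 / 2) + ennreal ((norm (\<psi> x))\<^sup>2 / 2) \<partial>lborel)"
      by (rule nn_integral_add[symmetric]) measurable
    also have "\<dots> = (\<integral>\<^sup>+x. ennreal ((norm (\<psi> x))\<^sup>2) \<partial>lborel)"
      by (intro nn_integral_cong) (simp add: ennreal_plus[symmetric] del: ennreal_plus)
    finally have Y: "?Y + ?Y = (\<integral>\<^sup>+x. ennreal ((norm (\<psi> x))\<^sup>2) \<partial>lborel)" .
    have "(\<integral>\<^sup>+x. ennreal ((norm (\<psi> x))\<^sup>2 / 2) * ennreal (sqrt (2 * pi) ^ DIM('a)) \<partial>lborel) = ennreal (sqrt (2 * pi) ^ DIM('a)) * ?Y"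
      by (subst nn_integral_multc) (measurable, rule mult.commute)
    then show ?thesis unfolding Y[symmetric] by (simp only: distrib_left)
  qed
  finally show ?thesis .
qed

text \<open>Fatou's lemma as the cutoff is removed. The factor c normalises the cutoff to 1 at the
  origin; multiplied by the c of \<open>Plancherel_gauss_le\<close> it gives (2 pi)^d.\<close>

lemma Plancherel_le:
  fixes \<psi> :: "'a::euclidean_space \<Rightarrow> complex"
  assumes int: "integrable lborel \<psi>"
  shows "(\<integral>\<^sup>+\<xi>. ennreal ((norm (FT1 \<psi> \<xi>))\<^sup>2) \<partial>lborel) \<le> ennreal ((2 * pi) ^ DIM('a)) * (\<integral>\<^sup>+x. ennreal ((norm (\<psi> x))\<^sup>2) \<partial>lborel)"
proof -
  have [measurable]: "\<psi> \<in> borel_measurable borel" using int borel_measurable_integrable by force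
  define c where "c = sqrt (2 * pi) ^ DIM('a)"
  have c: "c > 0" "c * c = (2 * pi) ^ DIM('a)" by (simp_all only: c_def power_mult_distrib[symmetric]) simp_all
  let ?h = "\<lambda>n \<xi>. ennreal (c * gauss ((1 / Suc n) *\<^sub>R \<xi>) * (norm (FT1 \<psi> \<xi>))\<^sup>2)"
  have lim: "(\<lambda>n. c * gauss ((1 / Suc n) *\<^sub>R \<xi>)) \<longlonglongrightarrow> c * gauss (0 *\<^sub>R \<xi>)" for \<xi> :: 'a
    unfolding gauss_def by (intro tendsto_intros LIMSEQ_inverse_real_of_nat[unfolded inverse_eq_divide]) auto
  have "(\<integral>\<^sup>+\<xi>. ennreal ((norm (FT1 \<psi> \<xi>))\<^sup>2) \<partial>lborel) = (\<integral>\<^sup>+\<xi>. liminf (\<lambda>n. ?h n \<xi>) \<partial>lborel)"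
  proof (rule nn_integral_cong)
    fix \<xi> :: 'a
    have "(\<lambda>n. ?h n \<xi>) \<longlonglongrightarrow> ennreal (c * gauss (0 *\<^sub>R \<xi>) * (norm (FT1 \<psi> \<xi>))\<^sup>2)"
      by (intro tendsto_ennrealI tendsto_mult_right lim)
    moreover have "c * gauss (0 *\<^sub>R \<xi>) = 1" by (simp add: c_def gauss_def)
    ultimately show "ennreal ((norm (FT1 \<psi> \<xi>))\<^sup>2) = liminf (\<lambda>n. ?h n \<xi>)"
      using lim_imp_Liminf[OF trivial_limit_sequentially] by fastforce
  qed
  also have "\<dots> \<le> liminf (\<lambda>n. \<integral>\<^sup>+\<xi>. ?h n \<xi> \<partial>lborel)"
    by (rule nn_integral_liminf) auto
  also have "\<dots> \<le> ennreal ((2 * pi) ^ DIM('a)) * (\<integral>\<^sup>+x. ennreal ((norm (\<psi> x))\<^sup>2) \<partial>lborel)"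
  proof (rule order_trans[OF Liminf_mono[OF always_eventually]])
    show "\<forall>n. (\<integral>\<^sup>+\<xi>. ?h n \<xi> \<partial>lborel) \<le> ennreal ((2 * pi) ^ DIM('a)) * (\<integral>\<^sup>+x. ennreal ((norm (\<psi> x))\<^sup>2) \<partial>lborel)"
    proof
      fix n
      have "(\<integral>\<^sup>+\<xi>. ?h n \<xi> \<partial>lborel) = ennreal c * (\<integral>\<^sup>+\<xi>. ennreal (gauss ((1 / Suc n) *\<^sub>R \<xi>) * (norm (FT1 \<psi> \<xi>))\<^sup>2) \<partial>lborel)"
        using c(1) by (subst nn_integral_cmult[symmetric]) (auto simp: ennreal_mult less_imp_le[OF gauss_pos] mult.assoc)
      also have "\<dots> \<le> ennreal c * (ennreal c * (\<integral>\<^sup>+x. ennreal ((norm (\<psi> x))\<^sup>2) \<partial>lborel))"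
        unfolding c_def by (intro mult_left_mono Plancherel_gauss_le[OF int]) auto
      finally show "(\<integral>\<^sup>+\<xi>. ?h n \<xi> \<partial>lborel) \<le> ennreal ((2 * pi) ^ DIM('a)) * (\<integral>\<^sup>+x. ennreal ((norm (\<psi> x))\<^sup>2) \<partial>lborel)"
        using c by (simp add: mult.assoc[symmetric] ennreal_mult[symmetric])
    qed
  qed (simp add: Liminf_const)
  finally show ?thesis .
qed

section \<open>Interpolation and fractional integration on the line\<close>

lemma nn_integral_abs_le:
  fixes h :: "real \<Rightarrow> ennreal"
  assumes [measurable]: "h \<in> borel_measurable borel"
  shows "(\<integral>\<^sup>+s. h \<bar>s\<bar> \<partial>lborel) \<le> 2 * (\<integral>\<^sup>+s. h s * indicator {0..} s \<partial>lborel)"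
proof -
  have "(\<integral>\<^sup>+s. h \<bar>s\<bar> \<partial>lborel) \<le> (\<integral>\<^sup>+s. h s * indicator {0..} s + h (-s) * indicator {0..} (-s) \<partial>lborel)"
    by (rule nn_integral_mono) (auto simp: indicator_def)
  also have "\<dots> = (\<integral>\<^sup>+s. h s * indicator {0..} s \<partial>lborel) + (\<integral>\<^sup>+s. h (-s) * indicator {0..} (-s) \<partial>lborel)"
    by (rule nn_integral_add) auto
  also have "(\<integral>\<^sup>+s. h (-s) * indicator {0..} (-s) \<partial>lborel) = (\<integral>\<^sup>+s. h s * indicator {0..} s \<partial>distr lborel borel uminus)"
    by (subst nn_integral_distr) auto
  finally show ?thesis by (simp add: lborel_distr_uminus mult_2)
qed

lemma nn_integral_powr_from_0:
  fixes c \<gamma> :: real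
  assumes "c \<ge> 0" "\<gamma> > -1"
  shows "(\<integral>\<^sup>+b. ennreal (b powr \<gamma>) * indicator {0..c} b \<partial>lborel) = ennreal (c powr (\<gamma>+1) / (\<gamma>+1))"
  by (rule nn_integral_has_integral_lebesgue'[OF _ has_integral_powr_from_0[OF assms(2,1)]]) auto

text \<open>Where \<open>a b > M\<close> the first bound on \<open>H\<close> is summed, elsewhere the second one;
  \<open>M\<close> balances the two contributions.\<close>
lemma level_set_interpolation:
  fixes v w :: "real \<Rightarrow> real" and H :: "real \<Rightarrow> real \<Rightarrow> ennreal" and \<alpha> q A B V W :: real
  assumes \<alpha>: "0 < \<alpha>" "\<alpha> < 1" and q: "q = 2 / (2 - \<alpha>)" and A: "A > 0" and B: "B > 0"
    and [measurable]: "v \<in> borel_measurable borel" "w \<in> borel_measurable borel"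
    and v0: "\<And>a. v a \<ge> 0" "\<And>a. a \<le> 0 \<Longrightarrow> v a = 0"
    and w0: "\<And>a. w a \<ge> 0" "\<And>a. a \<le> 0 \<Longrightarrow> w a = 0"
    and H1: "\<And>a b. H a b \<le> ennreal (A * v a * w b)"
    and H2: "\<And>a b. H a b \<le> ennreal (B * sqrt (v a * w b))"
    and V: "V > 0" "(\<integral>\<^sup>+a. ennreal (a powr (q - 1) * v a) \<partial>lborel) = ennreal V"
    and W: "W > 0" "(\<integral>\<^sup>+a. ennreal (a powr (q - 1) * w a) \<partial>lborel) = ennreal W"
  shows "(\<integral>\<^sup>+a. \<integral>\<^sup>+b. H a b \<partial>lborel \<partial>lborel)
     \<le> ennreal ((1 + (2 - \<alpha>) / (1 - \<alpha>)) * A powr (1 - \<alpha>) * B powr \<alpha> * (V * W) powr (1 - \<alpha>/2))"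
proof -
  define Z where "Z = sqrt (V * W)"
  \<comment> \<open>The exponent makes A M^(1-q) V W equal to A^(1-\<alpha>) B^\<alpha>
    Z^(2-\<alpha>), and B Z M^(1-q/2) as well.\<close>
  define M where "M = (A * Z / B) powr (2 - \<alpha>)"
  \<comment> \<open>The weight l evens out the two functions: \<open>l * V\<close> and
    \<open>W / l\<close> both equal the geometric mean Z.\<close>
  define l where "l = sqrt (W / V)"
  \<comment> \<open>k is the integral of b^(-q/2) over [0, 1]; it is finite because \<alpha> < 1
    gives q < 2.\<close>
  define k where "k = 1 / (1 - q/2)"
  have k: "k = (2 - \<alpha>) / (1 - \<alpha>)" using \<alpha> by (simp add: k_def q field_simps)
  have q1: "q > 1" "q < 2" using \<alpha> by (auto simp: q field_simps)
  have Z: "Z > 0" "Z * Z = V * W" using V W by (auto simp: Z_def)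
  have M: "M > 0" using Z A B by (simp add: M_def)
  have lam: "l > 0" using V W by (simp add: l_def)
  have lamV: "l * V = Z" "W / l = Z"
    using V W by (simp_all add: l_def Z_def real_sqrt_divide real_sqrt_mult field_simps)
  define T1 where "T1 a b = A * M powr (1 - q) * (a powr (q - 1) * v a) * (b powr (q - 1) * w b)" for a b
  define T2 where "T2 a b = B * (l / 2 * v a * (a powr (q/2)) * ((b powr (- (q/2))) * indicator {0..M/a} b))" for a b
  define T3 where "T3 a b = B * (1 / (2 * l) * w b * (b powr (q/2)) * ((a powr (- (q/2))) * indicator {0..M/b} a))" for a b
  have T_nonneg: "T1 a b \<ge> 0" "T2 a b \<ge> 0" "T3 a b \<ge> 0" for a b
    using A B lam v0 w0 by (auto simp: T1_def T2_def T3_def)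
  have H: "H a b \<le> ennreal (T1 a b) + ennreal (T2 a b) + ennreal (T3 a b)" for a b
  proof (cases "a > 0 \<and> b > 0")
    case False
    then have "v a * w b = 0" using v0(2)[of a] w0(2)[of b] by auto
    then have "H a b \<le> 0" using H1[of a b] by (auto simp: mult.assoc)
    then show ?thesis by auto
  next
    case ab: True
    show ?thesis
    proof (cases "a * b > M")
      case True
      \<comment> \<open>Chebyshev's inequality: for a b > M the factor (a b / M)^(q-1) is at least
        1, and it turns v and w into the densities whose integrals are V and W.\<close>
      have "M powr (1 - q) * (a powr (q - 1)) * (b powr (q - 1)) = (a * b / M) powr (q - 1)"
        using ab M by (simp add: powr_mult powr_divide powr_minus[symmetric] powr_diff field_simps)
      also have "\<dots> \<ge> 1" using True M q1 by (intro ge_one_powr_ge_zero) auto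
      finally have "1 * (A * v a * w b) \<le> (M powr (1 - q) * (a powr (q - 1)) * (b powr (q - 1))) * (A * v a * w b)"
        by (rule mult_right_mono) (use A v0 w0 in auto)
      then have "A * v a * w b \<le> T1 a b" by (simp add: T1_def mult_ac)
      then have "H a b \<le> ennreal (T1 a b)" using H1[of a b] order_trans ennreal_leI by blast
      also have "\<dots> \<le> ennreal (T1 a b) + (ennreal (T2 a b) + ennreal (T3 a b))" by simp
      finally show ?thesis by (simp add: add.assoc)
    next
      case False
      \<comment> \<open>The weighted arithmetic-geometric inequality separates v a from w b. The
        powers q/2 are chosen so that integrating b^(-q/2) over b \<le> M / a returns the factor
        a^(q-1) of V, and symmetrically for W.\<close>
      define c where "c = l * (a powr (q/2)) * (b powr (-(q/2)))"
      have c: "c > 0" using ab lam by (simp add: c_def)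
      have ic: "1 / c = 1 / l * (b powr (q/2)) * (a powr (-(q/2)))"
        using ab lam by (simp add: c_def powr_minus field_simps)
      have "sqrt (v a * w b) = sqrt ((c * v a) * (w b / c))" using c by simp
      also have "\<dots> \<le> (c * v a + w b / c) / 2"
        by (rule arith_geo_mean_sqrt) (use c v0 w0 in auto)
      also have "\<dots> = (c * v a + w b * (1/c)) / 2" by simp
      finally have "B * sqrt (v a * w b) \<le> B * ((c * v a + w b * (1/c)) / 2)"
        using B by (intro mult_left_mono) auto
      also have "\<dots> = T2 a b + T3 a b"
        using ab False unfolding ic T2_def T3_def unfolding c_def
        by (simp add: field_simps indicator_def)
      finally have "H a b \<le> ennreal (T2 a b + T3 a b)" using H2[of a b] order_trans ennreal_leI by blast
      also have "\<dots> \<le> ennreal (T1 a b) + (ennreal (T2 a b) + ennreal (T3 a b))"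
        using T_nonneg by simp
      finally show ?thesis by (simp add: add.assoc)
    qed
  qed
  have [measurable]: "(\<lambda>z. ennreal (T1 (fst z) (snd z))) \<in> borel_measurable (borel \<Otimes>\<^sub>M borel)"
    "(\<lambda>z. ennreal (T2 (fst z) (snd z))) \<in> borel_measurable (borel \<Otimes>\<^sub>M borel)"
    "(\<lambda>z. ennreal (T3 (fst z) (snd z))) \<in> borel_measurable (borel \<Otimes>\<^sub>M borel)"
    by (simp_all add: T1_def T2_def T3_def indicator_def cong: if_cong)
  have I1: "(\<integral>\<^sup>+a. \<integral>\<^sup>+b. ennreal (T1 a b) \<partial>lborel \<partial>lborel) = ennreal (A * M powr (1 - q) * V * W)"
  proof -
    have "(\<integral>\<^sup>+b. ennreal (T1 a b) \<partial>lborel) = ennreal (a powr (q - 1) * v a) * ennreal (A * M powr (1 - q) * W)" for a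
    proof -
      have "(\<integral>\<^sup>+b. ennreal (T1 a b) \<partial>lborel) = (\<integral>\<^sup>+b. ennreal (A * M powr (1 - q) * (a powr (q - 1) * v a)) * ennreal (b powr (q - 1) * w b) \<partial>lborel)"
        unfolding T1_def using A v0 w0 by (intro nn_integral_cong ennreal_mult) auto
      also have "\<dots> = ennreal (A * M powr (1 - q) * (a powr (q - 1) * v a)) * ennreal W"
        by (subst nn_integral_cmult) (auto simp: W)
      finally show ?thesis using A v0 W by (simp add: ennreal_mult[symmetric] mult_ac)
    qed
    then show ?thesis using A V W by (simp add: nn_integral_multc ennreal_mult[symmetric] mult_ac)
  qed
  have key: "(a powr (q/2)) * ((M / a) powr (1 - q/2) * k) = (a powr (q - 1)) * (M powr (1 - q/2) * k)" if "a > 0" for a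
  proof -
    have "(a powr (q/2)) * (M / a) powr (1 - q/2) = M powr (1 - q/2) * (a powr (q/2) / a powr (1 - q/2))"
      using that M by (simp add: powr_divide)
    also have "a powr (q/2) / a powr (1 - q/2) = a powr (q - 1)"
      using that by (simp add: powr_diff[symmetric])
    finally show ?thesis by (simp add: mult_ac)
  qed
  have inn: "(\<integral>\<^sup>+b. ennreal ((b powr (- (q/2))) * indicator {0..M/a} b) \<partial>lborel) = ennreal ((M / a) powr (1 - q/2) * k)" if "a > 0" for a
    using nn_integral_powr_from_0[of "M/a" "-(q/2)"] that M q1
    by (simp add: k_def nn_integral_set_ennreal)
  have I2: "(\<integral>\<^sup>+a. \<integral>\<^sup>+b. ennreal (T2 a b) \<partial>lborel \<partial>lborel) = ennreal (B * (l / 2 * V) * (M powr (1 - q/2) * k))"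
  proof -
    have "(\<integral>\<^sup>+b. ennreal (T2 a b) \<partial>lborel) = ennreal (a powr (q - 1) * v a) * ennreal (B * l / 2 * (M powr (1 - q/2) * k))" for a
    proof (cases "a > 0")
      case True
      have "(\<integral>\<^sup>+b. ennreal (T2 a b) \<partial>lborel) = ennreal (B * (l / 2 * v a * (a powr (q/2)))) *
        (\<integral>\<^sup>+b. ennreal ((b powr (- (q/2))) * indicator {0..M/a} b) \<partial>lborel)"
        unfolding T2_def using B lam v0
        by (subst nn_integral_cmult[symmetric]) (auto simp: ennreal_mult[symmetric] mult_ac)
      also have "\<dots> = ennreal (B * l / 2 * v a * ((a powr (q/2)) * ((M / a) powr (1 - q/2) * k)))"
        unfolding inn[OF True] using B lam v0 q1
        by (subst ennreal_mult[symmetric]) (auto simp: mult_ac k_def)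
      finally show ?thesis unfolding key[OF True] using B lam v0 q1
        by (subst ennreal_mult[symmetric]) (auto simp: mult_ac k_def)
    qed (use v0(2)[of a] in \<open>simp add: T2_def\<close>)
    then show ?thesis using B V lam k \<alpha>
      by (simp add: nn_integral_multc ennreal_mult[symmetric] mult_ac)
  qed
  have I3: "(\<integral>\<^sup>+b. \<integral>\<^sup>+a. ennreal (T3 a b) \<partial>lborel \<partial>lborel) = ennreal (B * (W / l / 2) * (M powr (1 - q/2) * k))"
  proof -
    have "(\<integral>\<^sup>+a. ennreal (T3 a b) \<partial>lborel) = ennreal (b powr (q - 1) * w b) * ennreal (B / (2 * l) * (M powr (1 - q/2) * k))" for b
    proof (cases "b > 0")
      case True
      have "(\<integral>\<^sup>+a. ennreal (T3 a b) \<partial>lborel) = ennreal (B * (1 / (2 * l) * w b * (b powr (q/2)))) *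
        (\<integral>\<^sup>+a. ennreal ((a powr (- (q/2))) * indicator {0..M/b} a) \<partial>lborel)"
        unfolding T3_def using B lam w0
        by (subst nn_integral_cmult[symmetric]) (auto simp: ennreal_mult[symmetric] mult_ac)
      also have "\<dots> = ennreal (B / (2 * l) * w b * ((b powr (q/2)) * ((M / b) powr (1 - q/2) * k)))"
        unfolding inn[OF True] using B lam w0 q1
        by (subst ennreal_mult[symmetric]) (auto simp: mult_ac k_def)
      finally show ?thesis unfolding key[OF True] using B lam w0 q1
        by (subst ennreal_mult[symmetric]) (auto simp: mult_ac k_def)
    qed (use w0(2)[of b] in \<open>simp add: T3_def\<close>)
    then show ?thesis using B W lam k \<alpha>
      by (simp add: nn_integral_multc ennreal_mult[symmetric] mult_ac)
  qed
  have I3': "(\<integral>\<^sup>+a. \<integral>\<^sup>+b. ennreal (T3 a b) \<partial>lborel \<partial>lborel) = (\<integral>\<^sup>+b. \<integral>\<^sup>+a. ennreal (T3 a b) \<partial>lborel \<partial>lborel)"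
    by (rule lborel_pair.Fubini') (simp add: T3_def case_prod_unfold indicator_def cong: if_cong)
  have "(\<integral>\<^sup>+a. \<integral>\<^sup>+b. H a b \<partial>lborel \<partial>lborel) \<le>
     (\<integral>\<^sup>+a. \<integral>\<^sup>+b. ennreal (T1 a b) + ennreal (T2 a b) + ennreal (T3 a b) \<partial>lborel \<partial>lborel)"
    by (intro nn_integral_mono H)
  also have "\<dots> = (\<integral>\<^sup>+a. \<integral>\<^sup>+b. ennreal (T1 a b) \<partial>lborel \<partial>lborel) +
      (\<integral>\<^sup>+a. \<integral>\<^sup>+b. ennreal (T2 a b) \<partial>lborel \<partial>lborel) + (\<integral>\<^sup>+a. \<integral>\<^sup>+b. ennreal (T3 a b) \<partial>lborel \<partial>lborel)"
  proof -
    have [measurable]: "(\<lambda>b. ennreal (T1 a b)) \<in> borel_measurable borel" "(\<lambda>b. ennreal (T2 a b)) \<in> borel_measurable borel"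
      "(\<lambda>b. ennreal (T3 a b)) \<in> borel_measurable borel" for a
      by (simp_all add: T1_def T2_def T3_def indicator_def cong: if_cong)
    have [measurable]: "(\<lambda>a. \<integral>\<^sup>+b. ennreal (T1 a b) \<partial>lborel) \<in> borel_measurable borel"
      "(\<lambda>a. \<integral>\<^sup>+b. ennreal (T2 a b) \<partial>lborel) \<in> borel_measurable borel"
      "(\<lambda>a. \<integral>\<^sup>+b. ennreal (T3 a b) \<partial>lborel) \<in> borel_measurable borel"
      by (rule lborel.borel_measurable_nn_integral; simp add: case_prod_unfold)+
    show ?thesis by (simp add: nn_integral_add)
  qed
  also have "\<dots> = ennreal (A * M powr (1 - q) * V * W + B * Z * (M powr (1 - q/2) * k))"
  proof -
    have "B * (l / 2 * V) * (M powr (1 - q/2) * k) + B * (W / l / 2) * (M powr (1 - q/2) * k) = B * Z * (M powr (1 - q/2) * k)"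
      using lamV by (simp add: field_simps)
    moreover have "k > 0" using k \<alpha> by simp
    ultimately show ?thesis unfolding I1 I2 I3' I3 using A B V(1) W(1) lam
      by (simp add: ennreal_plus[symmetric] add.assoc del: ennreal_plus)
  qed
  also have "A * M powr (1 - q) * V * W + B * Z * (M powr (1 - q/2) * k) =
    (1 + (2 - \<alpha>) / (1 - \<alpha>)) * A powr (1 - \<alpha>) * B powr \<alpha> * (V * W) powr (1 - \<alpha>/2)"
  proof -
    have ex: "(2 - \<alpha>) * (1 - q) = - \<alpha>" "(2 - \<alpha>) * (1 - q/2) = 1 - \<alpha>" using \<alpha> by (simp_all add: q field_simps)
    have ZZ: "(V * W) powr (1 - \<alpha>/2) = Z powr (2 - \<alpha>)"
      unfolding Z(2)[symmetric] using Z(1) by (simp add: powr_mult powr_add[symmetric])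
    have "A * M powr (1 - q) * V * W = A * (A * Z / B) powr (- \<alpha>) * (Z * Z)"
      unfolding M_def powr_powr ex Z(2) by simp
    also have "\<dots> = A powr (1 + -\<alpha>) * B powr \<alpha> * Z powr (1 + (1 + - \<alpha>))"
      unfolding powr_add using A B Z(1) by (simp add: powr_mult powr_divide powr_minus field_simps)
    finally have 1: "A * M powr (1 - q) * V * W = A powr (1 -\<alpha>) * B powr \<alpha> * Z powr (2 - \<alpha>)" by simp
    have "B * Z * (M powr (1 - q/2) * k) = B * (A * Z / B) powr (1 - \<alpha>) * Z * k"
      unfolding M_def powr_powr ex by simp
    also have "\<dots> = A powr (1 - \<alpha>) * (B powr 1 / B powr (1 - \<alpha>)) * (Z powr 1 * Z powr (1 - \<alpha>)) * k"
      using A B Z(1) by (simp add: powr_mult powr_divide field_simps)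
    also have "\<dots> = A powr (1 - \<alpha>) * B powr (1 - (1 - \<alpha>)) * Z powr (1 + (1 - \<alpha>)) * k"
      unfolding powr_add powr_diff ..
    finally have 2: "B * Z * (M powr (1 - q/2) * k) = A powr (1 - \<alpha>) * B powr \<alpha> * Z powr (2 - \<alpha>) * k" by simp
    show ?thesis unfolding k[symmetric] 1 2 ZZ by (simp add: algebra_simps)
  qed
  finally show ?thesis .
qed

text \<open>On the region \<open>V s' \<le> V s\<close> the inner integral is split at \<open>\<bar>s - s'\<bar> = N / V s\<close>.\<close>
lemma Hardy_Littlewood_Sobolev_diagonal:
  fixes V :: "real \<Rightarrow> real" and \<alpha> N :: real
  assumes \<alpha>: "0 < \<alpha>" "\<alpha> < 1" and N: "N > 0"
    and [measurable]: "V \<in> borel_measurable borel" and V0: "\<And>s. V s \<ge> 0"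
    and V: "(\<integral>\<^sup>+s. ennreal (V s) \<partial>lborel) = ennreal N"
  shows "(\<integral>\<^sup>+s. \<integral>\<^sup>+s'. ennreal (\<bar>s - s'\<bar> powr (-\<alpha>) * (V s * V s') powr (1 - \<alpha>/2)) \<partial>lborel \<partial>lborel)
     \<le> ennreal ((4 / (1 - \<alpha>) + 6) * N powr (2 - \<alpha>))"
proof -
  \<comment> \<open>In the application V s is a multiple of the q-th power of a slice norm and
    \<beta> = 1 / q, so \<open>(V s * V s') powr \<beta>\<close> is a product of slice norms up to a
    constant.\<close>
  define \<beta> where "\<beta> = 1 - \<alpha>/2"
  have \<beta>: "0 < \<beta>" "\<beta> < 1" "\<beta> + \<alpha>/2 = 1" using \<alpha> by (auto simp: \<beta>_def)
  define f where "f s s' = \<bar>s - s'\<bar> powr (-\<alpha>) * (V s * V s') powr \<beta>" for s s'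
  \<comment> \<open>By the symmetry of f it is enough to treat V s' \<le> V s; pairs with equality
    are counted twice, which only enlarges the bound.\<close>
  define h where "h s s' = f s s' * of_bool (V s' \<le> V s)" for s s'
  have f_sym: "f s s' = f s' s" for s s' by (simp add: f_def abs_minus_commute mult.commute)
  have [measurable]: "(\<lambda>z. ennreal (h (fst z) (snd z))) \<in> borel_measurable (borel \<Otimes>\<^sub>M borel)"
    by (simp add: h_def f_def of_bool_def)
  have inner: "(\<integral>\<^sup>+s'. ennreal (h s s') \<partial>lborel) \<le> ennreal (V s) * ennreal ((2 / (1 - \<alpha>) + 3) * N powr (1 - \<alpha>))" for s
  proof (cases "V s = 0")
    case True
    have "h s s' = 0" for s' using True V0[of s'] \<beta> by (simp add: h_def f_def)
    then show ?thesis by simp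
  next
    case False
    then have Vs: "V s > 0" using V0[of s] by simp
    define r where "r = N / V s"
    have r: "r > 0" using N Vs by (simp add: r_def)
    define c where "c = V s * N powr (1 - \<alpha>)"
    have c: "c > 0" using Vs N by (simp add: c_def)
    define g1 where "g1 d = ennreal (d powr (-\<alpha>)) * indicator {0..r} d" for d :: real
    define g2 where "g2 d = ennreal (r * d powr (-2)) * indicator {r..} d" for d :: real
    have [measurable]: "g1 \<in> borel_measurable borel" "g2 \<in> borel_measurable borel"
      by (simp_all add: g1_def[abs_def] g2_def[abs_def])
    have pt: "ennreal (h s s') \<le> ennreal (V s powr (2 - \<alpha>)) * g1 \<bar>s' + - s\<bar>
        + (ennreal (c / N) * ennreal (V s') + ennreal c * g2 \<bar>s' + - s\<bar>)" for s'
    proof (cases "V s' \<le> V s \<and> s \<noteq> s' \<and> V s' > 0")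
      case False
      then have "h s s' = 0" using V0[of s'] \<beta> \<alpha> by (auto simp: h_def f_def)
      then show ?thesis by simp
    next
      case True
      define d where "d = \<bar>s - s'\<bar>"
      have d: "d > 0" "\<bar>s' + - s\<bar> = d" using True by (auto simp: d_def)
      have hf: "h s s' = d powr (-\<alpha>) * (V s * V s') powr \<beta>" using True by (simp add: h_def f_def d_def)
      show ?thesis
      proof (cases "d \<le> r")
        case near: True
        \<comment> \<open>Near s the larger value V s replaces V s', which leaves a singularity in
          the distance that is integrable because \<alpha> < 1.\<close>
        have "(V s * V s') powr \<beta> \<le> (V s * V s) powr \<beta>"
          by (rule powr_mono2) (use True Vs \<beta> in auto)
        also have "\<dots> = V s powr (2 - \<alpha>)" using Vs by (simp add: powr_mult powr_add[symmetric] \<beta>_def)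
        finally have "h s s' \<le> V s powr (2 - \<alpha>) * d powr (-\<alpha>)"
          unfolding hf by (simp add: mult.commute mult_left_mono)
        then have "ennreal (h s s') \<le> ennreal (V s powr (2 - \<alpha>)) * g1 d"
          using near d by (simp add: g1_def ennreal_mult[symmetric] ennreal_leI)
        then show ?thesis unfolding d(2) by (rule order_trans) simp
      next
        case far: False
        \<comment> \<open>Far from s, Young's inequality with the weights \<beta> and \<alpha>/2,
          whose sum is 1, separates V s' from the distance: d^(-\<alpha>) is the power \<alpha>/2 of
          d^(-2), which is integrable away from 0. The factors 1 / N and r normalise x to integral 1
          and y to integral 1 on each tail.\<close>
        define x where "x = V s' / N"
        define y where "y = r * d powr (-2)"
        have xy: "x > 0" "y > 0" using True N r d by (auto simp: x_def y_def)
        have "x powr \<beta> * y powr (\<alpha>/2) \<le> \<beta> * x + \<alpha>/2 * y"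
          by (rule Youngs_inequality_0) (use xy \<beta> \<alpha> in auto)
        also have "\<dots> \<le> 1 * x + 1 * y" by (intro add_mono mult_right_mono) (use \<beta> \<alpha> xy in auto)
        finally have Y: "x powr \<beta> * y powr (\<alpha>/2) \<le> x + y" by simp
        have dd: "d\<^sup>2 powr (\<alpha>/2) = d powr \<alpha>"
        proof -
          have "d\<^sup>2 powr (\<alpha>/2) = (d powr 2) powr (\<alpha>/2)" using d by simp
          then show ?thesis unfolding powr_powr by simp
        qed
        have "h s s' = (V s powr \<beta> * N powr \<beta> * r powr (-(\<alpha>/2))) * (x powr \<beta> * y powr (\<alpha>/2))"
          unfolding hf x_def y_def using True Vs N r d
          by (simp add: powr_mult powr_divide powr_powr powr_minus dd field_simps)
        also have "V s powr \<beta> * N powr \<beta> * r powr (-(\<alpha>/2)) = V s powr (\<beta> + \<alpha>/2) * N powr (\<beta> - \<alpha>/2)"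
          unfolding r_def powr_add powr_diff using Vs N by (simp add: powr_divide powr_minus field_simps)
        also have "\<dots> = c" unfolding c_def \<beta>(3) using Vs by (simp add: \<beta>_def)
        finally have "h s s' \<le> c * (x + y)" using Y c by simp
        then have "ennreal (h s s') \<le> ennreal (c * x + c * y)" by (simp add: ennreal_leI algebra_simps)
        also have "\<dots> = ennreal (c / N) * ennreal (V s') + ennreal c * g2 d"
          using c xy N V0[of s'] far by (simp add: g2_def y_def[symmetric] ennreal_mult[symmetric] x_def)
        finally show ?thesis unfolding d(2) by (rule order_trans) simp
      qed
    qed
    have G1: "(\<integral>\<^sup>+s'. g1 \<bar>s' + - s\<bar> \<partial>lborel) \<le> ennreal (2 * (r powr (1 - \<alpha>) / (1 - \<alpha>)))"
    proof -
      have "(\<integral>\<^sup>+s'. g1 \<bar>s' + - s\<bar> \<partial>lborel) = (\<integral>\<^sup>+s'. g1 \<bar>s'\<bar> \<partial>lborel)"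
        by (rule nn_integral_lborel_translate) measurable
      also have "\<dots> \<le> 2 * (\<integral>\<^sup>+s. g1 s * indicator {0..} s \<partial>lborel)" by (rule nn_integral_abs_le) measurable
      also have "(\<integral>\<^sup>+s. g1 s * indicator {0..} s \<partial>lborel) = (\<integral>\<^sup>+d. ennreal (d powr (-\<alpha>)) * indicator {0..r} d \<partial>lborel)"
        by (rule nn_integral_cong) (auto simp: g1_def indicator_def)
      also have "\<dots> = ennreal (r powr (1 - \<alpha>) / (1 - \<alpha>))"
        using nn_integral_powr_from_0[of r "-\<alpha>"] r \<alpha> by simp
      finally show ?thesis using ennreal_mult[of 2 "r powr (1 - \<alpha>) / (1 - \<alpha>)"] \<alpha> by simp
    qed
    have G2: "(\<integral>\<^sup>+s'. g2 \<bar>s' + - s\<bar> \<partial>lborel) \<le> 2"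
    proof -
      have "(\<integral>\<^sup>+s'. g2 \<bar>s' + - s\<bar> \<partial>lborel) = (\<integral>\<^sup>+s'. g2 \<bar>s'\<bar> \<partial>lborel)"
        by (rule nn_integral_lborel_translate) measurable
      also have "\<dots> \<le> 2 * (\<integral>\<^sup>+s. g2 s * indicator {0..} s \<partial>lborel)" by (rule nn_integral_abs_le) measurable
      also have "(\<integral>\<^sup>+s. g2 s * indicator {0..} s \<partial>lborel) = (\<integral>\<^sup>+d. ennreal r * (ennreal (d powr (-2)) * indicator {r..} d) \<partial>lborel)"
        using r by (intro nn_integral_cong) (auto simp: g2_def indicator_def ennreal_mult)
      also have "\<dots> = ennreal r * ennreal (r powr (-1))"
        using nn_integral_powr_to_inf[of r "-2"] r by (simp add: nn_integral_cmult)
      also have "\<dots> = 1" using r by (simp add: ennreal_mult[symmetric] powr_minus)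
      finally show ?thesis by simp
    qed
    have "(\<integral>\<^sup>+s'. ennreal (h s s') \<partial>lborel) \<le> (\<integral>\<^sup>+s'. ennreal (V s powr (2 - \<alpha>)) * g1 \<bar>s' + - s\<bar>
        + (ennreal (c / N) * ennreal (V s') + ennreal c * g2 \<bar>s' + - s\<bar>) \<partial>lborel)"
      by (rule nn_integral_mono) (rule pt)
    also have "\<dots> = ennreal (V s powr (2 - \<alpha>)) * (\<integral>\<^sup>+s'. g1 \<bar>s' + - s\<bar> \<partial>lborel)
       + (ennreal (c / N) * ennreal N + ennreal c * (\<integral>\<^sup>+s'. g2 \<bar>s' + - s\<bar> \<partial>lborel))"
      by (simp add: nn_integral_add nn_integral_cmult V)
    also have "\<dots> \<le> ennreal (V s powr (2 - \<alpha>)) * ennreal (2 * (r powr (1 - \<alpha>) / (1 - \<alpha>)))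
       + (ennreal (c / N) * ennreal N + ennreal c * 2)"
      by (intro add_mono mult_left_mono G1 G2) auto
    also have "\<dots> = ennreal (V s powr (2 - \<alpha>) * (2 * (r powr (1 - \<alpha>) / (1 - \<alpha>))) + (c + c * 2))"
      using c N \<alpha> by (simp add: ennreal_mult[symmetric] ennreal_plus[symmetric] ennreal_numeral[symmetric] del: ennreal_plus ennreal_numeral)
    also have "V s powr (2 - \<alpha>) * (2 * (r powr (1 - \<alpha>) / (1 - \<alpha>))) = c * (2 / (1 - \<alpha>))"
    proof -
      have "V s powr (2 - \<alpha>) * r powr (1 - \<alpha>) = V s powr (1 + (1 - \<alpha>)) * (N powr (1 - \<alpha>) / V s powr (1 - \<alpha>))"
        using N Vs by (simp add: r_def powr_divide)
      also have "\<dots> = c" unfolding powr_add c_def using Vs by simp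
      finally show ?thesis by (simp add: field_simps)
    qed
    \<comment> \<open>The term 2 / (1 - \<alpha>) comes from the near part, and 3 is 1 from the mass
      of V plus 2 from the two tails.\<close>
    also have "c * (2 / (1 - \<alpha>)) + (c + c * 2) = V s * ((2 / (1 - \<alpha>) + 3) * N powr (1 - \<alpha>))"
      unfolding c_def by (simp add: algebra_simps)
    finally show ?thesis using Vs \<alpha> by (simp add: ennreal_mult)
  qed
  have half: "(\<integral>\<^sup>+s. \<integral>\<^sup>+s'. ennreal (h s s') \<partial>lborel \<partial>lborel) \<le> ennreal ((2 / (1 - \<alpha>) + 3) * N powr (2 - \<alpha>))"
  proof -
    have "(\<integral>\<^sup>+s. \<integral>\<^sup>+s'. ennreal (h s s') \<partial>lborel \<partial>lborel) \<le>
        (\<integral>\<^sup>+s. ennreal (V s) * ennreal ((2 / (1 - \<alpha>) + 3) * N powr (1 - \<alpha>)) \<partial>lborel)"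
      by (intro nn_integral_mono inner)
    also have "\<dots> = ennreal (N * ((2 / (1 - \<alpha>) + 3) * N powr (1 - \<alpha>)))"
      using N \<alpha> by (simp add: nn_integral_multc V ennreal_mult[symmetric])
    also have "N * ((2 / (1 - \<alpha>) + 3) * N powr (1 - \<alpha>)) = (2 / (1 - \<alpha>) + 3) * N powr (1 + (1 - \<alpha>))"
      unfolding powr_add using N by simp
    finally show ?thesis by simp
  qed
  have "(\<integral>\<^sup>+s. \<integral>\<^sup>+s'. ennreal (f s s') \<partial>lborel \<partial>lborel) \<le>
     (\<integral>\<^sup>+s. \<integral>\<^sup>+s'. ennreal (h s s') + ennreal (h s' s) \<partial>lborel \<partial>lborel)"
    by (intro nn_integral_mono) (auto simp: h_def f_sym)
  also have "\<dots> = (\<integral>\<^sup>+s. \<integral>\<^sup>+s'. ennreal (h s s') \<partial>lborel \<partial>lborel) + (\<integral>\<^sup>+s. \<integral>\<^sup>+s'. ennreal (h s' s) \<partial>lborel \<partial>lborel)"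
    by (simp add: nn_integral_add h_def f_def of_bool_def)
  also have "(\<integral>\<^sup>+s. \<integral>\<^sup>+s'. ennreal (h s' s) \<partial>lborel \<partial>lborel) = (\<integral>\<^sup>+s. \<integral>\<^sup>+s'. ennreal (h s s') \<partial>lborel \<partial>lborel)"
    by (rule lborel_pair.Fubini'[symmetric]) (simp add: case_prod_unfold h_def f_def of_bool_def)
  finally have "(\<integral>\<^sup>+s. \<integral>\<^sup>+s'. ennreal (f s s') \<partial>lborel \<partial>lborel) \<le>
    ennreal ((2 / (1 - \<alpha>) + 3) * N powr (2 - \<alpha>)) + ennreal ((2 / (1 - \<alpha>) + 3) * N powr (2 - \<alpha>))"
    using add_mono[OF half half] order_trans by blast
  also have "\<dots> = ennreal ((4 / (1 - \<alpha>) + 6) * N powr (2 - \<alpha>))"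
    using \<alpha> N by (simp add: ennreal_plus[symmetric] algebra_simps del: ennreal_plus)
  finally show ?thesis by (simp add: f_def \<beta>_def)
qed

section \<open>Inversion of the weak Fourier transform\<close>

lemma integrable_indicator_compact:
  "integrable lborel (indicator (cball (c::'a::euclidean_space) r) :: 'a \<Rightarrow> real)"
  using emeasure_lborel_cball_finite[of c r] borel_closed[of "cball c r"] by (subst integrable_indicator_iff) auto

text \<open>The fundamental lemma of the calculus of variations. Bump functions decrease to the
  indicators of compact sets, closed sets form an intersection-stable generator of the Borel sets,
  and a density on a ball is determined by its integrals over Borel sets. Balls appear because w is
  only locally integrable.\<close>

lemma AE_eq_0_if_test_integrals_0:
  fixes w :: "'a::euclidean_space \<Rightarrow> real"
  assumes w: "\<And>n::nat. integrable lborel (\<lambda>x. indicator (cball 0 n) x * w x)"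
    and [measurable]: "w \<in> borel_measurable borel"
    and test: "\<And>f::'a \<Rightarrow> real. continuous_on UNIV f \<Longrightarrow> (\<And>x. 0 \<le> f x \<and> f x \<le> 1) \<Longrightarrow> bounded {x. f x \<noteq> 0} \<Longrightarrow>
       (\<integral>x. f x * w x \<partial>lborel) = 0"
  shows "AE x in lborel. w x = 0"
proof -
  have K0: "(\<integral>x. indicator K x * w x \<partial>lborel) = 0" if K: "compact K" for K
  proof (cases "K = {}")
    case False
    \<comment> \<open>f n is 1 on K and vanishes at distance 1 / (n + 1) or more from K, so all f n
      are supported in the ball of radius m + 1 once K lies in that of radius m.\<close>
    define f where "f n x = max 0 (1 - real (Suc n) * infdist x K)" for n x
    have cont: "continuous_on UNIV (f n)" for n unfolding f_def by (intro continuous_intros)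
    have [measurable]: "f n \<in> borel_measurable borel" for n using cont by (rule borel_measurable_continuous_onI)
    have [measurable]: "K \<in> sets borel" using K by (simp add: compact_imp_closed borel_closed)
    obtain m :: nat where m: "K \<subseteq> cball 0 m"
    proof -
      obtain B where "\<And>x. x \<in> K \<Longrightarrow> norm x \<le> B" using compact_imp_bounded[OF K] by (auto simp: bounded_iff)
      moreover obtain m :: nat where "B \<le> m" using real_arch_simple by blast
      ultimately show ?thesis by (intro that[of m]) (force simp: dist_norm)
    qed
    have supp: "norm x \<le> real (m + 1)" if "f n x \<noteq> 0" for n x
    proof -
      have "real (Suc n) * infdist x K < 1" using that by (auto simp: f_def max_def split: if_splits)
      moreover have "1 * infdist x K \<le> real (Suc n) * infdist x K" by (intro mult_right_mono) (auto simp: infdist_nonneg)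
      ultimately have "infdist x K < 1" by simp
      moreover obtain y where "y \<in> K" "infdist x K = dist x y"
        using infdist_attains_inf[OF compact_imp_closed[OF K] False] by blast
      ultimately have "dist x y < 1" "norm y \<le> m" using m by auto
      then show ?thesis using norm_triangle_ineq2[of x y] by (simp add: dist_norm)
    qed
    have f01: "0 \<le> f n x \<and> f n x \<le> 1" for n x by (auto simp: f_def infdist_nonneg)
    have "(\<lambda>n. \<integral>x. f n x * w x \<partial>lborel) \<longlonglongrightarrow> (\<integral>x. indicator K x * w x \<partial>lborel)"
    proof (rule integral_dominated_convergence)
      show "integrable lborel (\<lambda>x. \<bar>indicator (cball 0 (m + 1)) x * w x\<bar>)" using w by (rule integrable_abs)
      show "AE x in lborel. (\<lambda>n. f n x * w x) \<longlonglongrightarrow> indicator K x * w x"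
      proof (rule AE_I2, rule tendsto_mult_right)
        fix x
        show "(\<lambda>n. f n x) \<longlonglongrightarrow> indicator K x"
        proof (cases "x \<in> K")
          case True then show ?thesis by (simp add: f_def)
        next
          case no: False
          then have "infdist x K > 0"
            using in_closed_iff_infdist_zero[OF compact_imp_closed[OF K] False] infdist_nonneg[of x K] by force
          then obtain N where N: "1 < real N * infdist x K" using reals_Archimedean3 by blast
          have "f n x = 0" if "n \<ge> N" for n
          proof -
            have "real N * infdist x K \<le> real (Suc n) * infdist x K" using that by (intro mult_right_mono) (auto simp: infdist_nonneg)
            then show ?thesis using N by (simp add: f_def)
          qed
          then have "eventually (\<lambda>n. f n x = 0) sequentially" using eventually_sequentially by blast
          then show ?thesis using no by (simp add: tendsto_eventually)
        qed
      qed
      show "AE x in lborel. norm (f n x * w x) \<le> \<bar>indicator (cball 0 (m + 1)) x * w x\<bar>" for n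
      proof (rule AE_I2)
        fix x show "norm (f n x * w x) \<le> \<bar>indicator (cball 0 (m + 1)) x * w x\<bar>"
          using supp[of n x] f01[of n x] by (cases "f n x = 0") (auto simp: abs_mult intro: mult_left_le_one_le)
      qed
    qed auto
    moreover have "(\<integral>x. f n x * w x \<partial>lborel) = 0" for n
    proof (rule test[OF cont f01])
      show "bounded {x. f n x \<noteq> 0}" using supp[of n] by (auto simp: bounded_iff)
    qed
    ultimately show ?thesis by (simp add: LIMSEQ_const_iff)
  qed simp
  have AEn: "AE x in lborel. indicator (cball 0 (real n)) x * w x = 0" for n :: nat
  proof (rule density_unique_real[OF w, of "\<lambda>_. 0"])
    define wn where "wn x = indicator (cball 0 (real n)) x * w x" for x
    have wn: "integrable lborel wn" unfolding wn_def by (rule w)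
    have G: "(\<integral>x. indicator A x * wn x \<partial>lborel) = 0" if "A \<in> sets borel" for A
    proof -
      have "Int_stable (Collect (closed :: 'a set \<Rightarrow> bool))" by (auto simp: Int_stable_def)
      moreover have "Collect (closed :: 'a set \<Rightarrow> bool) \<subseteq> Pow UNIV" by simp
      moreover have "A \<in> sigma_sets UNIV (Collect closed)" using that by (simp add: borel_eq_closed)
      ultimately show ?thesis
      proof (induction rule: sigma_sets_induct_disjoint)
        case (basic A)
        then have "compact (A \<inter> cball 0 (real n))" by (intro closed_Int_compact) auto
        from K0[OF this] show ?case by (simp add: wn_def indicator_inter_arith mult.assoc)
      next
        case (compl A)
        then have [measurable]: "A \<in> sets borel" by (simp add: borel_eq_closed)
        have "(\<integral>x. indicator (UNIV - A) x * wn x \<partial>lborel) = (\<integral>x. wn x - indicator A x * wn x \<partial>lborel)"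
          by (rule Bochner_Integration.integral_cong) (auto simp: indicator_def)
        also have "\<dots> = (\<integral>x. wn x \<partial>lborel) - (\<integral>x. indicator A x * wn x \<partial>lborel)"
          using integrable_real_mult_indicator[OF _ wn, of A] wn
          by (intro Bochner_Integration.integral_diff) (auto simp: mult.commute)
        also have "(\<integral>x. wn x \<partial>lborel) = 0" using K0[of "cball 0 (real n)"] by (simp add: wn_def)
        finally show ?case using compl by simp
      next
        case (union A)
        then have A: "A i \<in> sets borel" for i by (auto simp: borel_eq_closed)
        have "(LINT x:(\<Union>i. A i)|lborel. wn x) = (\<Sum>i. (LINT x:(A i)|lborel. wn x))"
        proof (rule lebesgue_integral_countable_add)
          show "A i \<inter> A j = {}" if "i \<noteq> j" for i j using union(1) that by (auto simp: disjoint_family_on_def)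
          show "set_integrable lborel (\<Union>i. A i) wn" unfolding set_integrable_def
            using integrable_real_mult_indicator[OF _ wn, of "\<Union>i. A i"] A by (auto simp: mult.commute)
        qed (use A in auto)
        then show ?case using union(3) by (simp add: set_lebesgue_integral_def)
      qed simp
    qed
    fix A assume "A \<in> sets (lborel :: 'a measure)"
    with G[of A] show "(\<integral>x\<in>A. indicator (cball 0 (real n)) x * w x \<partial>lborel) = (\<integral>x\<in>A. 0 \<partial>lborel)"
      by (simp add: set_lebesgue_integral_def wn_def)
  qed simp
  then have "AE x in lborel. \<forall>n::nat. indicator (cball 0 (real n)) x * w x = 0"
    unfolding AE_all_countable using AEn by blast
  then show ?thesis
  proof eventually_elim
    fix x assume a: "\<forall>n::nat. indicator (cball 0 (real n)) x * w x = 0"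
    obtain n :: nat where "norm x \<le> n" using real_arch_simple by blast
    then show "w x = 0" using a[rule_format, of n] by simp
  qed
qed

lemma gauss_le_1: "gauss (z :: 'a::euclidean_space) \<le> 1"
proof -
  have "1 \<le> sqrt (2 * pi) ^ DIM('a)"
    using pi_ge_two by (intro one_le_power) (simp add: real_le_rsqrt)
  then show ?thesis by (simp add: gauss_def divide_le_eq le_divide_eq_1 order_trans[of _ 1])
qed

lemma gauss_0: "gauss (0 :: 'a::euclidean_space) = 1 / sqrt (2 * pi) ^ DIM('a)"
  by (simp add: gauss_def)

text \<open>Truncated inversion: a Gaussian cutoff in frequency becomes an average of f around x
  with a Gaussian of width \<epsilon>. The powers of \<epsilon> cancel in the substitution
  \<open>y = x + \<epsilon> *\<^sub>R z\<close>, so the weight in z is fixed and the limit can be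
  taken inside the integral.\<close>

lemma FT1_gauss_cutoff:
  fixes f :: "'a::euclidean_space \<Rightarrow> complex"
  assumes f: "integrable lborel f" and \<epsilon>: "\<epsilon> > 0"
  shows "FT1 (\<lambda>\<xi>. of_real (gauss (\<epsilon> *\<^sub>R \<xi>)) * (\<integral>y. cis (\<xi> \<bullet> y) * f y \<partial>lborel)) x
    = of_real (sqrt (2 * pi) ^ DIM('a)) * (\<integral>z. of_real (gauss z) * f (x + \<epsilon> *\<^sub>R z) \<partial>lborel)"
proof -
  have [measurable]: "f \<in> borel_measurable borel" using f borel_measurable_integrable by force
  have gint: "integrable lborel (\<lambda>\<xi>. complex_of_real (gauss (\<epsilon> *\<^sub>R \<xi> :: 'a)))"
    using integrable_gauss_scaled[OF \<epsilon>, where 'a='a] by (rule integrable_of_real)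
  have g: "integrable lborel (\<lambda>\<xi>. cis (- (x \<bullet> \<xi>)) * complex_of_real (gauss (\<epsilon> *\<^sub>R \<xi>)))"
    by (rule Bochner_Integration.integrable_bound[OF gint]) (auto simp: norm_mult)
  have "FT1 (\<lambda>\<xi>. of_real (gauss (\<epsilon> *\<^sub>R \<xi>)) * (\<integral>y. cis (\<xi> \<bullet> y) * f y \<partial>lborel)) x
     = (\<integral>\<xi>. (cis (- (x \<bullet> \<xi>)) * of_real (gauss (\<epsilon> *\<^sub>R \<xi>))) * (\<integral>y. cis (\<xi> \<bullet> y) * f y \<partial>lborel) \<partial>lborel)"
    unfolding FT1_def mult.assoc by (simp only: inner_commute[of _ x])
  also have "\<dots> = (\<integral>y. f y * (\<integral>\<xi>. cis (\<xi> \<bullet> y) * (cis (- (x \<bullet> \<xi>)) * of_real (gauss (\<epsilon> *\<^sub>R \<xi>))) \<partial>lborel) \<partial>lborel)"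
    by (rule integral_kernel_swap[OF g f]) auto
  also have "\<dots> = (\<integral>y. f y * of_real (exp (- (norm (y - x))\<^sup>2 / (2 * \<epsilon>\<^sup>2)) / \<epsilon> ^ DIM('a)) \<partial>lborel)"
  proof (rule Bochner_Integration.integral_cong[OF refl])
    fix y
    have "(\<integral>\<xi>. cis (\<xi> \<bullet> y) * (cis (- (x \<bullet> \<xi>)) * of_real (gauss (\<epsilon> *\<^sub>R \<xi>))) \<partial>lborel) = (\<integral>\<xi>. cis (\<xi> \<bullet> (y - x)) * of_real (gauss (\<epsilon> *\<^sub>R \<xi>)) \<partial>lborel)"
      by (simp add: mult.assoc[symmetric] cis_mult inner_diff_right inner_commute)
    then show "f y * (\<integral>\<xi>. cis (\<xi> \<bullet> y) * (cis (- (x \<bullet> \<xi>)) * of_real (gauss (\<epsilon> *\<^sub>R \<xi>))) \<partial>lborel) = f y * of_real (exp (- (norm (y - x))\<^sup>2 / (2 * \<epsilon>\<^sup>2)) / \<epsilon> ^ DIM('a))"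
      unfolding fourier_gauss_scaled[OF \<epsilon>] by simp
  qed
  also have "\<dots> = (\<integral>y. f (y + x) * of_real (exp (- (norm y)\<^sup>2 / (2 * \<epsilon>\<^sup>2)) / \<epsilon> ^ DIM('a)) \<partial>lborel)"
    by (subst integral_lborel_translate[of _ x, symmetric]) auto
  also have "\<dots> = of_real (\<epsilon> ^ DIM('a)) * (\<integral>z. f (\<epsilon> *\<^sub>R z + x) * of_real (exp (- (norm (\<epsilon> *\<^sub>R z))\<^sup>2 / (2 * \<epsilon>\<^sup>2)) / \<epsilon> ^ DIM('a)) \<partial>lborel)"
    by (rule integral_lborel_scale) (use \<epsilon> in auto)
  also have "\<dots> = (\<integral>z. of_real (\<epsilon> ^ DIM('a)) * (f (\<epsilon> *\<^sub>R z + x) * of_real (exp (- (norm (\<epsilon> *\<^sub>R z))\<^sup>2 / (2 * \<epsilon>\<^sup>2)) / \<epsilon> ^ DIM('a))) \<partial>lborel)"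
    by simp
  also have "\<dots> = (\<integral>z. of_real (sqrt (2 * pi) ^ DIM('a)) * (of_real (gauss z) * f (x + \<epsilon> *\<^sub>R z)) \<partial>lborel)"
    using \<epsilon> by (intro Bochner_Integration.integral_cong) (auto simp: gauss_def power_mult_distrib add.commute)
  also have "\<dots> = of_real (sqrt (2 * pi) ^ DIM('a)) * (\<integral>z. of_real (gauss z) * f (x + \<epsilon> *\<^sub>R z) \<partial>lborel)"
    by (rule Bochner_Integration.integral_mult_right_zero)
  finally show ?thesis .
qed

text \<open>Makes square integrable functions integrable on bounded sets, and supplies the
  dominating functions below.\<close>

lemma le_square_plus_1: "x \<le> x\<^sup>2 + 1" for x :: real
proof -
  have "x\<^sup>2 - x + 1/4 \<ge> 0" using zero_le_power2[of "x - 1/2"] by (simp add: power2_eq_square algebra_simps)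
  then show ?thesis by simp
qed

lemma L2_measurable: "L2 f \<Longrightarrow> f \<in> borel_measurable borel"
  by (simp add: L2_def)

lemma integrable_mult_L2:
  assumes f: "L2 f" and g: "L2 g"
  shows "integrable lborel (\<lambda>x. f x * g x)"
proof (rule Bochner_Integration.integrable_bound)
  show "integrable lborel (\<lambda>x. (norm (f x))\<^sup>2 + (norm (g x))\<^sup>2)" using f g by (simp add: L2_def)
  have [measurable]: "f \<in> borel_measurable borel" "g \<in> borel_measurable borel" using f g L2_measurable by auto
  show "(\<lambda>x. f x * g x) \<in> borel_measurable lborel" by measurable
  show "AE x in lborel. norm (f x * g x) \<le> norm ((norm (f x))\<^sup>2 + (norm (g x))\<^sup>2)"
  proof (rule AE_I2)
    fix x
    have "norm (f x) * norm (g x) \<le> 2 * norm (f x) * norm (g x)" by simp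
    also have "\<dots> \<le> (norm (f x))\<^sup>2 + (norm (g x))\<^sup>2" by (rule sum_squares_bound)
    finally show "norm (f x * g x) \<le> norm ((norm (f x))\<^sup>2 + (norm (g x))\<^sup>2)" by (simp add: norm_mult)
  qed
qed

lemma L2_bounded_support:
  fixes f :: "'a::euclidean_space \<Rightarrow> complex"
  assumes [measurable]: "f \<in> borel_measurable borel" and b: "\<And>x. norm (f x) \<le> c * indicator (cball 0 r) x"
  shows "L2 f" "integrable lborel f"
proof -
  have i: "integrable lborel (\<lambda>x. c' * indicator (cball (0::'a) r) x :: real)" for c'
    using integrable_indicator_compact by (rule integrable_mult_right)
  show "integrable lborel f"
    by (rule Bochner_Integration.integrable_bound[OF i[of c]]) (use b in \<open>auto intro: order_trans abs_ge_self\<close>)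
  have "(norm (f x))\<^sup>2 \<le> c\<^sup>2 * indicator (cball 0 r) x" for x
    using power_mono[OF b[of x], of 2] by (cases "x \<in> cball 0 r") (auto simp: power_mult_distrib)
  then show "L2 f" unfolding L2_def
    by (intro conjI Bochner_Integration.integrable_bound[OF i[of "c\<^sup>2"]]) (auto intro: order_trans abs_ge_self)
qed

text \<open>Fourier inversion for the weak transform. The multiplication formula is tested on
  Gaussian truncations of the transform of a continuous f with bounded support. In the limit one
  side is a multiple of the integral of f v, the other a multiple of the integral of f against the
  inverse transform of h.\<close>

lemma is_fourier_AE_eq:
  fixes v h :: "'a::euclidean_space \<Rightarrow> complex"
  assumes vh: "is_fourier v h" and h: "integrable lborel h"
  shows "AE x in lborel. v x = (\<integral>\<xi>. cis (x \<bullet> \<xi>) * h \<xi> \<partial>lborel) / (2 * pi) ^ DIM('a)"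
proof -
  have v2: "L2 v" "L2 h" using vh by (auto simp: is_fourier_def)
  have [measurable]: "v \<in> borel_measurable borel" "h \<in> borel_measurable borel" using v2 L2_measurable by auto
  define c where "c = sqrt (2 * pi) ^ DIM('a)"
  have c: "c > 0" "c * c = (2 * pi) ^ DIM('a)" by (simp_all only: c_def power_mult_distrib[symmetric]) simp_all
  define Hh where "Hh x = (\<integral>\<xi>. cis (x \<bullet> \<xi>) * h \<xi> \<partial>lborel)" for x
  have [measurable]: "Hh \<in> borel_measurable borel" unfolding Hh_def[abs_def]
    by (rule lborel.borel_measurable_lebesgue_integral) (simp add: case_prod_unfold)
  have Hh_le: "norm (Hh x) \<le> (\<integral>\<xi>. norm (h \<xi>) \<partial>lborel)" for x
    unfolding Hh_def by (rule integral_norm_bound[THEN order_trans]) (simp add: norm_mult)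
  \<comment> \<open>The discrepancy, with the denominator (2 pi)^d = c c multiplied out; its
    integral against every test function turns out to be 0.\<close>
  define w where "w x = of_real (c * c) * v x - Hh x" for x
  have [measurable]: "w \<in> borel_measurable borel" unfolding w_def by measurable
  have test: "integrable lborel (\<lambda>x. of_real (f x) * w x)" "(\<integral>x. of_real (f x) * w x \<partial>lborel) = 0"
    if cont: "continuous_on UNIV f" and f01: "\<And>x. 0 \<le> f x \<and> f x \<le> 1" and bs: "bounded {x. f x \<noteq> 0}" for f :: "'a \<Rightarrow> real"
  proof -
    have [measurable]: "f \<in> borel_measurable borel" using cont by (rule borel_measurable_continuous_onI)
    obtain m where m: "\<And>x. f x \<noteq> 0 \<Longrightarrow> norm x \<le> m" using bs by (auto simp: bounded_iff)
    define fc where "fc x = complex_of_real (f x)" for x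
    have [measurable]: "fc \<in> borel_measurable borel" unfolding fc_def by measurable
    have fb: "norm (fc x) \<le> 1 * indicator (cball 0 m) x" for x
      using f01[of x] m[of x] by (cases "f x = 0") (auto simp: fc_def)
    note fL = L2_bounded_support[OF _ fb, simplified]
    have vf: "integrable lborel (\<lambda>x. v x * fc x)" by (rule integrable_mult_L2[OF v2(1)]) (use fL in simp)
    define Lf where "Lf = (\<integral>x. norm (fc x) \<partial>lborel)"
    have Lf: "Lf \<ge> 0" by (simp add: Lf_def)
    define F where "F \<xi> = (\<integral>y. cis (\<xi> \<bullet> y) * fc y \<partial>lborel)" for \<xi>
    have [measurable]: "F \<in> borel_measurable borel" unfolding F_def[abs_def]
      by (rule lborel.borel_measurable_lebesgue_integral) (simp add: case_prod_unfold)
    have F_le: "norm (F \<xi>) \<le> Lf" for \<xi>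
      unfolding F_def Lf_def by (rule integral_norm_bound[THEN order_trans]) (simp add: norm_mult)
    define \<epsilon> where "\<epsilon> n = 1 / real (Suc n)" for n
    have \<epsilon>: "\<epsilon> n > 0" "\<epsilon> n \<le> 1" for n by (auto simp: \<epsilon>_def)
    have \<epsilon>lim: "\<epsilon> \<longlonglongrightarrow> 0" unfolding \<epsilon>_def by (rule LIMSEQ_inverse_real_of_nat[unfolded inverse_eq_divide])
    \<comment> \<open>F itself may fail to be integrable. The Gaussian factor puts
      \<open>\<psi> n\<close> into both L1 and L2, as \<open>is_fourier\<close> demands of a test
      function.\<close>
    define \<psi> where "\<psi> n \<xi> = of_real (gauss (\<epsilon> n *\<^sub>R \<xi>)) * F \<xi>" for n \<xi>
    have [measurable]: "\<psi> n \<in> borel_measurable borel" for n unfolding \<psi>_def by measurable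
    have gi: "integrable lborel (\<lambda>\<xi>::'a. k * gauss (\<epsilon> n *\<^sub>R \<xi>))" for k n
      using integrable_gauss_scaled[OF \<epsilon>(1)] by (rule integrable_mult_right)
    have \<psi>1: "norm (\<psi> n \<xi>) \<le> Lf * gauss (\<epsilon> n *\<^sub>R \<xi>)" for n \<xi>
      using mult_left_mono[OF F_le[of \<xi>] less_imp_le[OF gauss_pos[of "\<epsilon> n *\<^sub>R \<xi>"]]]
      by (simp add: \<psi>_def norm_mult less_imp_le[OF gauss_pos] mult.commute)
    have \<psi>int: "integrable lborel (\<psi> n)" for n
      by (rule Bochner_Integration.integrable_bound[OF gi[of Lf n]]) (use \<psi>1 in \<open>auto intro!: AE_I2 order_trans[OF _ abs_ge_self]\<close>)
    have \<psi>2: "(norm (\<psi> n \<xi>))\<^sup>2 \<le> Lf\<^sup>2 * gauss (\<epsilon> n *\<^sub>R \<xi>)" for n \<xi>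
    proof -
      have "(norm (\<psi> n \<xi>))\<^sup>2 \<le> (Lf * gauss (\<epsilon> n *\<^sub>R \<xi>))\<^sup>2" by (rule power_mono[OF \<psi>1]) simp
      also have "\<dots> = Lf\<^sup>2 * gauss (\<epsilon> n *\<^sub>R \<xi>) * gauss (\<epsilon> n *\<^sub>R \<xi>)" by (simp add: power2_eq_square mult_ac)
      also have "\<dots> \<le> Lf\<^sup>2 * gauss (\<epsilon> n *\<^sub>R \<xi>) * 1"
        by (rule mult_left_mono[OF gauss_le_1]) (simp add: less_imp_le[OF gauss_pos])
      finally show ?thesis by simp
    qed
    have "L2 (\<psi> n)" for n unfolding L2_def
      by (intro conjI Bochner_Integration.integrable_bound[OF gi[of "Lf\<^sup>2" n]]) (use \<psi>2 in \<open>auto intro!: AE_I2 order_trans[OF _ abs_ge_self]\<close>)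
    with \<psi>int vh have mf: "(\<integral>\<xi>. h \<xi> * \<psi> n \<xi> \<partial>lborel) = (\<integral>x. v x * FT1 (\<psi> n) x \<partial>lborel)" for n
      by (simp add: is_fourier_def)
    have FT: "FT1 (\<psi> n) x = of_real c * (\<integral>z. of_real (gauss z) * fc (x + \<epsilon> n *\<^sub>R z) \<partial>lborel)" for n x
      unfolding \<psi>_def F_def c_def by (rule FT1_gauss_cutoff) (use fL \<epsilon> in auto)
    define I where "I n z = (\<integral>x. v x * fc (x + \<epsilon> n *\<^sub>R z) \<partial>lborel)" for n z
    define A where "A = (\<integral>x. (norm (v x))\<^sup>2 \<partial>lborel) + (\<integral>x. (norm (fc x))\<^sup>2 \<partial>lborel)"
    have nv: "(\<integral>\<^sup>+x. ennreal ((norm (v x))\<^sup>2) \<partial>lborel) = ennreal (\<integral>x. (norm (v x))\<^sup>2 \<partial>lborel)"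
      by (rule nn_integral_eq_integral) (use v2 in \<open>auto simp: L2_def\<close>)
    have nf: "(\<integral>\<^sup>+x. ennreal ((norm (fc x))\<^sup>2) \<partial>lborel) = ennreal (\<integral>x. (norm (fc x))\<^sup>2 \<partial>lborel)"
      by (rule nn_integral_eq_integral) (use fL in \<open>auto simp: L2_def\<close>)
    \<comment> \<open>A does not depend on the translation y, so it serves both for the interchange
      of integrals and as the dominating constant in z.\<close>
    have nI: "(\<integral>\<^sup>+x. ennreal (norm (v x * fc (x + y))) \<partial>lborel) \<le> ennreal A" for y
    proof -
      have "(\<integral>\<^sup>+x. ennreal (norm (v x * fc (x + y))) \<partial>lborel) \<le> (\<integral>\<^sup>+x. ennreal ((norm (v x))\<^sup>2) + ennreal ((norm (fc (x + y)))\<^sup>2) \<partial>lborel)"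
      proof (rule nn_integral_mono)
        fix x
        have "norm (v x) * norm (fc (x + y)) \<le> 2 * norm (v x) * norm (fc (x + y))" by simp
        also have "\<dots> \<le> (norm (v x))\<^sup>2 + (norm (fc (x + y)))\<^sup>2" by (rule sum_squares_bound)
        finally show "ennreal (norm (v x * fc (x + y))) \<le> ennreal ((norm (v x))\<^sup>2) + ennreal ((norm (fc (x + y)))\<^sup>2)"
          by (simp add: norm_mult ennreal_plus[symmetric] ennreal_leI del: ennreal_plus)
      qed
      also have "\<dots> = (\<integral>\<^sup>+x. ennreal ((norm (v x))\<^sup>2) \<partial>lborel) + (\<integral>\<^sup>+x. ennreal ((norm (fc (x + y)))\<^sup>2) \<partial>lborel)"
        by (rule nn_integral_add) auto
      also have "(\<integral>\<^sup>+x. ennreal ((norm (fc (x + y)))\<^sup>2) \<partial>lborel) = (\<integral>\<^sup>+x. ennreal ((norm (fc x))\<^sup>2) \<partial>lborel)"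
        by (rule nn_integral_lborel_translate) measurable
      finally show ?thesis unfolding nv nf A_def by simp
    qed
    have A: "A \<ge> 0" by (simp add: A_def)
    have I_le: "norm (I n z) \<le> A" for n z
      using order_trans[OF norm_integral_le_nn_integral nI] A unfolding I_def by (simp add: ennreal_le_iff)
    have [measurable]: "I n \<in> borel_measurable borel" for n unfolding I_def[abs_def]
      by (rule lborel.borel_measurable_lebesgue_integral) (simp add: case_prod_unfold)
    have swap: "(\<integral>x. v x * FT1 (\<psi> n) x \<partial>lborel) = of_real c * (\<integral>z. of_real (gauss z) * I n z \<partial>lborel)" for n
    proof -
      have int: "integrable (lborel \<Otimes>\<^sub>M lborel) (\<lambda>(z, x). of_real (gauss z) * (v x * fc (x + \<epsilon> n *\<^sub>R z)))"
      proof (rule integrableI_bounded)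
        have "(\<integral>\<^sup>+p. ennreal (norm (case p of (z, x) \<Rightarrow> of_real (gauss z) * (v x * fc (x + \<epsilon> n *\<^sub>R z)))) \<partial>(lborel \<Otimes>\<^sub>M lborel))
          = (\<integral>\<^sup>+z. \<integral>\<^sup>+x. ennreal (gauss z) * ennreal (norm (v x * fc (x + \<epsilon> n *\<^sub>R z))) \<partial>lborel \<partial>lborel)"
          by (subst lborel.nn_integral_fst[symmetric]) (auto simp: norm_mult ennreal_mult less_imp_le[OF gauss_pos] case_prod_unfold)
        also have "\<dots> \<le> (\<integral>\<^sup>+z. ennreal (gauss (z::'a)) * ennreal A \<partial>lborel)"
          by (intro nn_integral_mono) (subst nn_integral_cmult, auto intro!: mult_left_mono nI)
        also have "\<dots> < \<infinity>" by (simp add: nn_integral_multc nn_integral_gauss)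
        finally show "(\<integral>\<^sup>+p. ennreal (norm (case p of (z, x) \<Rightarrow> of_real (gauss z) * (v x * fc (x + \<epsilon> n *\<^sub>R z)))) \<partial>(lborel \<Otimes>\<^sub>M lborel)) < \<infinity>" .
      qed (simp add: case_prod_unfold)
      have "(\<integral>x. v x * FT1 (\<psi> n) x \<partial>lborel) = of_real c * (\<integral>x. v x * (\<integral>z. of_real (gauss z) * fc (x + \<epsilon> n *\<^sub>R z) \<partial>lborel) \<partial>lborel)"
        unfolding FT by (simp add: mult.left_commute)
      also have "(\<integral>x. v x * (\<integral>z. of_real (gauss z) * fc (x + \<epsilon> n *\<^sub>R z) \<partial>lborel) \<partial>lborel) = (\<integral>x. (\<integral>z. of_real (gauss z) * (v x * fc (x + \<epsilon> n *\<^sub>R z)) \<partial>lborel) \<partial>lborel)"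
        by (subst Bochner_Integration.integral_mult_right_zero[symmetric]) (simp add: mult.left_commute)
      also have "\<dots> = (\<integral>z. (\<integral>x. of_real (gauss z) * (v x * fc (x + \<epsilon> n *\<^sub>R z)) \<partial>lborel) \<partial>lborel)"
        by (rule lborel_pair.Fubini_integral[OF int])
      finally show ?thesis unfolding I_def by simp
    qed
    \<comment> \<open>As \<epsilon> n \<le> 1, all translates of fc by
      \<open>\<epsilon> n *\<^sub>R z\<close> are supported in one ball, where |v| \<le> |v|^2 + 1
      dominates.\<close>
    have Ilim: "(\<lambda>n. I n z) \<longlonglongrightarrow> (\<integral>x. v x * fc x \<partial>lborel)" for z
      unfolding I_def
    proof (rule integral_dominated_convergence)
      show "integrable lborel (\<lambda>x. (norm (v x))\<^sup>2 + indicator (cball 0 (m + norm z)) x)"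
        using v2(1) integrable_indicator_compact by (auto simp: L2_def intro!: Bochner_Integration.integrable_add)
      show "AE x in lborel. (\<lambda>n. v x * fc (x + \<epsilon> n *\<^sub>R z)) \<longlonglongrightarrow> v x * fc x"
      proof (rule AE_I2)
        fix x
        have "(\<lambda>n. x + \<epsilon> n *\<^sub>R z) \<longlonglongrightarrow> x + 0 *\<^sub>R z" by (intro tendsto_intros \<epsilon>lim)
        then have "(\<lambda>n. f (x + \<epsilon> n *\<^sub>R z)) \<longlonglongrightarrow> f x"
          using cont by (intro continuous_on_tendsto_compose[OF cont]) auto
        then show "(\<lambda>n. v x * fc (x + \<epsilon> n *\<^sub>R z)) \<longlonglongrightarrow> v x * fc x"
          unfolding fc_def by (intro tendsto_intros)
      qed
      show "AE x in lborel. norm (v x * fc (x + \<epsilon> n *\<^sub>R z)) \<le> (norm (v x))\<^sup>2 + indicator (cball 0 (m + norm z)) x" for n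
      proof (rule AE_I2)
        fix x
        show "norm (v x * fc (x + \<epsilon> n *\<^sub>R z)) \<le> (norm (v x))\<^sup>2 + indicator (cball 0 (m + norm z)) x"
        proof (cases "f (x + \<epsilon> n *\<^sub>R z) = 0")
          case False
          have "norm x \<le> norm (x + \<epsilon> n *\<^sub>R z) + norm (\<epsilon> n *\<^sub>R z)" using norm_triangle_ineq4[of "x + \<epsilon> n *\<^sub>R z" "\<epsilon> n *\<^sub>R z"] by simp
          also have "\<dots> \<le> m + 1 * norm z"
            using m[OF False] \<epsilon>[of n] mult_right_mono[of "\<epsilon> n" 1 "norm z"] by (intro add_mono) auto
          finally have x: "x \<in> cball 0 (m + norm z)" by simp
          have "norm (v x) * norm (fc (x + \<epsilon> n *\<^sub>R z)) \<le> norm (v x) * 1"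
            using f01[of "x + \<epsilon> n *\<^sub>R z"] by (intro mult_left_mono) (auto simp: fc_def)
          also have "\<dots> \<le> (norm (v x))\<^sup>2 + 1" using le_square_plus_1[of "norm (v x)"] by simp
          finally show ?thesis using x by (simp add: norm_mult)
        qed (simp add: fc_def)
      qed
    qed auto
    have "(\<lambda>n. \<integral>z. of_real (gauss z) * I n z \<partial>lborel) \<longlonglongrightarrow> (\<integral>z. of_real (gauss (z::'a)) * (\<integral>x. v x * fc x \<partial>lborel) \<partial>lborel)"
    proof (rule integral_dominated_convergence)
      show "integrable lborel (\<lambda>z::'a. gauss z * A)" using integrable_gauss by (rule integrable_mult_left)
      show "AE z in lborel. (\<lambda>n. of_real (gauss z) * I n z) \<longlonglongrightarrow> of_real (gauss z) * (\<integral>x. v x * fc x \<partial>lborel)"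
        by (intro AE_I2 tendsto_mult_left Ilim)
      show "AE z in lborel. norm (of_real (gauss z) * I n z) \<le> gauss z * A" for n
        using I_le by (auto simp: norm_mult less_imp_le[OF gauss_pos] intro!: mult_left_mono)
    qed auto
    moreover have "(\<integral>z. of_real (gauss (z::'a)) * (\<integral>x. v x * fc x \<partial>lborel) \<partial>lborel) = (\<integral>x. v x * fc x \<partial>lborel)"
    proof -
      have "(\<integral>z. complex_of_real (gauss (z::'a)) \<partial>lborel) = 1" using fourier_gauss[of "0::'a"] by simp
      then show ?thesis by (simp only: Bochner_Integration.integral_mult_left_zero mult_1_left)
    qed
    ultimately have R: "(\<lambda>n. \<integral>x. v x * FT1 (\<psi> n) x \<partial>lborel) \<longlonglongrightarrow> of_real c * (\<integral>x. v x * fc x \<partial>lborel)"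
      unfolding swap by (intro tendsto_mult_left) (simp only:)
    \<comment> \<open>On this side the cutoff tends to its value 1 / c at the origin, while the
      other side carries the factor c; together they produce the c c in w.\<close>
    have L: "(\<lambda>n. \<integral>\<xi>. h \<xi> * \<psi> n \<xi> \<partial>lborel) \<longlonglongrightarrow> (\<integral>\<xi>. h \<xi> * (of_real (1/c) * F \<xi>) \<partial>lborel)"
    proof (rule integral_dominated_convergence)
      show "integrable lborel (\<lambda>\<xi>. norm (h \<xi>) * Lf)" using h by (intro integrable_mult_left integrable_norm)
      show "AE \<xi> in lborel. (\<lambda>n. h \<xi> * \<psi> n \<xi>) \<longlonglongrightarrow> h \<xi> * (of_real (1/c) * F \<xi>)"
      proof (rule AE_I2)
        fix \<xi> :: 'a
        have "(\<lambda>n. gauss (\<epsilon> n *\<^sub>R \<xi>)) \<longlonglongrightarrow> gauss (0 *\<^sub>R \<xi>)"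
          unfolding gauss_def by (intro tendsto_intros \<epsilon>lim) auto
        then have "(\<lambda>n. gauss (\<epsilon> n *\<^sub>R \<xi>)) \<longlonglongrightarrow> 1 / c" by (simp add: gauss_0 c_def)
        then show "(\<lambda>n. h \<xi> * \<psi> n \<xi>) \<longlonglongrightarrow> h \<xi> * (of_real (1/c) * F \<xi>)"
          unfolding \<psi>_def by (intro tendsto_intros)
      qed
      show "AE \<xi> in lborel. norm (h \<xi> * \<psi> n \<xi>) \<le> norm (h \<xi>) * Lf" for n
      proof (rule AE_I2)
        fix \<xi>
        have "norm (\<psi> n \<xi>) \<le> Lf * 1" using order_trans[OF \<psi>1 mult_left_mono[OF gauss_le_1 Lf]] .
        then show "norm (h \<xi> * \<psi> n \<xi>) \<le> norm (h \<xi>) * Lf" by (simp add: norm_mult mult_left_mono)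
      qed
    qed auto
    have "(\<integral>\<xi>. h \<xi> * (of_real (1/c) * F \<xi>) \<partial>lborel) = of_real c * (\<integral>x. v x * fc x \<partial>lborel)"
      using LIMSEQ_unique[OF L[unfolded mf] R] .
    moreover have "(\<integral>\<xi>. h \<xi> * (of_real (1/c) * F \<xi>) \<partial>lborel) = of_real (1/c) * (\<integral>\<xi>. h \<xi> * F \<xi> \<partial>lborel)"
      by (simp add: mult.left_commute)
    moreover have "(\<integral>\<xi>. h \<xi> * F \<xi> \<partial>lborel) = (\<integral>y. fc y * Hh y \<partial>lborel)"
      unfolding F_def Hh_def using integral_kernel_swap[OF h fL(2), of "\<lambda>x y. cis (x \<bullet> y)"] by (simp add: inner_commute)
    ultimately have key: "(\<integral>y. fc y * Hh y \<partial>lborel) = of_real (c * c) * (\<integral>x. v x * fc x \<partial>lborel)"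
      using c(1) by (simp add: field_simps)
    have fH: "integrable lborel (\<lambda>y. fc y * Hh y)"
    proof (rule Bochner_Integration.integrable_bound)
      show "integrable lborel (\<lambda>y. norm (fc y) * (\<integral>\<xi>. norm (h \<xi>) \<partial>lborel))" using fL(2) by (intro integrable_mult_left integrable_norm) auto
      show "AE y in lborel. norm (fc y * Hh y) \<le> norm (norm (fc y) * (\<integral>\<xi>. norm (h \<xi>) \<partial>lborel))"
        using Hh_le by (auto simp: norm_mult abs_mult intro!: mult_left_mono order_trans[OF _ abs_ge_self])
    qed measurable
    have eq: "of_real (f x) * w x = of_real (c * c) * (v x * fc x) - fc x * Hh x" for x
      by (simp add: w_def fc_def algebra_simps)
    show "integrable lborel (\<lambda>x. of_real (f x) * w x)"
      unfolding eq using vf fH by (intro Bochner_Integration.integrable_diff integrable_mult_right) auto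
    show "(\<integral>x. of_real (f x) * w x \<partial>lborel) = 0"
      unfolding eq using vf fH key by (subst Bochner_Integration.integral_diff) (auto intro: integrable_mult_right)
  qed
  have [measurable]: "cball (0::'a) t \<in> sets borel" for t by (simp add: borel_closed)
  have wn: "integrable lborel (\<lambda>x. indicator (cball 0 (real n)) x *\<^sub>R w x)" for n :: nat
  proof (rule Bochner_Integration.integrable_bound)
    show "integrable lborel (\<lambda>x. c * c * (norm (v x))\<^sup>2 + (c * c + (\<integral>\<xi>. norm (h \<xi>) \<partial>lborel)) * indicator (cball 0 (real n)) x)"
      using v2(1) integrable_indicator_compact by (intro Bochner_Integration.integrable_add integrable_mult_right) (auto simp: L2_def)
    show "AE x in lborel. norm (indicator (cball 0 (real n)) x *\<^sub>R w x) \<le> norm (c * c * (norm (v x))\<^sup>2 + (c * c + (\<integral>\<xi>. norm (h \<xi>) \<partial>lborel)) * indicator (cball 0 (real n)) x)"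
    proof (rule AE_I2)
      fix x
      have "norm (w x) \<le> c * c * norm (v x) + (\<integral>\<xi>. norm (h \<xi>) \<partial>lborel)"
        unfolding w_def using Hh_le[of x] c(1)
        by (intro order_trans[OF norm_triangle_ineq4]) (auto simp: norm_mult)
      also have "norm (v x) \<le> (norm (v x))\<^sup>2 + 1" using le_square_plus_1[of "norm (v x)"] by simp
      finally have le: "norm (w x) \<le> c * c * ((norm (v x))\<^sup>2 + 1) + (\<integral>\<xi>. norm (h \<xi>) \<partial>lborel)" using c(1) by simp
      have "0 \<le> c * c * (norm (v x))\<^sup>2" using c(1) by simp
      then show "norm (indicator (cball 0 (real n)) x *\<^sub>R w x) \<le> norm (c * c * (norm (v x))\<^sup>2 + (c * c + (\<integral>\<xi>. norm (h \<xi>) \<partial>lborel)) * indicator (cball 0 (real n)) x)"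
        using le by (auto simp: indicator_def algebra_simps intro: order_trans[OF _ abs_ge_self])
    qed
  qed measurable
  have re: "AE x in lborel. Re (w x) = 0"
  proof (rule AE_eq_0_if_test_integrals_0)
    show "integrable lborel (\<lambda>x. indicator (cball 0 (real n)) x * Re (w x))" for n
      using integrable_Re[OF wn[of n]] by simp
    fix f :: "'a \<Rightarrow> real" assume f: "continuous_on UNIV f" "\<And>x. 0 \<le> f x \<and> f x \<le> 1" "bounded {x. f x \<noteq> 0}"
    show "(\<integral>x. f x * Re (w x) \<partial>lborel) = 0"
      using integral_Re[OF test(1)[OF f]] test(2)[OF f] by simp
  qed measurable
  have im: "AE x in lborel. Im (w x) = 0"
  proof (rule AE_eq_0_if_test_integrals_0)
    show "integrable lborel (\<lambda>x. indicator (cball 0 (real n)) x * Im (w x))" for n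
      using integrable_Im[OF wn[of n]] by simp
    fix f :: "'a \<Rightarrow> real" assume f: "continuous_on UNIV f" "\<And>x. 0 \<le> f x \<and> f x \<le> 1" "bounded {x. f x \<noteq> 0}"
    show "(\<integral>x. f x * Im (w x) \<partial>lborel) = 0"
      using integral_Im[OF test(1)[OF f]] test(2)[OF f] by simp
  qed measurable
  show ?thesis using re im
  proof eventually_elim
    fix x assume "Re (w x) = 0" "Im (w x) = 0"
    then have "w x = 0" by (simp add: complex_eq_iff)
    then have "of_real (c * c) * v x = Hh x" by (simp add: w_def)
    then have "v x = Hh x / of_real (c * c)" using c(1) by (simp add: field_simps)
    then show "v x = (\<integral>\<xi>. cis (x \<bullet> \<xi>) * h \<xi> \<partial>lborel) / (2 * pi) ^ DIM('a)"
      unfolding Hh_def c(2) by simp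
  qed
qed

section \<open>The dual estimate\<close>

text \<open>For two fixed slices the levels are summed by \<open>level_set_interpolation\<close>,
  with A |s - s'|^(-\<sigma>) in the role of A. Since \<sigma> (1 - \<alpha>) = \<alpha>, what comes
  out is exactly the kernel |s - s'|^(-\<alpha>) of the fractional integral over the slices.\<close>

lemma slice_level_sum:
  fixes v :: "real \<Rightarrow> real \<Rightarrow> real" and V :: "real \<Rightarrow> real" and H :: "real \<Rightarrow> real \<Rightarrow> real \<Rightarrow> real \<Rightarrow> ennreal"
    and \<alpha> q \<sigma> A B N :: real
  assumes \<alpha>: "0 < \<alpha>" "\<alpha> < 1" and q: "q = 2 / (2 - \<alpha>)" and \<sigma>: "\<sigma> * (1 - \<alpha>) = \<alpha>" and A: "A > 0" and B: "B > 0"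
    and mv: "\<And>s. v s \<in> borel_measurable borel"
    and v0: "\<And>s a. v s a \<ge> 0" "\<And>s a. a \<le> 0 \<Longrightarrow> v s a = 0"
    and [measurable]: "V \<in> borel_measurable borel" and V0: "\<And>s. V s \<ge> 0"
    and V: "\<And>s. (\<integral>\<^sup>+a. ennreal (a powr (q - 1) * v s a) \<partial>lborel) = ennreal (V s)"
    and N: "N > 0" "(\<integral>\<^sup>+s. ennreal (V s) \<partial>lborel) = ennreal N"
    and H1: "\<And>s s' a b. s \<noteq> s' \<Longrightarrow> H s s' a b \<le> ennreal (A * \<bar>s - s'\<bar> powr (-\<sigma>) * v s a * v s' b)"
    and H2: "\<And>s s' a b. H s s' a b \<le> ennreal (B * sqrt (v s a * v s' b))"
  shows "(\<integral>\<^sup>+s. \<integral>\<^sup>+s'. \<integral>\<^sup>+a. \<integral>\<^sup>+b. H s s' a b \<partial>lborel \<partial>lborel \<partial>lborel \<partial>lborel)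
    \<le> ennreal ((1 + (2 - \<alpha>) / (1 - \<alpha>)) * A powr (1 - \<alpha>) * B powr \<alpha> * ((4 / (1 - \<alpha>) + 6) * N powr (2 - \<alpha>)))"
proof -
  define K where "K = (1 + (2 - \<alpha>) / (1 - \<alpha>)) * A powr (1 - \<alpha>) * B powr \<alpha>"
  have K: "K \<ge> 0" using \<alpha> by (simp add: K_def)
  \<comment> \<open>The interpolation is formulated for positive masses. On a slice with V s = 0 the
    function v s vanishes at almost all levels, and H2 then makes H vanish.\<close>
  have v_AE: "AE a in lborel. v s a = 0" if "V s = 0" for s
  proof -
    have "(\<integral>\<^sup>+a. ennreal (a powr (q - 1) * v s a) \<partial>lborel) = 0" using V[of s] that by simp
    moreover have "(\<lambda>a. ennreal (a powr (q - 1) * v s a)) \<in> borel_measurable lborel" using mv[of s] by simp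
    ultimately have "AE a in lborel. ennreal (a powr (q - 1) * v s a) = 0" by (simp only: nn_integral_0_iff_AE)
    then show ?thesis
    proof eventually_elim
      fix a assume "ennreal (a powr (q - 1) * v s a) = 0"
      then have "a powr (q - 1) * v s a \<le> 0" by (simp only: ennreal_eq_0_iff)
      then show "v s a = 0" using v0(1)[of s a] v0(2)[of a s]
        by (cases "a \<le> 0") (auto simp: mult_le_0_iff dest: antisym)
    qed
  qed
  have J: "(\<integral>\<^sup>+a. \<integral>\<^sup>+b. H s s' a b \<partial>lborel \<partial>lborel) \<le> ennreal (K * (\<bar>s - s'\<bar> powr (-\<alpha>) * (V s * V s') powr (1 - \<alpha>/2)))"
    if ne: "s' \<noteq> s" for s s'
  proof -
    consider "V s = 0" | "V s' = 0" | "V s > 0" "V s' > 0" using V0[of s] V0[of s'] by linarith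
    then show ?thesis
    proof cases
      case 1
      have "(\<integral>\<^sup>+a. \<integral>\<^sup>+b. H s s' a b \<partial>lborel \<partial>lborel) \<le> (\<integral>\<^sup>+(a::real). 0 \<partial>lborel)"
      proof (rule nn_integral_mono_AE, use v_AE[OF 1] in eventually_elim)
        fix a assume "v s a = 0"
        then have "H s s' a b = 0" for b using H2[of s s' a b] by simp
        then show "(\<integral>\<^sup>+b. H s s' a b \<partial>lborel) \<le> 0" by simp
      qed
      then show ?thesis by simp
    next
      case 2
      have "(\<integral>\<^sup>+b. H s s' a b \<partial>lborel) \<le> (\<integral>\<^sup>+(b::real). 0 \<partial>lborel)" for a
      proof (rule nn_integral_mono_AE, use v_AE[OF 2] in eventually_elim)
        fix b assume "v s' b = 0"
        then show "H s s' a b \<le> 0" using H2[of s s' a b] by simp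
      qed
      then show ?thesis by simp
    next
      case 3
      define A' where "A' = A * \<bar>s - s'\<bar> powr (-\<sigma>)"
      have A': "A' > 0" using A ne by (simp add: A'_def)
      have "A' powr (1 - \<alpha>) = A powr (1 - \<alpha>) * \<bar>s - s'\<bar> powr (-\<sigma> * (1 - \<alpha>))"
        using A by (simp add: A'_def powr_mult powr_powr)
      also have "- \<sigma> * (1 - \<alpha>) = - \<alpha>" using \<sigma> by simp
      finally have e: "A' powr (1 - \<alpha>) = A powr (1 - \<alpha>) * \<bar>s - s'\<bar> powr (-\<alpha>)" .
      have "(\<integral>\<^sup>+a. \<integral>\<^sup>+b. H s s' a b \<partial>lborel \<partial>lborel)
         \<le> ennreal ((1 + (2 - \<alpha>) / (1 - \<alpha>)) * A' powr (1 - \<alpha>) * B powr \<alpha> * (V s * V s') powr (1 - \<alpha>/2))"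
        by (rule level_set_interpolation[OF \<alpha> q A' B mv[of s] mv[of s'] v0(1)[of s] v0(2)[of _ s] v0(1)[of s'] v0(2)[of _ s'] _ H2 3(1) V[of s] 3(2) V[of s']])
           (use H1[of s s'] ne in \<open>auto simp: A'_def\<close>)
      also have "\<dots> = ennreal (K * (\<bar>s - s'\<bar> powr (-\<alpha>) * (V s * V s') powr (1 - \<alpha>/2)))"
        unfolding e K_def by (simp only: mult_ac)
      finally show ?thesis .
    qed
  qed
  have "(\<integral>\<^sup>+s. \<integral>\<^sup>+s'. \<integral>\<^sup>+a. \<integral>\<^sup>+b. H s s' a b \<partial>lborel \<partial>lborel \<partial>lborel \<partial>lborel) \<le>
    (\<integral>\<^sup>+s. \<integral>\<^sup>+s'. ennreal K * ennreal (\<bar>s - s'\<bar> powr (-\<alpha>) * (V s * V s') powr (1 - \<alpha>/2)) \<partial>lborel \<partial>lborel)"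
  proof (rule nn_integral_mono, rule nn_integral_mono_AE)
    fix s :: real
    \<comment> \<open>The diagonal, about which H1 says nothing, is a null set.\<close>
    show "AE s' in lborel. (\<integral>\<^sup>+a. \<integral>\<^sup>+b. H s s' a b \<partial>lborel \<partial>lborel) \<le> ennreal K * ennreal (\<bar>s - s'\<bar> powr (-\<alpha>) * (V s * V s') powr (1 - \<alpha>/2))"
      using AE_lborel_singleton[of s]
    proof eventually_elim
      fix s' assume "s' \<noteq> s"
      then show "(\<integral>\<^sup>+a. \<integral>\<^sup>+b. H s s' a b \<partial>lborel \<partial>lborel) \<le> ennreal K * ennreal (\<bar>s - s'\<bar> powr (-\<alpha>) * (V s * V s') powr (1 - \<alpha>/2))"
        using J[of s' s] K by (subst ennreal_mult[symmetric]) auto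
    qed
  qed
  also have "\<dots> = ennreal K * (\<integral>\<^sup>+s. \<integral>\<^sup>+s'. ennreal (\<bar>s - s'\<bar> powr (-\<alpha>) * (V s * V s') powr (1 - \<alpha>/2)) \<partial>lborel \<partial>lborel)"
    by (simp add: nn_integral_cmult)
  also have "\<dots> \<le> ennreal K * ennreal ((4 / (1 - \<alpha>) + 6) * N powr (2 - \<alpha>))"
    by (intro mult_left_mono Hardy_Littlewood_Sobolev_diagonal[OF \<alpha> N(1) _ V0 N(2)]) auto
  also have "\<dots> = ennreal (K * ((4 / (1 - \<alpha>) + 6) * N powr (2 - \<alpha>)))"
    using K \<alpha> by (simp add: ennreal_mult)
  finally show ?thesis by (simp add: K_def)
qed

lemma integral_kernel_swap_bounded:
  fixes g :: "'a::euclidean_space \<Rightarrow> complex" and f :: "'b::euclidean_space \<Rightarrow> complex" and k :: "'a \<Rightarrow> 'b \<Rightarrow> complex"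
  assumes g: "integrable lborel g" and f: "integrable lborel f"
    and [measurable]: "(\<lambda>z. k (fst z) (snd z)) \<in> borel_measurable (borel \<Otimes>\<^sub>M borel)"
    and k: "\<And>x y. norm (k x y) \<le> c" and c: "c > 0"
  shows "(\<integral>x. g x * (\<integral>y. k x y * f y \<partial>lborel) \<partial>lborel) = (\<integral>y. f y * (\<integral>x. k x y * g x \<partial>lborel) \<partial>lborel)"
proof -
  have fc: "integrable lborel (\<lambda>y. of_real c * f y)" using f by (rule integrable_mult_right)
  have "(\<integral>x. g x * (\<integral>y. (k x y / of_real c) * (of_real c * f y) \<partial>lborel) \<partial>lborel) = (\<integral>y. (of_real c * f y) * (\<integral>x. (k x y / of_real c) * g x \<partial>lborel) \<partial>lborel)"
    by (rule integral_kernel_swap[OF g fc]) (use k c in \<open>auto simp: norm_divide divide_le_eq\<close>)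
  moreover have "(\<integral>x. (k x y / of_real c) * g x \<partial>lborel) = (\<integral>x. k x y * g x \<partial>lborel) / of_real c" for y
    by simp
  ultimately show ?thesis using c by simp
qed

text \<open>The expansion step of the \<open>T T\<^sup>*\<close> argument; it is applied to the slices, to the level
  sets of a slice, and to the points of a level set.\<close>
lemma norm_bilinear_integral_le:
  fixes f :: "'b::euclidean_space \<Rightarrow> complex" and f' :: "'c::euclidean_space \<Rightarrow> complex" and m :: "'a::euclidean_space \<Rightarrow> complex"
    and k :: "'a \<Rightarrow> 'b \<Rightarrow> complex" and k' :: "'a \<Rightarrow> 'c \<Rightarrow> complex"
  assumes m: "integrable lborel m" and f: "integrable lborel f" and f': "integrable lborel f'"
    and mk[measurable]: "(\<lambda>z. k (fst z) (snd z)) \<in> borel_measurable (borel \<Otimes>\<^sub>M borel)"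
    and mk'[measurable]: "(\<lambda>z. k' (fst z) (snd z)) \<in> borel_measurable (borel \<Otimes>\<^sub>M borel)"
    and k: "\<And>x y. norm (k x y) \<le> c" and k': "\<And>x y. norm (k' x y) \<le> c" and c: "c > 0"
  shows "ennreal (norm (\<integral>x. m x * ((\<integral>y. k x y * f y \<partial>lborel) * cnj (\<integral>z. k' x z * f' z \<partial>lborel)) \<partial>lborel))
    \<le> (\<integral>\<^sup>+y. \<integral>\<^sup>+z. ennreal (norm (f y)) * (ennreal (norm (f' z)) * ennreal (norm (\<integral>x. m x * (k x y * cnj (k' x z)) \<partial>lborel))) \<partial>lborel \<partial>lborel)"
proof -
  have mm[measurable]: "m \<in> borel_measurable borel" "f' \<in> borel_measurable borel" "f \<in> borel_measurable borel"
    using m f f' borel_measurable_integrable by force+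
  have ck[measurable]: "(\<lambda>x. k x y) \<in> borel_measurable borel" for y
    using measurable_compose[OF measurable_Pair2'[of y borel borel] mk] by simp
  have ck'[measurable]: "(\<lambda>x. k' x y) \<in> borel_measurable borel" for y
    using measurable_compose[OF measurable_Pair2'[of y borel borel] mk'] by simp
  define P where "P x = (\<integral>z. k' x z * f' z \<partial>lborel)" for x
  have [measurable]: "P \<in> borel_measurable borel" unfolding P_def[abs_def]
    by (rule lborel.borel_measurable_lebesgue_integral) (simp add: case_prod_unfold)
  have P_le: "norm (P x) \<le> c * (\<integral>z. norm (f' z) \<partial>lborel)" for x
  proof -
    have "norm (P x) \<le> (\<integral>z. norm (k' x z * f' z) \<partial>lborel)" unfolding P_def by (rule integral_norm_bound)
    also have "\<dots> \<le> (\<integral>z. c * norm (f' z) \<partial>lborel)"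
      using f' c k' by (intro integral_mono_AE') (auto simp: norm_mult intro!: mult_right_mono)
    finally show ?thesis by simp
  qed
  have g: "integrable lborel (\<lambda>x. m x * cnj (P x))"
  proof (rule Bochner_Integration.integrable_bound)
    show "integrable lborel (\<lambda>x. norm (m x) * (c * (\<integral>z. norm (f' z) \<partial>lborel)))" using m by (intro integrable_mult_left integrable_norm)
    show "AE x in lborel. norm (m x * cnj (P x)) \<le> norm (norm (m x) * (c * (\<integral>z. norm (f' z) \<partial>lborel)))"
      using P_le c by (auto simp: norm_mult intro!: AE_I2 mult_left_mono order_trans[OF _ abs_ge_self])
  qed measurable
  have inner: "(\<integral>x. k x y * (m x * cnj (P x)) \<partial>lborel) = (\<integral>z. cnj (f' z) * (\<integral>x. m x * (k x y * cnj (k' x z)) \<partial>lborel) \<partial>lborel)" for y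
  proof -
    have "(\<integral>x. k x y * (m x * cnj (P x)) \<partial>lborel) = (\<integral>x. (k x y * m x) * (\<integral>z. cnj (k' x z) * cnj (f' z) \<partial>lborel) \<partial>lborel)"
      unfolding P_def by (simp add: Bochner_Integration.integral_cnj[symmetric] mult.assoc del: Bochner_Integration.integral_cnj)
    also have "\<dots> = (\<integral>z. cnj (f' z) * (\<integral>x. cnj (k' x z) * (k x y * m x) \<partial>lborel) \<partial>lborel)"
    proof (rule integral_kernel_swap_bounded[where c=c])
      show "integrable lborel (\<lambda>x. k x y * m x)"
      proof (rule Bochner_Integration.integrable_bound)
        show "integrable lborel (\<lambda>x. c * norm (m x))" using m by simp
        show "AE x in lborel. norm (k x y * m x) \<le> norm (c * norm (m x))"
          using k c by (auto simp: norm_mult intro!: AE_I2 mult_right_mono)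
      qed measurable
      show "integrable lborel (\<lambda>z. cnj (f' z))" using f' by simp
    qed (use k' c in auto)
    finally show ?thesis by (simp add: mult_ac)
  qed
  have "(\<integral>x. m x * ((\<integral>y. k x y * f y \<partial>lborel) * cnj (\<integral>z. k' x z * f' z \<partial>lborel)) \<partial>lborel)
     = (\<integral>x. (m x * cnj (P x)) * (\<integral>y. k x y * f y \<partial>lborel) \<partial>lborel)"
    by (simp add: P_def mult_ac)
  also have "\<dots> = (\<integral>y. f y * (\<integral>x. k x y * (m x * cnj (P x)) \<partial>lborel) \<partial>lborel)"
    by (rule integral_kernel_swap_bounded[OF g f mk k c])
  also have "\<dots> = (\<integral>y. f y * (\<integral>z. cnj (f' z) * (\<integral>x. m x * (k x y * cnj (k' x z)) \<partial>lborel) \<partial>lborel) \<partial>lborel)"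
    unfolding inner ..
  also have "ennreal (norm \<dots>) \<le> (\<integral>\<^sup>+y. ennreal (norm (f y)) * (\<integral>\<^sup>+z. ennreal (norm (f' z)) * ennreal (norm (\<integral>x. m x * (k x y * cnj (k' x z)) \<partial>lborel)) \<partial>lborel) \<partial>lborel)"
  proof (rule order_trans[OF norm_integral_le_nn_integral], rule nn_integral_mono)
    fix y
    have "ennreal (norm (\<integral>z. cnj (f' z) * (\<integral>x. m x * (k x y * cnj (k' x z)) \<partial>lborel) \<partial>lborel)) \<le>
      (\<integral>\<^sup>+z. ennreal (norm (f' z)) * ennreal (norm (\<integral>x. m x * (k x y * cnj (k' x z)) \<partial>lborel)) \<partial>lborel)"
      by (rule order_trans[OF norm_integral_le_nn_integral]) (simp add: norm_mult ennreal_mult)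
    then show "ennreal (norm (f y * (\<integral>z. cnj (f' z) * (\<integral>x. m x * (k x y * cnj (k' x z)) \<partial>lborel) \<partial>lborel))) \<le>
       ennreal (norm (f y)) * (\<integral>\<^sup>+z. ennreal (norm (f' z)) * ennreal (norm (\<integral>x. m x * (k x y * cnj (k' x z)) \<partial>lborel)) \<partial>lborel)"
      by (simp add: norm_mult ennreal_mult mult_left_mono)
  qed
  also have "\<dots> = (\<integral>\<^sup>+y. \<integral>\<^sup>+z. ennreal (norm (f y)) * (ennreal (norm (f' z)) * ennreal (norm (\<integral>x. m x * (k x y * cnj (k' x z)) \<partial>lborel))) \<partial>lborel \<partial>lborel)"
  proof (rule nn_integral_cong)
    fix y
    have "(\<lambda>z. \<integral>x. m x * (k x y * cnj (k' x z)) \<partial>lborel) \<in> borel_measurable borel"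
    proof (rule lborel.borel_measurable_lebesgue_integral)
      have "(\<lambda>p. k' (snd p) (fst p)) \<in> borel_measurable (borel \<Otimes>\<^sub>M borel)"
        using measurable_compose[OF measurable_pair_swap' mk'] by (simp add: case_prod_unfold)
      then show "(\<lambda>(z, x). m x * (k x y * cnj (k' x z))) \<in> borel_measurable (borel \<Otimes>\<^sub>M lborel)"
        by (simp add: case_prod_unfold)
    qed
    then show "ennreal (norm (f y)) * (\<integral>\<^sup>+z. ennreal (norm (f' z)) * ennreal (norm (\<integral>x. m x * (k x y * cnj (k' x z)) \<partial>lborel)) \<partial>lborel)
      = (\<integral>\<^sup>+z. ennreal (norm (f y)) * (ennreal (norm (f' z)) * ennreal (norm (\<integral>x. m x * (k x y * cnj (k' x z)) \<partial>lborel))) \<partial>lborel)"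
      by (subst nn_integral_cmult) auto
  qed
  finally show ?thesis .
qed

text \<open>The square of a direction cosine is at most its modulus |\<xi> \<bullet> e| / |\<xi>|.
  One power of the cosine thus provides the Jacobian of \<open>zeta e\<close>, and the inner radius
  provides the gain 1 / a.\<close>

lemma annulus_weight_le_inner:
  assumes a: "a > 0" and e: "norm e = 1"
  shows "annulus_weight a b e \<xi> \<le> 1 / (2 * a) * (2 * \<bar>\<xi> \<bullet> e\<bar>)"
proof (cases "a \<le> norm \<xi> \<and> norm \<xi> \<le> b")
  case True
  define c where "c = \<bar>e \<bullet> sgn \<xi>\<bar>"
  have n: "norm \<xi> > 0" using True a by linarith
  have "c \<le> 1" using Cauchy_Schwarz_ineq2[of e "sgn \<xi>"] e n by (simp add: c_def norm_sgn)
  moreover have c0: "c \<ge> 0" by (simp add: c_def)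
  ultimately have "c * c \<le> c" by (simp add: mult_left_le)
  also have "c = \<bar>\<xi> \<bullet> e\<bar> / norm \<xi>" using n by (simp add: c_def sgn_div_norm abs_mult inner_commute divide_inverse_commute)
  also have "\<dots> \<le> \<bar>\<xi> \<bullet> e\<bar> / a" using True a n by (intro divide_left_mono mult_pos_pos) auto
  finally have "c * c \<le> \<bar>\<xi> \<bullet> e\<bar> / a" .
  moreover have "annulus_weight a b e \<xi> = c * c" using True by (simp add: annulus_weight_def c_def power2_eq_square)
  ultimately show ?thesis using a by simp
qed (use a in \<open>auto simp: annulus_weight_def\<close>)

text \<open>The L2 bound for one level set: the weight is dominated by the Jacobian of
  \<open>zeta e\<close>, so the change of variables leads to Plancherel. The bound |G| \<le> 1
  replaces |G|^2 by |G|; for a function that is unimodular on a set and 0 elsewhere, the right side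
  is then a multiple of the measure of that set.\<close>

lemma nn_integral_annulus_weight_le:
  fixes G :: "'a::euclidean_space \<Rightarrow> complex"
  assumes a: "a > 0" and e: "norm e = 1" and G: "integrable lborel G" and G1: "\<And>y. norm (G y) \<le> 1"
  shows "(\<integral>\<^sup>+\<xi>. ennreal (annulus_weight a b e \<xi> * (norm (\<integral>y. cis (y \<bullet> zeta e \<xi>) * G y \<partial>lborel))\<^sup>2) \<partial>lborel)
    \<le> ennreal ((2 * pi) ^ DIM('a) / a * (\<integral>y. norm (G y) \<partial>lborel))"
proof -
  have cG: "integrable lborel (\<lambda>y. cnj (G y))" using G by simp
  have [measurable]: "G \<in> borel_measurable borel" using G borel_measurable_integrable by force
  define P where "P \<eta> = ennreal ((norm (FT1 (\<lambda>y. cnj (G y)) \<eta>))\<^sup>2)" for \<eta>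
  have [measurable]: "P \<in> borel_measurable borel" unfolding P_def by measurable
  have eq: "norm (\<integral>y. cis (y \<bullet> \<eta>) * G y \<partial>lborel) = norm (FT1 (\<lambda>y. cnj (G y)) \<eta>)" for \<eta>
  proof -
    have "cnj (\<integral>y. cis (y \<bullet> \<eta>) * G y \<partial>lborel) = FT1 (\<lambda>y. cnj (G y)) \<eta>"
      unfolding FT1_def by (subst Bochner_Integration.integral_cnj[symmetric]) (simp add: cis_cnj)
    then show ?thesis by (metis complex_mod_cnj)
  qed
  have "(\<integral>\<^sup>+\<xi>. ennreal (annulus_weight a b e \<xi> * (norm (\<integral>y. cis (y \<bullet> zeta e \<xi>) * G y \<partial>lborel))\<^sup>2) \<partial>lborel)
    \<le> (\<integral>\<^sup>+\<xi>. ennreal (1 / (2 * a)) * (ennreal (2 * \<bar>\<xi> \<bullet> e\<bar>) * P (zeta e \<xi>)) \<partial>lborel)"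
  proof (rule nn_integral_mono)
    fix \<xi> :: 'a
    let ?c = "(norm (FT1 (\<lambda>y. cnj (G y)) (zeta e \<xi>)))\<^sup>2"
    have "annulus_weight a b e \<xi> * ?c \<le> 1 / (2 * a) * (2 * \<bar>\<xi> \<bullet> e\<bar>) * ?c"
      by (rule mult_right_mono[OF annulus_weight_le_inner[OF a e]]) simp
    then have "ennreal (annulus_weight a b e \<xi> * ?c) \<le> ennreal (1 / (2 * a) * (2 * \<bar>\<xi> \<bullet> e\<bar> * ?c))"
      by (intro ennreal_leI) (simp only: mult.assoc)
    also have "\<dots> = ennreal (1 / (2 * a)) * (ennreal (2 * \<bar>\<xi> \<bullet> e\<bar>) * ennreal ?c)"
      using a by (subst ennreal_mult, simp, simp, subst ennreal_mult, simp_all)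
    finally show "ennreal (annulus_weight a b e \<xi> * (norm (\<integral>y. cis (y \<bullet> zeta e \<xi>) * G y \<partial>lborel))\<^sup>2)
      \<le> ennreal (1 / (2 * a)) * (ennreal (2 * \<bar>\<xi> \<bullet> e\<bar>) * P (zeta e \<xi>))"
      unfolding eq P_def .
  qed
  also have "\<dots> = ennreal (1 / (2 * a)) * (\<integral>\<^sup>+\<xi>. ennreal (2 * \<bar>\<xi> \<bullet> e\<bar>) * P (zeta e \<xi>) \<partial>lborel)"
    by (rule nn_integral_cmult) measurable
  also have "\<dots> \<le> ennreal (1 / (2 * a)) * (2 * (\<integral>\<^sup>+\<eta>. P \<eta> \<partial>lborel))"
    by (intro mult_left_mono nn_integral_zeta_le e) auto
  also have "\<dots> \<le> ennreal (1 / (2 * a)) * (2 * (ennreal ((2 * pi) ^ DIM('a)) * (\<integral>\<^sup>+y. ennreal ((norm (cnj (G y)))\<^sup>2) \<partial>lborel)))"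
    unfolding P_def by (intro mult_left_mono Plancherel_le[OF cG]) auto
  also have "\<dots> \<le> ennreal (1 / (2 * a)) * (2 * (ennreal ((2 * pi) ^ DIM('a)) * (\<integral>\<^sup>+y. ennreal (norm (G y)) \<partial>lborel)))"
    using G1 by (intro mult_left_mono nn_integral_mono) (auto simp: power2_eq_square mult_left_le intro!: ennreal_leI)
  also have "(\<integral>\<^sup>+y. ennreal (norm (G y)) \<partial>lborel) = ennreal (\<integral>y. norm (G y) \<partial>lborel)"
    by (rule nn_integral_eq_integral) (use G in auto)
  also have "ennreal (1 / (2 * a)) * (2 * (ennreal ((2 * pi) ^ DIM('a)) * ennreal (\<integral>y. norm (G y) \<partial>lborel))) = ennreal ((2 * pi) ^ DIM('a) / a * (\<integral>y. norm (G y) \<partial>lborel))"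
  proof -
    define N where "N = (\<integral>y. norm (G y) \<partial>lborel)"
    define R where "R = (2 * pi) ^ DIM('a)"
    have N: "N \<ge> 0" "R \<ge> 0" by (simp_all add: N_def R_def)
    have "ennreal (R / a * N) = ennreal (1 / (2 * a) * (2 * (R * N)))" using a by simp
    also have "\<dots> = ennreal (1 / (2 * a)) * ennreal (2 * (R * N))" by (rule ennreal_mult) (use a N in auto)
    also have "ennreal (2 * (R * N)) = ennreal 2 * ennreal (R * N)" by (rule ennreal_mult) (use N in auto)
    also have "ennreal (R * N) = ennreal R * ennreal N" by (rule ennreal_mult) (use N in auto)
    finally show ?thesis by (simp add: N_def R_def)
  qed
  finally show ?thesis .
qed

text \<open>The transpose, without conjugation, of the extension operator read in the coordinates of
  \<open>coord_swap e\<close>.\<close>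

definition dual_extension :: "'a \<Rightarrow> (real \<times> 'a::euclidean_space \<Rightarrow> complex) \<Rightarrow> 'a \<Rightarrow> complex" where
  "dual_extension e F \<xi> = (\<integral>z. cis (fst z * (\<xi> \<bullet> e) + snd z \<bullet> zeta e \<xi>) * F z \<partial>lborel)"

text \<open>The squared norm is expanded over pairs of slices. Each slice of F is a superposition of
  unimodular functions on its level sets, so the form splits further into pieces BL indexed by two
  slices and two levels. Kernel decay gives H1, the L2 bound with Cauchy-Schwarz gives H2, and
  \<open>slice_level_sum\<close> adds up the pieces. Boundedness and bounded support of F justify
  the interchanges of integrals.\<close>

lemma dual_extension_bound_of_kernel:
  fixes F :: "real \<times> 'a::euclidean_space \<Rightarrow> complex" and \<alpha> q \<sigma> A :: real
  assumes \<alpha>: "0 < \<alpha>" "\<alpha> < 1" and q: "q = 2 / (2 - \<alpha>)" and \<sigma>: "\<sigma> * (1 - \<alpha>) = \<alpha>" and A: "A > 0"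
    and a: "a > 0" and e: "norm e = 1"
    and F[measurable]: "F \<in> borel_measurable (borel \<Otimes>\<^sub>M borel)"
    and Fb: "\<And>s y. norm (F (s, y)) \<le> M * (indicator (cball 0 r) s * indicator (cball 0 r) y)" and M: "M > 0" and r: "r > 0"
    and ker: "\<And>s z. s \<noteq> 0 \<Longrightarrow> norm (\<integral>\<xi>. of_real (annulus_weight a b e \<xi>) * cis (s * (\<xi> \<bullet> e) + z \<bullet> zeta e \<xi>) \<partial>lborel) \<le> A * \<bar>s\<bar> powr (-\<sigma>)"
  shows "(\<integral>\<^sup>+\<xi>. ennreal (annulus_weight a b e \<xi> * (norm (dual_extension e F \<xi>))\<^sup>2) \<partial>lborel)
    \<le> ennreal ((1 + (2 - \<alpha>) / (1 - \<alpha>)) * A powr (1 - \<alpha>) * ((2 * pi) ^ DIM('a) / a) powr \<alpha> * ((4 / (1 - \<alpha>) + 6) * ((\<integral>z. norm (F z) powr q \<partial>lborel) / q) powr (2 - \<alpha>)))"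
proof -
  have [measurable]: "F \<in> borel_measurable borel" using F by (simp add: borel_prod)
  have q1: "q > 1" "q < 2" using \<alpha> by (auto simp: q field_simps)
  let ?B = "cball (0::'a) r"
  have [measurable]: "?B \<in> sets borel" "cball (0::real) r \<in> sets borel" by (simp_all add: borel_closed)
  define E where "E \<xi> y = cis (y \<bullet> zeta e \<xi>)" for \<xi> y :: 'a
  have [measurable]: "(\<lambda>z. E (fst z) (snd z)) \<in> borel_measurable (borel \<Otimes>\<^sub>M borel)"
    "E \<xi> \<in> borel_measurable borel" for \<xi> unfolding E_def by measurable
  have nE: "norm (E \<xi> y) = 1" for \<xi> y by (simp add: E_def)
  define w where "w = annulus_weight a b e"
  have [measurable]: "w \<in> borel_measurable borel" unfolding w_def by measurable
  note wb = annulus_weight_bounds[OF e, of a b, folded w_def]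
  have bint: "integrable lborel (\<lambda>x::'a. c * indicator (cball 0 R) x :: real)" for c R
    using emeasure_lborel_cball_finite[of "0::'a" R] borel_closed[of "cball (0::'a) R"] by (intro integrable_mult_right, subst integrable_indicator_iff) auto
  have wint: "integrable lborel w"
    by (rule Bochner_Integration.integrable_bound[OF bint[of 1 b]]) (use wb in auto)
  \<comment> \<open>A layer-cake decomposition with phase: at level l, the sign of F on the set
    where |F| \<ge> l. The condition 0 < l makes v vanish at nonpositive levels.\<close>
  define G where "G s l y = (if 0 < l \<and> l \<le> norm (F (s, y)) then sgn (F (s, y)) else 0)" for s l y
  have [measurable]: "(\<lambda>z. G s (fst z) (snd z)) \<in> borel_measurable (borel \<Otimes>\<^sub>M borel)"
    "(\<lambda>z. G s (snd z) (fst z)) \<in> borel_measurable (borel \<Otimes>\<^sub>M borel)"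
    "G s l \<in> borel_measurable borel" for s l unfolding G_def by measurable
  have G1: "norm (G s l y) \<le> 1" for s l y by (simp add: G_def norm_sgn)
  have Gb: "norm (G s l y) \<le> indicator ?B y" for s l y
  proof (cases "y \<in> ?B")
    case False
    then have "F (s, y) = 0" using Fb[of s y] by simp
    then show ?thesis by (simp add: G_def)
  qed (use G1 in simp)
  have Gint: "integrable lborel (G s l)" for s l
    by (rule Bochner_Integration.integrable_bound[OF bint[of 1 r]]) (use Gb in auto)
  \<comment> \<open>f0 restricts the levels to \<open>{0..M}\<close>, and f1 below restricts the
    slices to those that F can meet. As integrable factors they bring both superpositions into the
    form of \<open>norm_bilinear_integral_le\<close>.\<close>
  define f0 where "f0 l = complex_of_real (indicator {0..M} l)" for l :: real
  have f0: "integrable lborel f0" unfolding f0_def by (intro integrable_of_real integrable_real_indicator) (auto simp: emeasure_lborel_Icc_eq)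
  define f1 where "f1 s = complex_of_real (indicator (cball 0 r) s)" for s :: real
  have f1: "integrable lborel f1" unfolding f1_def using emeasure_lborel_cball_finite[of "0::real" r]
    by (intro integrable_of_real integrable_real_indicator) auto
  have Fb1: "norm (F (s, y)) \<le> M * indicator ?B y" for s y
    using Fb[of s y] M by (cases "s \<in> cball 0 r"; cases "y \<in> ?B") auto
  have FM: "norm (F (s, y)) \<le> M" for s y
    using Fb1[of s y] M by (cases "y \<in> ?B") auto
  have Glayer: "(\<integral>l. G s l y * f0 l \<partial>lborel) = F (s, y)" for s y
  proof -
    have "(\<integral>l. G s l y * f0 l \<partial>lborel) = (\<integral>l. indicator {0<..norm (F (s, y))} l *\<^sub>R sgn (F (s, y)) \<partial>lborel)"
      by (rule Bochner_Integration.integral_cong) (use FM[of s y] in \<open>auto simp: G_def f0_def indicator_def\<close>)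
    also have "\<dots> = norm (F (s, y)) *\<^sub>R sgn (F (s, y))" by simp
    finally show ?thesis by (cases "F (s, y) = 0") (simp_all add: sgn_div_norm)
  qed
  define Gh where "Gh s l \<xi> = (\<integral>y. E \<xi> y * G s l y \<partial>lborel)" for s l \<xi>
  define \<Psi> where "\<Psi> s \<xi> = (\<integral>y. E \<xi> y * F (s, y) \<partial>lborel)" for s \<xi>
  have [measurable]: "(\<lambda>z. Gh s (snd z) (fst z)) \<in> borel_measurable (borel \<Otimes>\<^sub>M borel)" for s
    unfolding Gh_def E_def by (rule lborel.borel_measurable_lebesgue_integral) (simp add: case_prod_unfold G_def)
  have [measurable]: "(\<lambda>z. \<Psi> (snd z) (fst z)) \<in> borel_measurable (borel \<Otimes>\<^sub>M borel)"
    unfolding \<Psi>_def E_def by (rule lborel.borel_measurable_lebesgue_integral) (simp add: case_prod_unfold)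
  define V0 where "V0 = measure lborel ?B"
  have V0: "V0 > 0" using content_cball_pos[OF r] by (simp add: V0_def)
  have Gh_le: "norm (Gh s l \<xi>) \<le> V0" for s l \<xi>
  proof -
    have "norm (Gh s l \<xi>) \<le> (\<integral>y. norm (E \<xi> y * G s l y) \<partial>lborel)" unfolding Gh_def by (rule integral_norm_bound)
    also have "\<dots> \<le> (\<integral>y. 1 * indicator ?B y \<partial>lborel)"
      by (rule integral_mono_AE'[OF bint]) (use Gb nE in \<open>auto simp: norm_mult\<close>)
    finally show ?thesis by (simp add: V0_def)
  qed
  have \<Psi>_le: "norm (\<Psi> s \<xi>) \<le> M * V0" for s \<xi>
  proof -
    have "norm (\<Psi> s \<xi>) \<le> (\<integral>y. norm (E \<xi> y * F (s, y)) \<partial>lborel)" unfolding \<Psi>_def by (rule integral_norm_bound)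
    also have "\<dots> \<le> (\<integral>y. M * indicator ?B y \<partial>lborel)"
    proof (rule integral_mono_AE'[OF bint])
      show "AE y in lborel. norm (E \<xi> y * F (s, y)) \<le> M * indicator ?B y"
      proof (rule AE_I2)
        fix y show "norm (E \<xi> y * F (s, y)) \<le> M * indicator ?B y"
          using Fb1[of s y] nE[of \<xi> y] by (simp add: norm_mult)
      qed
    qed (use M in auto)
    finally show ?thesis by (simp add: V0_def)
  qed
  have \<Psi>_layer: "\<Psi> s \<xi> = (\<integral>l. Gh s l \<xi> * f0 l \<partial>lborel)" for s \<xi>
  proof -
    define g where "g y = E \<xi> y * of_real (indicator ?B y)" for y
    have [measurable]: "g \<in> borel_measurable borel" unfolding g_def by measurable
    have g: "integrable lborel g"
      by (rule Bochner_Integration.integrable_bound[OF bint[of 1 r]]) (auto simp: g_def norm_mult nE)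
    have "\<Psi> s \<xi> = (\<integral>y. g y * (\<integral>l. G s l y * f0 l \<partial>lborel) \<partial>lborel)"
      unfolding \<Psi>_def Glayer
    proof (rule Bochner_Integration.integral_cong[OF refl])
      fix y show "E \<xi> y * F (s, y) = g y * F (s, y)"
        using Fb[of s y] by (cases "y \<in> ?B") (auto simp: g_def)
    qed
    also have "\<dots> = (\<integral>l. f0 l * (\<integral>y. G s l y * g y \<partial>lborel) \<partial>lborel)"
      by (rule integral_kernel_swap_bounded[OF g f0, of "\<lambda>y l. G s l y" 1]) (use G1 in auto)
    also have "\<dots> = (\<integral>l. Gh s l \<xi> * f0 l \<partial>lborel)"
    proof (rule Bochner_Integration.integral_cong[OF refl])
      fix l
      have "(\<integral>y. G s l y * g y \<partial>lborel) = Gh s l \<xi>" unfolding Gh_def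
      proof (rule Bochner_Integration.integral_cong[OF refl])
        fix y show "G s l y * g y = E \<xi> y * G s l y"
          using Gb[of s l y] by (cases "y \<in> ?B") (auto simp: g_def)
      qed
      then show "f0 l * (\<integral>y. G s l y * g y \<partial>lborel) = Gh s l \<xi> * f0 l" by simp
    qed
    finally show ?thesis .
  qed
  define k where "k \<xi> s = cis (s * (\<xi> \<bullet> e)) * \<Psi> s \<xi>" for \<xi> s
  have [measurable]: "(\<lambda>z. k (fst z) (snd z)) \<in> borel_measurable (borel \<Otimes>\<^sub>M borel)" unfolding k_def by measurable
  have k_le: "norm (k \<xi> s) \<le> M * V0" for \<xi> s using \<Psi>_le by (simp add: k_def norm_mult)
  have Fint: "integrable (lborel \<Otimes>\<^sub>M lborel) F"
  proof (rule Bochner_Integration.integrable_bound)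
    show "integrable (lborel \<Otimes>\<^sub>M lborel) (\<lambda>z::real \<times> 'a. M * (indicator (cball 0 r) (fst z) * indicator ?B (snd z)) :: real)"
    proof (intro integrable_mult_right)
      have "emeasure (lborel \<Otimes>\<^sub>M lborel) (cball (0::real) r \<times> ?B) < \<infinity>"
        using emeasure_lborel_cball_finite[of "0::real" r] emeasure_lborel_cball_finite[of "0::'a" r]
        by (simp add: lborel.emeasure_pair_measure_Times ennreal_mult_less_top)
      then have "integrable (lborel \<Otimes>\<^sub>M lborel) (indicator (cball (0::real) r \<times> ?B) :: _ \<Rightarrow> real)"
        by (intro integrable_real_indicator) auto
      then show "integrable (lborel \<Otimes>\<^sub>M lborel) (\<lambda>z::real \<times> 'a. indicator (cball 0 r) (fst z) * indicator ?B (snd z) :: real)"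
        by (rule Bochner_Integration.integrable_cong[THEN iffD1, rotated 2]) (auto simp: indicator_def)
    qed
    show "AE z in lborel \<Otimes>\<^sub>M lborel. norm (F z) \<le> norm (M * (indicator (cball 0 r) (fst z) * indicator ?B (snd z)) :: real)"
      using Fb by (auto intro!: AE_I2 order_trans[OF _ abs_ge_self])
  qed measurable
  define \<Phi> where "\<Phi> = dual_extension e F"
  have \<Phi>: "\<Phi> \<xi> = (\<integral>s. k \<xi> s * f1 s \<partial>lborel)" for \<xi>
  proof -
    have int: "integrable (lborel \<Otimes>\<^sub>M lborel) (\<lambda>z. cis (fst z * (\<xi> \<bullet> e) + snd z \<bullet> zeta e \<xi>) * F z)"
      by (rule Bochner_Integration.integrable_bound[OF Fint]) (auto simp: norm_mult)
    have "\<Phi> \<xi> = (\<integral>s. \<integral>y. cis (s * (\<xi> \<bullet> e) + y \<bullet> zeta e \<xi>) * F (s, y) \<partial>lborel \<partial>lborel)"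
      unfolding \<Phi>_def dual_extension_def lborel_prod[symmetric] using lborel_pair.integral_fst'[OF int] by simp
    also have "\<dots> = (\<integral>s. k \<xi> s * f1 s \<partial>lborel)"
    proof (rule Bochner_Integration.integral_cong[OF refl])
      fix s
      have "(\<integral>y. cis (s * (\<xi> \<bullet> e) + y \<bullet> zeta e \<xi>) * F (s, y) \<partial>lborel) = k \<xi> s"
        unfolding k_def \<Psi>_def E_def by (simp add: cis_mult[symmetric] mult.assoc)
      moreover have "k \<xi> s * f1 s = k \<xi> s"
      proof (cases "s \<in> cball 0 r")
        case False
        then have "F (s, y) = 0" for y using Fb[of s y] by simp
        then show ?thesis by (simp add: k_def \<Psi>_def)
      qed (simp add: f1_def)
      ultimately show "(\<integral>y. cis (s * (\<xi> \<bullet> e) + y \<bullet> zeta e \<xi>) * F (s, y) \<partial>lborel) = k \<xi> s * f1 s" by simp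
    qed
    finally show ?thesis .
  qed
  have [measurable]: "\<Phi> \<in> borel_measurable borel" unfolding \<Phi>
    by (rule lborel.borel_measurable_lebesgue_integral) (simp add: case_prod_unfold f1_def)
  have wc: "integrable lborel (\<lambda>\<xi>. complex_of_real (w \<xi>))" using wint by (rule integrable_of_real)
  define BS where "BS s s' = (\<integral>\<xi>. of_real (w \<xi>) * (k \<xi> s * cnj (k \<xi> s')) \<partial>lborel)" for s s'
  \<comment> \<open>The phases of the two slices combine to a single phase in s - s', which is
    assigned to the multiplier rather than to the level functions.\<close>
  define m where "m s s' \<xi> = of_real (w \<xi>) * cis ((s - s') * (\<xi> \<bullet> e))" for s s' \<xi>
  have [measurable]: "m s s' \<in> borel_measurable borel" for s s' unfolding m_def[abs_def] by measurable
  have mint: "integrable lborel (m s s')" for s s'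
    by (rule Bochner_Integration.integrable_bound[OF wint]) (auto simp: m_def norm_mult)
  define BL where "BL s s' l l' = (\<integral>\<xi>. m s s' \<xi> * (Gh s l \<xi> * cnj (Gh s' l' \<xi>)) \<partial>lborel)" for s s' l l'
  define v where "v s l = (\<integral>y. norm (G s l y) \<partial>lborel)" for s l
  have v_meas: "v s \<in> borel_measurable borel" for s unfolding v_def[abs_def]
    by (rule lborel.borel_measurable_lebesgue_integral) (simp add: case_prod_unfold)
  have v0: "v s l \<ge> 0" for s l by (simp add: v_def)
  have v0': "v s l = 0" if "l \<le> 0" for s l using that by (simp add: v_def G_def)
  have nv: "(\<integral>\<^sup>+y. ennreal (norm (G s l y)) \<partial>lborel) = ennreal (v s l)" for s l
    unfolding v_def by (rule nn_integral_eq_integral) (use Gint in auto)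
  have step1: "(\<integral>\<^sup>+\<xi>. ennreal (w \<xi> * (norm (\<Phi> \<xi>))\<^sup>2) \<partial>lborel) \<le> (\<integral>\<^sup>+s. \<integral>\<^sup>+s'. ennreal (norm (BS s s')) \<partial>lborel \<partial>lborel)"
  proof -
    define L where "L = M * V0 * (\<integral>s. norm (f1 s) \<partial>lborel)"
    have \<Phi>_le: "norm (\<Phi> \<xi>) \<le> L" for \<xi>
    proof -
      have "norm (\<Phi> \<xi>) \<le> (\<integral>s. norm (k \<xi> s * f1 s) \<partial>lborel)" unfolding \<Phi> by (rule integral_norm_bound)
      also have "\<dots> \<le> (\<integral>s. M * V0 * norm (f1 s) \<partial>lborel)"
        using f1 k_le M V0 by (intro integral_mono_AE') (auto simp: norm_mult intro!: mult_right_mono)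
      finally show ?thesis by (simp add: L_def)
    qed
    have i: "integrable lborel (\<lambda>\<xi>. w \<xi> * (norm (\<Phi> \<xi>))\<^sup>2)"
    proof (rule Bochner_Integration.integrable_bound)
      show "integrable lborel (\<lambda>\<xi>. w \<xi> * L\<^sup>2)" using wint by simp
      show "AE \<xi> in lborel. norm (w \<xi> * (norm (\<Phi> \<xi>))\<^sup>2) \<le> norm (w \<xi> * L\<^sup>2)"
        using \<Phi>_le by (auto simp: abs_mult intro!: AE_I2 mult_left_mono power_mono)
    qed measurable
    have "(\<integral>\<^sup>+\<xi>. ennreal (w \<xi> * (norm (\<Phi> \<xi>))\<^sup>2) \<partial>lborel) = ennreal (\<integral>\<xi>. w \<xi> * (norm (\<Phi> \<xi>))\<^sup>2 \<partial>lborel)"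
      by (rule nn_integral_eq_integral[OF i]) (use wb in auto)
    also have "\<dots> \<le> ennreal (norm (complex_of_real (\<integral>\<xi>. w \<xi> * (norm (\<Phi> \<xi>))\<^sup>2 \<partial>lborel)))" by (rule ennreal_leI) simp
    also have "complex_of_real (\<integral>\<xi>. w \<xi> * (norm (\<Phi> \<xi>))\<^sup>2 \<partial>lborel) = (\<integral>\<xi>. complex_of_real (w \<xi> * (norm (\<Phi> \<xi>))\<^sup>2) \<partial>lborel)"
      by (rule integral_complex_of_real[symmetric])
    also have "\<dots> = (\<integral>\<xi>. of_real (w \<xi>) * ((\<integral>s. k \<xi> s * f1 s \<partial>lborel) * cnj (\<integral>s. k \<xi> s * f1 s \<partial>lborel)) \<partial>lborel)"
      unfolding \<Phi>[symmetric] of_real_mult complex_norm_square ..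
    also have "ennreal (norm \<dots>) \<le> (\<integral>\<^sup>+s. \<integral>\<^sup>+s'. ennreal (norm (f1 s)) * (ennreal (norm (f1 s')) * ennreal (norm (BS s s'))) \<partial>lborel \<partial>lborel)"
      unfolding BS_def by (rule norm_bilinear_integral_le[OF wc f1 f1 _ _ k_le k_le]) (use M V0 in auto)
    also have "\<dots> \<le> (\<integral>\<^sup>+s. \<integral>\<^sup>+s'. ennreal (norm (BS s s')) \<partial>lborel \<partial>lborel)"
      by (intro nn_integral_mono) (auto simp: f1_def indicator_def)
    finally show ?thesis .
  qed
  have step2: "ennreal (norm (BS s s')) \<le> (\<integral>\<^sup>+l. \<integral>\<^sup>+l'. ennreal (norm (BL s s' l l')) \<partial>lborel \<partial>lborel)" for s s'
  proof -
    have "BS s s' = (\<integral>\<xi>. m s s' \<xi> * ((\<integral>l. Gh s l \<xi> * f0 l \<partial>lborel) * cnj (\<integral>l. Gh s' l \<xi> * f0 l \<partial>lborel)) \<partial>lborel)"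
      unfolding BS_def \<Psi>_layer[symmetric]
    proof (rule Bochner_Integration.integral_cong[OF refl])
      fix \<xi>
      have "cis (s * (\<xi> \<bullet> e)) * cnj (cis (s' * (\<xi> \<bullet> e))) = cis ((s - s') * (\<xi> \<bullet> e))"
        by (simp add: cis_cnj cis_mult left_diff_distrib)
      then show "of_real (w \<xi>) * (k \<xi> s * cnj (k \<xi> s')) = m s s' \<xi> * (\<Psi> s \<xi> * cnj (\<Psi> s' \<xi>))"
        unfolding k_def m_def by (simp add: mult_ac)
    qed
    also have "ennreal (norm \<dots>) \<le> (\<integral>\<^sup>+l. \<integral>\<^sup>+l'. ennreal (norm (f0 l)) * (ennreal (norm (f0 l')) * ennreal (norm (BL s s' l l'))) \<partial>lborel \<partial>lborel)"
      unfolding BL_def by (rule norm_bilinear_integral_le[OF mint f0 f0, of "\<lambda>\<xi> l. Gh s l \<xi>" "\<lambda>\<xi> l. Gh s' l \<xi>" V0]) (use Gh_le V0 in auto)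
    also have "\<dots> \<le> (\<integral>\<^sup>+l. \<integral>\<^sup>+l'. ennreal (norm (BL s s' l l')) \<partial>lborel \<partial>lborel)"
      by (intro nn_integral_mono) (auto simp: f0_def indicator_def)
    finally show ?thesis .
  qed
  \<comment> \<open>The third expansion, over the points of the two level sets: the innermost
    integral is the kernel at (s - s', y - y').\<close>
  have H1: "ennreal (norm (BL s s' l l')) \<le> ennreal (A * \<bar>s - s'\<bar> powr (-\<sigma>) * v s l * v s' l')" if ne: "s \<noteq> s'" for s s' l l'
  proof -
    define K where "K = A * \<bar>s - s'\<bar> powr (-\<sigma>)"
    have K: "K \<ge> 0" using A by (simp add: K_def)
    have kk: "norm (\<integral>\<xi>. m s s' \<xi> * (E \<xi> y * cnj (E \<xi> y')) \<partial>lborel) \<le> K" for y y'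
    proof -
      have "(\<integral>\<xi>. m s s' \<xi> * (E \<xi> y * cnj (E \<xi> y')) \<partial>lborel) = (\<integral>\<xi>. of_real (w \<xi>) * cis ((s - s') * (\<xi> \<bullet> e) + (y - y') \<bullet> zeta e \<xi>) \<partial>lborel)"
        by (rule Bochner_Integration.integral_cong) (simp_all add: m_def E_def cis_cnj cis_mult inner_diff_left mult.assoc algebra_simps)
      then show ?thesis using ker[of "s - s'" "y - y'"] ne by (simp add: w_def K_def)
    qed
    have "ennreal (norm (BL s s' l l')) \<le> (\<integral>\<^sup>+y. \<integral>\<^sup>+y'. ennreal (norm (G s l y)) * (ennreal (norm (G s' l' y')) * ennreal (norm (\<integral>\<xi>. m s s' \<xi> * (E \<xi> y * cnj (E \<xi> y')) \<partial>lborel))) \<partial>lborel \<partial>lborel)"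
      unfolding BL_def Gh_def by (rule norm_bilinear_integral_le[OF mint Gint Gint, where c=1]) (auto simp: nE)
    also have "\<dots> \<le> (\<integral>\<^sup>+y. \<integral>\<^sup>+y'. ennreal (norm (G s l y)) * (ennreal (norm (G s' l' y')) * ennreal K) \<partial>lborel \<partial>lborel)"
      by (intro nn_integral_mono mult_left_mono ennreal_leI kk) auto
    also have "\<dots> = ennreal (v s l) * (ennreal (v s' l') * ennreal K)"
      by (simp add: nn_integral_cmult nn_integral_multc nv)
    also have "\<dots> = ennreal (A * \<bar>s - s'\<bar> powr (-\<sigma>) * v s l * v s' l')"
      using v0 K by (simp add: ennreal_mult[symmetric] K_def[symmetric] mult_ac)
    finally show ?thesis .
  qed
  \<comment> \<open>The phase in m has modulus 1, so Cauchy-Schwarz with the weight w reduces the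
    claim to one level set at a time, uniformly in s and s'.\<close>
  have H2: "ennreal (norm (BL s s' l l')) \<le> ennreal ((2 * pi) ^ DIM('a) / a * sqrt (v s l * v s' l'))" for s s' l l'
  proof -
    define c where "c = (2 * pi) ^ DIM('a) / a"
    have c: "c > 0" using a by (simp add: c_def)
    have [measurable]: "Gh s l \<in> borel_measurable borel" for s l unfolding Gh_def[abs_def] E_def
      by (rule lborel.borel_measurable_lebesgue_integral) (simp add: case_prod_unfold)
    have L2: "(\<integral>\<^sup>+\<xi>. ennreal (w \<xi> * (norm (Gh s l \<xi>))\<^sup>2) \<partial>lborel) \<le> ennreal (c * v s l)" for s l
      using nn_integral_annulus_weight_le[OF a e Gint G1, of b s l] by (simp add: w_def Gh_def E_def v_def c_def)
    define f where "f s l \<xi> = ennreal (sqrt (w \<xi>) * norm (Gh s l \<xi>))" for s l \<xi>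
    have f2: "(\<integral>\<^sup>+\<xi>. (f s l \<xi>)\<^sup>2 \<partial>lborel) \<le> ennreal (c * v s l)" for s l
    proof -
      have "(f s l \<xi>)\<^sup>2 = ennreal (w \<xi> * (norm (Gh s l \<xi>))\<^sup>2)" for \<xi>
        using wb(1)[of \<xi>] by (simp add: f_def ennreal_power power_mult_distrib)
      then show ?thesis using L2[of s l] by simp
    qed
    have "ennreal (norm (BL s s' l l')) \<le> (\<integral>\<^sup>+\<xi>. f s l \<xi> * f s' l' \<xi> \<partial>lborel)"
      unfolding BL_def
    proof (rule order_trans[OF norm_integral_le_nn_integral], rule nn_integral_mono)
      fix \<xi>
      have eq: "sqrt (w \<xi>) * norm (Gh s l \<xi>) * (sqrt (w \<xi>) * norm (Gh s' l' \<xi>)) = w \<xi> * (norm (Gh s l \<xi>) * norm (Gh s' l' \<xi>))"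
      proof -
        have "sqrt (w \<xi>) * norm (Gh s l \<xi>) * (sqrt (w \<xi>) * norm (Gh s' l' \<xi>)) = (sqrt (w \<xi>) * sqrt (w \<xi>)) * (norm (Gh s l \<xi>) * norm (Gh s' l' \<xi>))"
          by (simp only: mult_ac)
        then show ?thesis using wb(1)[of \<xi>] by simp
      qed
      have "f s l \<xi> * f s' l' \<xi> = ennreal (sqrt (w \<xi>) * norm (Gh s l \<xi>) * (sqrt (w \<xi>) * norm (Gh s' l' \<xi>)))"
        unfolding f_def by (rule ennreal_mult[symmetric]) (use wb(1)[of \<xi>] in auto)
      moreover have "norm (m s s' \<xi> * (Gh s l \<xi> * cnj (Gh s' l' \<xi>))) = w \<xi> * (norm (Gh s l \<xi>) * norm (Gh s' l' \<xi>))"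
        using wb(1)[of \<xi>] by (simp add: m_def norm_mult)
      ultimately show "ennreal (norm (m s s' \<xi> * (Gh s l \<xi> * cnj (Gh s' l' \<xi>)))) \<le> f s l \<xi> * f s' l' \<xi>"
        unfolding eq by simp
    qed
    then have "(ennreal (norm (BL s s' l l')))\<^sup>2 \<le> (\<integral>\<^sup>+\<xi>. f s l \<xi> * f s' l' \<xi> \<partial>lborel)\<^sup>2"
      by (rule power_mono) simp
    also have "\<dots> \<le> (\<integral>\<^sup>+\<xi>. (f s l \<xi>)\<^sup>2 \<partial>lborel) * (\<integral>\<^sup>+\<xi>. (f s' l' \<xi>)\<^sup>2 \<partial>lborel)"
      by (rule Cauchy_Schwarz_nn_integral) (auto simp: f_def)
    also have "\<dots> \<le> ennreal (c * v s l) * ennreal (c * v s' l')" by (intro mult_mono f2) auto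
    also have "\<dots> = ennreal ((c * sqrt (v s l * v s' l'))\<^sup>2)"
      using c v0 by (simp add: ennreal_mult[symmetric] power_mult_distrib power2_eq_square mult_ac)
    finally have "(norm (BL s s' l l'))\<^sup>2 \<le> (c * sqrt (v s l * v s' l'))\<^sup>2"
      by (simp add: ennreal_power)
    then have "norm (BL s s' l l') \<le> c * sqrt (v s l * v s' l')"
      by (rule power2_le_imp_le) (use c v0 in simp)
    then show ?thesis by (simp add: c_def ennreal_leI)
  qed
  \<comment> \<open>Integrating l^(q-1) over the levels up to |F| gives |F|^q / q; this is the
    origin of the division by q.\<close>
  define V where "V s = (\<integral>y. norm (F (s, y)) powr q \<partial>lborel) / q" for s
  have [measurable]: "V \<in> borel_measurable borel" unfolding V_def[abs_def]
    by (intro borel_measurable_divide lborel.borel_measurable_lebesgue_integral) (auto simp: case_prod_unfold)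
  have V0': "V s \<ge> 0" for s using q1 by (simp add: V_def)
  have Fq_le: "norm (F (s, y)) powr q \<le> M powr q * (indicator (cball 0 r) s * indicator ?B y)" for s y
    using Fb[of s y] q1 M by (cases "s \<in> cball 0 r"; cases "y \<in> ?B") (auto intro: powr_mono2)
  have Fq_le1: "norm (F (s, y)) powr q \<le> M powr q * indicator ?B y" for s y
    using Fq_le[of s y] by (cases "s \<in> cball 0 r"; cases "y \<in> ?B") auto
  have Fqs: "integrable lborel (\<lambda>y. norm (F (s, y)) powr q)" for s
    by (rule Bochner_Integration.integrable_bound[OF bint[of "M powr q" r]])
       (use Fq_le1[of s] in \<open>auto intro!: AE_I2 order_trans[OF _ abs_ge_self]\<close>)
  have Vs: "(\<integral>\<^sup>+l. ennreal (l powr (q - 1) * v s l) \<partial>lborel) = ennreal (V s)" for s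
  proof -
    have "(\<integral>\<^sup>+l. ennreal (l powr (q - 1) * v s l) \<partial>lborel) = (\<integral>\<^sup>+l. \<integral>\<^sup>+y. ennreal (l powr (q - 1)) * ennreal (norm (G s l y)) \<partial>lborel \<partial>lborel)"
      using v0 by (simp add: nn_integral_cmult nv ennreal_mult)
    also have "\<dots> = (\<integral>\<^sup>+y. \<integral>\<^sup>+l. ennreal (l powr (q - 1)) * ennreal (norm (G s l y)) \<partial>lborel \<partial>lborel)"
      by (rule lborel_pair.Fubini') (simp add: case_prod_unfold)
    also have "\<dots> = (\<integral>\<^sup>+y. ennreal (norm (F (s, y)) powr q / q) \<partial>lborel)"
    proof (rule nn_integral_cong)
      fix y
      have "(\<integral>\<^sup>+l. ennreal (l powr (q - 1)) * ennreal (norm (G s l y)) \<partial>lborel) = (\<integral>\<^sup>+l. ennreal (l powr (q - 1)) * indicator {0..norm (F (s, y))} l \<partial>lborel)"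
        by (rule nn_integral_cong) (auto simp: G_def indicator_def norm_sgn)
      also have "\<dots> = ennreal (norm (F (s, y)) powr q / q)" using q1 by (simp add: nn_integral_powr_from_0)
      finally show "(\<integral>\<^sup>+l. ennreal (l powr (q - 1)) * ennreal (norm (G s l y)) \<partial>lborel) = ennreal (norm (F (s, y)) powr q / q)" .
    qed
    also have "\<dots> = ennreal (\<integral>y. norm (F (s, y)) powr q / q \<partial>lborel)"
      by (rule nn_integral_eq_integral) (use Fqs q1 in auto)
    finally show ?thesis by (simp add: V_def)
  qed
  define X where "X = (\<integral>z. norm (F z) powr q \<partial>lborel)"
  have Fq: "integrable (lborel \<Otimes>\<^sub>M lborel) (\<lambda>z. norm (F z) powr q)"
  proof (rule Bochner_Integration.integrable_bound)
    have "emeasure (lborel \<Otimes>\<^sub>M lborel) (cball (0::real) r \<times> ?B) < \<infinity>"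
      using emeasure_lborel_cball_finite[of "0::real" r] emeasure_lborel_cball_finite[of "0::'a" r]
      by (simp add: lborel.emeasure_pair_measure_Times ennreal_mult_less_top)
    then show "integrable (lborel \<Otimes>\<^sub>M lborel) (\<lambda>z. M powr q * indicator (cball (0::real) r \<times> ?B) z :: real)"
      by (intro integrable_mult_right integrable_real_indicator) auto
    show "AE z in lborel \<Otimes>\<^sub>M lborel. norm (norm (F z) powr q) \<le> norm (M powr q * indicator (cball (0::real) r \<times> ?B) z :: real)"
      using Fq_le by (auto intro!: AE_I2 simp: indicator_times)
  qed measurable
  have X0: "X \<ge> 0" by (simp add: X_def)
  have NV: "(\<integral>\<^sup>+s. ennreal (V s) \<partial>lborel) = ennreal (X / q)"
  proof -
    have "(\<integral>\<^sup>+s. ennreal (V s) \<partial>lborel) = (\<integral>\<^sup>+s. \<integral>\<^sup>+y. ennreal (norm (F (s, y)) powr q / q) \<partial>lborel \<partial>lborel)"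
      unfolding V_def using Fqs q1 by (simp add: nn_integral_eq_integral)
    also have "\<dots> = (\<integral>\<^sup>+z. ennreal (norm (F z) powr q / q) \<partial>(lborel \<Otimes>\<^sub>M lborel))"
      by (subst lborel.nn_integral_fst[symmetric]) auto
    also have "\<dots> = ennreal (\<integral>z. norm (F z) powr q / q \<partial>(lborel \<Otimes>\<^sub>M lborel))"
      by (rule nn_integral_eq_integral) (use Fq q1 in auto)
    finally show ?thesis by (simp add: X_def lborel_prod)
  qed
  show ?thesis
  \<comment> \<open>\<open>slice_level_sum\<close> is formulated for positive total mass; if X = 0,
    then F vanishes almost everywhere.\<close>
  proof (cases "X = 0")
    case True
    have "AE z in lborel \<Otimes>\<^sub>M lborel. norm (F z) powr q = 0"
      using True Fq by (subst integral_nonneg_eq_0_iff_AE[symmetric]) (auto simp: X_def lborel_prod)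
    then have "AE z in lborel. F z = 0" unfolding lborel_prod by eventually_elim simp
    then have "dual_extension e F \<xi> = (\<integral>z. 0 \<partial>(lborel :: (real \<times> 'a) measure))" for \<xi>
      unfolding dual_extension_def lborel_prod[symmetric]
      by (intro integral_cong_AE) (auto simp: lborel_prod elim: eventually_mono)
    then show ?thesis by simp
  next
    case False
    have "(\<integral>\<^sup>+\<xi>. ennreal (w \<xi> * (norm (\<Phi> \<xi>))\<^sup>2) \<partial>lborel) \<le> (\<integral>\<^sup>+s. \<integral>\<^sup>+s'. \<integral>\<^sup>+l. \<integral>\<^sup>+l'. ennreal (norm (BL s s' l l')) \<partial>lborel \<partial>lborel \<partial>lborel \<partial>lborel)"
      by (rule order_trans[OF step1]) (intro nn_integral_mono step2)
    also have "\<dots> \<le> ennreal ((1 + (2 - \<alpha>) / (1 - \<alpha>)) * A powr (1 - \<alpha>) * ((2 * pi) ^ DIM('a) / a) powr \<alpha> * ((4 / (1 - \<alpha>) + 6) * (X / q) powr (2 - \<alpha>)))"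
    proof (rule slice_level_sum[OF \<alpha> q \<sigma> A _ v_meas v0 v0' _ V0' Vs _ NV H1 H2])
      show "X / q > 0" using X0 False q1 by simp
    qed (use a in auto)
    finally show ?thesis by (simp add: w_def \<Phi>_def X_def)
  qed
qed

section \<open>The extension estimate\<close>

definition extension :: "('a::euclidean_space \<Rightarrow> complex) \<Rightarrow> real \<times> 'a \<Rightarrow> complex" where
  "extension g z = (\<integral>\<xi>. cis (snd z \<bullet> \<xi> - fst z * (norm \<xi>)\<^sup>2) * g \<xi> \<partial>lborel)"

lemma extension_measurable[measurable]:
  assumes [measurable]: "g \<in> borel_measurable borel"
  shows "extension g \<in> borel_measurable borel"
  unfolding extension_def[abs_def]
  by (rule lborel.borel_measurable_lebesgue_integral) (simp add: case_prod_unfold)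

lemma norm_extension_le: "norm (extension g z) \<le> (\<integral>\<xi>. norm (g \<xi>) \<partial>lborel)"
  unfolding extension_def by (rule integral_norm_bound[THEN order_trans]) (simp add: norm_mult)

lemma extension_coord_swap:
  assumes "norm e = 1"
  shows "extension g (coord_swap e (s, y)) = (\<integral>\<xi>. cis (s * (\<xi> \<bullet> e) + y \<bullet> zeta e \<xi>) * g \<xi> \<partial>lborel)"
proof -
  have "snd (coord_swap e (s, y)) \<bullet> \<xi> - fst (coord_swap e (s, y)) * (norm \<xi>)\<^sup>2 = s * (\<xi> \<bullet> e) + y \<bullet> zeta e \<xi>" for \<xi>
    by (simp add: coord_swap_def zeta_def inner_add_left inner_diff_right inner_commute algebra_simps)
  then show ?thesis unfolding extension_def by simp
qed

section \<open>Uniform bounds in dimension at least two\<close>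

context
  assumes d2: "DIM('a::euclidean_space) \<ge> 2"
begin

text \<open>The kernel constant is a multiple of a^\<sigma> and the L2 constant a multiple of 1 / a.
  Raised to the powers 1 - \<alpha> and \<alpha> they give a^\<alpha> and a^(-\<alpha>), which
  cancel. The numbers 7 and 6 are dictated by the annulus between the radii 1 and 7 that a boost
  produces for small R; for R \<ge> 2 the annulus of the theorem satisfies both conditions as it
  is.\<close>

lemma dual_extension_bound:
  fixes \<alpha> q :: real
  defines "\<alpha> \<equiv> (real DIM('a) - 1) / (real DIM('a) + 1)" and "q \<equiv> 2 / (2 - \<alpha>)"
  shows "\<exists>C>0. \<forall>a b M r. \<forall>e::'a. \<forall>F. norm e = 1 \<longrightarrow> 1 \<le> a \<longrightarrow> a \<le> b \<longrightarrow> b \<le> 7 * a \<longrightarrow> b - a \<le> 6 \<longrightarrow>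
     F \<in> borel_measurable (borel \<Otimes>\<^sub>M borel) \<longrightarrow> 0 < M \<longrightarrow> 0 < r \<longrightarrow>
     (\<forall>s y. norm (F (s, y)) \<le> M * (indicator (cball 0 r) s * indicator (cball 0 r) y)) \<longrightarrow>
     (\<integral>\<^sup>+\<xi>. ennreal (annulus_weight a b e \<xi> * (norm (dual_extension e F \<xi>))\<^sup>2) \<partial>lborel)
      \<le> ennreal (C * (\<integral>z. norm (F z) powr q \<partial>lborel) powr (2 - \<alpha>))"
proof -
  define \<sigma> where "\<sigma> = (real DIM('a) - 1) / 2"
  have \<alpha>: "0 < \<alpha>" "\<alpha> < 1" using d2 by (auto simp: \<alpha>_def field_simps)
  have \<sigma>\<alpha>: "\<sigma> * (1 - \<alpha>) = \<alpha>" using d2 by (simp add: \<sigma>_def \<alpha>_def field_simps)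
  have \<sigma>: "\<sigma> \<ge> 0" using d2 by (simp add: \<sigma>_def)
  have q1: "q > 1" using \<alpha> by (auto simp: q_def field_simps)
  obtain K where K: "K \<ge> 0" "\<And>a b s. \<And>e z :: 'a. norm e = 1 \<Longrightarrow> 0 \<le> a \<Longrightarrow> a \<le> b \<Longrightarrow> s \<noteq> 0 \<Longrightarrow>
    norm (\<integral>\<xi>. of_real (annulus_weight a b e \<xi>) * cis (s * (\<xi> \<bullet> e) + z \<bullet> zeta e \<xi>) \<partial>lborel) \<le> K * (b - a) * b powr \<sigma> * \<bar>s\<bar> powr (-\<sigma>)"
    using kernel_decay[where 'a='a] unfolding \<sigma>_def by blast
  \<comment> \<open>The 6 bounds the thickness and the 7 the ratio of the radii; K + 1 in place of K
    makes the constant positive, as the interpolation requires.\<close>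
  define A1 where "A1 = (K + 1) * 6 * 7 powr \<sigma>"
  have A1: "A1 > 0" using K by (simp add: A1_def)
  define c where "c = (2 * pi) ^ DIM('a)"
  have c: "c > 0" by (simp add: c_def)
  define C where "C = (1 + (2 - \<alpha>) / (1 - \<alpha>)) * (A1 powr (1 - \<alpha>) * c powr \<alpha>) * ((4 / (1 - \<alpha>) + 6) * (1 / q) powr (2 - \<alpha>))"
  have C: "C > 0" using \<alpha> A1 c q1 by (simp add: C_def add_pos_pos)
  have main: "(\<integral>\<^sup>+\<xi>. ennreal (annulus_weight a b e \<xi> * (norm (dual_extension e F \<xi>))\<^sup>2) \<partial>lborel)
      \<le> ennreal (C * (\<integral>z. norm (F z) powr q \<partial>lborel) powr (2 - \<alpha>))"
    if e: "norm e = 1" and ab: "1 \<le> a" "a \<le> b" "b \<le> 7 * a" "b - a \<le> 6"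
      and F: "F \<in> borel_measurable (borel \<Otimes>\<^sub>M borel)"
      and Fb: "\<And>s y. norm (F (s, y)) \<le> M * (indicator (cball 0 r) s * indicator (cball 0 r) y)"
      and M: "0 < M" and r: "0 < r"
    for a b M r and e :: 'a and F
  proof -
    define A where "A = A1 * a powr \<sigma>"
    have A: "A > 0" using A1 ab by (simp add: A_def)
    define X where "X = (\<integral>z. norm (F z) powr q \<partial>lborel)"
    have X: "X \<ge> 0" by (simp add: X_def)
    have "(\<integral>\<^sup>+\<xi>. ennreal (annulus_weight a b e \<xi> * (norm (dual_extension e F \<xi>))\<^sup>2) \<partial>lborel)
      \<le> ennreal ((1 + (2 - \<alpha>) / (1 - \<alpha>)) * A powr (1 - \<alpha>) * ((2 * pi) ^ DIM('a) / a) powr \<alpha> * ((4 / (1 - \<alpha>) + 6) * ((\<integral>z. norm (F z) powr q \<partial>lborel) / q) powr (2 - \<alpha>)))"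
    proof (rule dual_extension_bound_of_kernel[OF \<alpha> _ \<sigma>\<alpha> A _ e F Fb M r])
      show "q = 2 / (2 - \<alpha>)" by (simp add: q_def)
      show "norm (\<integral>\<xi>. of_real (annulus_weight a b e \<xi>) * cis (s * (\<xi> \<bullet> e) + z \<bullet> zeta e \<xi>) \<partial>lborel) \<le> A * \<bar>s\<bar> powr (-\<sigma>)"
        if "s \<noteq> 0" for s z
      proof -
        have "norm (\<integral>\<xi>. of_real (annulus_weight a b e \<xi>) * cis (s * (\<xi> \<bullet> e) + z \<bullet> zeta e \<xi>) \<partial>lborel) \<le> K * (b - a) * b powr \<sigma> * \<bar>s\<bar> powr (-\<sigma>)"
          by (rule K(2)) (use e ab that in auto)
        also have "\<dots> \<le> (K + 1) * 6 * (7 * a) powr \<sigma> * \<bar>s\<bar> powr (-\<sigma>)"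
          using K(1) ab \<sigma> by (intro mult_right_mono mult_mono powr_mono2) auto
        also have "\<dots> = A * \<bar>s\<bar> powr (-\<sigma>)" using ab by (simp add: A_def A1_def powr_mult mult_ac)
        finally show ?thesis .
      qed
    qed (use ab in auto)
    also have "A powr (1 - \<alpha>) = A1 powr (1 - \<alpha>) * a powr \<alpha>"
      using A1 ab by (simp add: A_def powr_mult powr_powr \<sigma>\<alpha>)
    also have "((2 * pi) ^ DIM('a) / a) powr \<alpha> = c powr \<alpha> / a powr \<alpha>"
      unfolding c_def[symmetric] using c ab by (simp add: powr_divide)
    also have "((\<integral>z. norm (F z) powr q \<partial>lborel) / q) powr (2 - \<alpha>) = (1 / q) powr (2 - \<alpha>) * X powr (2 - \<alpha>)"
      using X q1 by (simp add: X_def[symmetric] powr_mult[symmetric] del: powr_mult)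
    also have "(1 + (2 - \<alpha>) / (1 - \<alpha>)) * (A1 powr (1 - \<alpha>) * a powr \<alpha>) * (c powr \<alpha> / a powr \<alpha>) * ((4 / (1 - \<alpha>) + 6) * ((1 / q) powr (2 - \<alpha>) * X powr (2 - \<alpha>))) = C * X powr (2 - \<alpha>)"
      using ab by (simp add: C_def mult_ac)
    finally show ?thesis by (simp add: X_def)
  qed
  show ?thesis by (rule exI[of _ C], intro conjI allI impI C, rule main) (assumption | blast)+
qed

text \<open>Duality with the extremal function: F is |W|^(p-2) times the conjugate of W, cut off to
  a box, so its pairing with W is X, the integral of |W|^p over the box. Moving the operator onto F
  and applying Cauchy-Schwarz gives X^2 \<le> (C N)^2 X^(2-\<alpha>), hence X \<le> (C
  N)^(2/\<alpha>).\<close>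

lemma extension_directional_bound:
  fixes p :: real
  defines "p \<equiv> 2 * (real DIM('a) + 1) / (real DIM('a) - 1)"
  shows "\<exists>C>0. \<forall>a b. \<forall>e::'a. \<forall>g. norm e = 1 \<longrightarrow> 1 \<le> a \<longrightarrow> a \<le> b \<longrightarrow> b \<le> 7 * a \<longrightarrow> b - a \<le> 6 \<longrightarrow>
     L2 g \<longrightarrow> integrable lborel g \<longrightarrow> (\<forall>\<xi>. g \<xi> \<noteq> 0 \<longrightarrow> a \<le> norm \<xi> \<and> norm \<xi> \<le> b) \<longrightarrow>
     (\<integral>\<^sup>+z. ennreal (norm (extension (\<lambda>\<xi>. g \<xi> * of_real ((e \<bullet> sgn \<xi>)\<^sup>2)) z) powr p) \<partial>lborel) \<le> ennreal ((C * L2norm g) powr p)"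
proof -
  define \<alpha> where "\<alpha> = (real DIM('a) - 1) / (real DIM('a) + 1)"
  define q where "q = 2 / (2 - \<alpha>)"
  have \<alpha>: "0 < \<alpha>" "\<alpha> < 1" using d2 by (auto simp: \<alpha>_def field_simps)
  have p: "p = 2 / \<alpha>" using d2 by (simp add: p_def \<alpha>_def field_simps)
  have p2: "p > 2" using \<alpha> by (simp add: p field_simps)
  have pq: "(p - 1) * q = p" using \<alpha> by (simp add: p q_def field_simps)
  have q1: "q > 1" using \<alpha> by (auto simp: q_def field_simps)
  obtain C0 where C0: "C0 > 0" and C0': "\<forall>a b M r. \<forall>e::'a. \<forall>F. norm e = 1 \<longrightarrow> 1 \<le> a \<longrightarrow> a \<le> b \<longrightarrow> b \<le> 7 * a \<longrightarrow> b - a \<le> 6 \<longrightarrow>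
     F \<in> borel_measurable (borel \<Otimes>\<^sub>M borel) \<longrightarrow> 0 < M \<longrightarrow> 0 < r \<longrightarrow>
     (\<forall>s y. norm (F (s, y)) \<le> M * (indicator (cball 0 r) s * indicator (cball 0 r) y)) \<longrightarrow>
     (\<integral>\<^sup>+\<xi>. ennreal (annulus_weight a b e \<xi> * (norm (dual_extension e F \<xi>))\<^sup>2) \<partial>lborel)
      \<le> ennreal (C0 * (\<integral>z. norm (F z) powr q \<partial>lborel) powr (2 - \<alpha>))"
    using dual_extension_bound[folded \<alpha>_def, folded q_def] by (elim exE conjE) (rule that)
  define C where "C = sqrt C0"
  have C: "C > 0" using C0 by (simp add: C_def)
  have main: "(\<integral>\<^sup>+z. ennreal (norm (extension (\<lambda>\<xi>. g \<xi> * of_real ((e \<bullet> sgn \<xi>)\<^sup>2)) z) powr p) \<partial>lborel) \<le> ennreal ((C * L2norm g) powr p)"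
    if e: "norm e = 1" and ab: "1 \<le> a" "a \<le> b" "b \<le> 7 * a" "b - a \<le> 6" and g2: "L2 g" and gi: "integrable lborel g"
      and supp: "\<And>\<xi>. g \<xi> \<noteq> 0 \<Longrightarrow> a \<le> norm \<xi> \<and> norm \<xi> \<le> b" for a b and e :: 'a and g
  proof -
    have [measurable]: "g \<in> borel_measurable borel" using g2 L2_measurable by auto
    have [measurable]: "cball (0::'a) t \<in> sets borel" "cball (0::real) t \<in> sets borel" for t by (simp_all add: borel_closed)
    define h where "h \<xi> = g \<xi> * of_real ((e \<bullet> sgn \<xi>)\<^sup>2)" for \<xi>
    have [measurable]: "h \<in> borel_measurable borel" unfolding h_def by measurable
    have es: "\<bar>e \<bullet> sgn \<xi>\<bar> \<le> 1" for \<xi> using Cauchy_Schwarz_ineq2[of e "sgn \<xi>"] e by (cases "\<xi> = 0") (auto simp: norm_sgn)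
    have hg: "norm (h \<xi>) \<le> norm (g \<xi>)" for \<xi>
      using power_mono[OF es[of \<xi>], of 2] by (auto simp: h_def norm_mult norm_power intro: mult_left_le)
    have hi: "integrable lborel h" by (rule Bochner_Integration.integrable_bound[OF gi]) (use hg in auto)
    \<comment> \<open>The factor (e \<bullet> sgn \<xi>)^2 in h is the full weight. One of its two
      square roots is bounded by 1; the other stays and is paired with the dual function in
      Cauchy-Schwarz.\<close>
    have hw: "norm (h \<xi>) \<le> norm (g \<xi>) * sqrt (annulus_weight a b e \<xi>)" for \<xi>
    proof (cases "g \<xi> = 0")
      case False
      then have "annulus_weight a b e \<xi> = (e \<bullet> sgn \<xi>)\<^sup>2" using supp[of \<xi>] by (simp add: annulus_weight_def)
      then have "sqrt (annulus_weight a b e \<xi>) = \<bar>e \<bullet> sgn \<xi>\<bar>" by simp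
      moreover have "\<bar>e \<bullet> sgn \<xi>\<bar> * \<bar>e \<bullet> sgn \<xi>\<bar> \<le> 1 * \<bar>e \<bullet> sgn \<xi>\<bar>" by (rule mult_right_mono[OF es]) simp
      moreover have "norm (h \<xi>) = norm (g \<xi>) * (\<bar>e \<bullet> sgn \<xi>\<bar> * \<bar>e \<bullet> sgn \<xi>\<bar>)" by (simp add: h_def norm_mult norm_power power2_eq_square)
      ultimately show ?thesis by (simp only: mult_1_left) (rule mult_left_mono, simp_all)
    qed (simp add: h_def)
    define L where "L = (\<integral>\<xi>. norm (h \<xi>) \<partial>lborel)"
    have L: "L \<ge> 0" by (simp add: L_def)
    define W where "W z = extension h (coord_swap e z)" for z
    have [measurable]: "W \<in> borel_measurable borel" unfolding W_def by measurable
    have W_le: "norm (W z) \<le> L" for z unfolding W_def L_def by (rule norm_extension_le)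
    have Wk: "W z = (\<integral>\<xi>. cis (fst z * (\<xi> \<bullet> e) + snd z \<bullet> zeta e \<xi>) * h \<xi> \<partial>lborel)" for z
      using extension_coord_swap[OF e, of h "fst z" "snd z"] by (simp add: W_def)
    define N where "N = L2norm g"
    have N: "N \<ge> 0" by (simp add: N_def L2norm_def)
    have N2: "(\<integral>\<^sup>+\<xi>. ennreal ((norm (g \<xi>))\<^sup>2) \<partial>lborel) = ennreal (N\<^sup>2)"
      unfolding N_def L2norm_def using g2 by (simp add: L2_def nn_integral_eq_integral)
    \<comment> \<open>X must be finite before a power of it can be divided out, hence the box of
      radius r. The bound does not depend on r, and monotone convergence removes the box.\<close>
    have bd: "(\<integral>\<^sup>+z. ennreal (norm (W z) powr p) * indicator (cball 0 r \<times> cball 0 r) z \<partial>lborel) \<le> ennreal ((C * N) powr p)" if r: "r > 0" for r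
    proof -
      let ?D = "cball (0::real) r \<times> cball (0::'a) r"
      have D[measurable]: "?D \<in> sets borel" unfolding borel_prod[symmetric] by simp
      have Dfin: "emeasure lborel ?D < \<infinity>"
        using emeasure_lborel_cball_finite[of "0::real" r] emeasure_lborel_cball_finite[of "0::'a" r]
        unfolding lborel_prod[symmetric] by (simp add: lborel.emeasure_pair_measure_Times ennreal_mult_less_top)
      have Di: "integrable lborel (\<lambda>z. k * indicator ?D z :: real)" for k
        by (intro integrable_mult_right integrable_real_indicator) (use Dfin in auto)
      define F where "F z = of_real (indicator ?D z * norm (W z) powr (p - 2)) * cnj (W z)" for z
      have Fm[measurable]: "F \<in> borel_measurable borel" unfolding F_def by measurable
      have nF: "norm (F z) = indicator ?D z * norm (W z) powr (p - 1)" for z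
      proof (cases "W z = 0")
        case False
        have "norm (W z) powr (p - 1) = norm (W z) powr ((p - 2) + 1)" by simp
        also have "\<dots> = norm (W z) powr (p - 2) * norm (W z)" unfolding powr_add using False by simp
        finally show ?thesis by (simp add: F_def norm_mult abs_mult)
      qed (simp add: F_def)
      \<comment> \<open>W is bounded by the L1 norm L of h, which bounds F; the added 1 keeps M
        positive.\<close>
      define M where "M = L powr (p - 1) + 1"
      have M: "M > 0" by (simp add: M_def add_nonneg_pos)
      have Fb: "norm (F (s, y)) \<le> M * (indicator (cball 0 r) s * indicator (cball 0 r) y)" for s y
      proof -
        have "norm (W (s, y)) powr (p - 1) \<le> L powr (p - 1)" using W_le p2 by (intro powr_mono2) auto
        then show ?thesis unfolding nF by (auto simp: indicator_def M_def)
      qed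
      have Fi: "integrable lborel F"
      proof (rule Bochner_Integration.integrable_bound[OF Di[of M]])
        show "AE z in lborel. norm (F z) \<le> norm (M * indicator ?D z)"
        proof (rule AE_I2)
          fix z show "norm (F z) \<le> norm (M * indicator ?D z)" using Fb[of "fst z" "snd z"] M by (cases z) (simp add: indicator_times)
        qed
      qed simp
      define X where "X = (\<integral>z. norm (F z) powr q \<partial>lborel)"
      have Fq: "norm (F z) powr q = norm (W z) powr p * indicator ?D z" for z
        unfolding nF by (cases "z \<in> ?D") (auto simp: powr_powr pq)
      have FW: "F z * W z = of_real (norm (F z) powr q)" for z
      proof (cases "W z = 0")
        case False
        have "norm (W z) powr p = norm (W z) powr ((p - 2) + 2)" by simp
        also have "\<dots> = norm (W z) powr (p - 2) * (norm (W z))\<^sup>2" unfolding powr_add using False by simp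
        finally have pp: "norm (W z) powr p = norm (W z) powr (p - 2) * (norm (W z))\<^sup>2" .
        have "F z * W z = of_real (indicator ?D z * norm (W z) powr (p - 2)) * of_real ((norm (W z))\<^sup>2)"
          unfolding F_def complex_norm_square by (simp only: mult_ac)
        also have "\<dots> = of_real (norm (F z) powr q)" unfolding Fq pp of_real_mult[symmetric] by (simp only: mult_ac)
        finally show ?thesis .
      qed (simp add: Fq)
      have Fqi: "integrable lborel (\<lambda>z. norm (F z) powr q)"
      proof (rule Bochner_Integration.integrable_bound[OF Di[of "L powr p"]])
        show "AE z in lborel. norm (norm (F z) powr q) \<le> norm (L powr p * indicator ?D z)"
          unfolding Fq using W_le p2 by (auto intro!: AE_I2 powr_mono2 simp: indicator_def)
      qed measurable
      have X0: "X \<ge> 0" by (simp add: X_def)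
      have nX: "(\<integral>\<^sup>+z. ennreal (norm (W z) powr p) * indicator ?D z \<partial>lborel) = ennreal X"
      proof -
        have "(\<integral>\<^sup>+z. ennreal (norm (W z) powr p) * indicator ?D z \<partial>lborel) = (\<integral>\<^sup>+z. ennreal (norm (F z) powr q) \<partial>lborel)"
          unfolding Fq by (intro nn_integral_cong) (auto simp: indicator_def)
        also have "\<dots> = ennreal X" unfolding X_def by (rule nn_integral_eq_integral[OF Fqi]) auto
        finally show ?thesis .
      qed
      have "complex_of_real X = (\<integral>z. F z * W z \<partial>lborel)" unfolding X_def FW by simp
      also have "\<dots> = (\<integral>\<xi>. h \<xi> * (\<integral>z. cis (fst z * (\<xi> \<bullet> e) + snd z \<bullet> zeta e \<xi>) * F z \<partial>lborel) \<partial>lborel)"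
        unfolding Wk by (rule integral_kernel_swap[OF Fi hi]) auto
      finally have XE: "complex_of_real X = (\<integral>\<xi>. h \<xi> * dual_extension e F \<xi> \<partial>lborel)" unfolding dual_extension_def .
      define f2 where "f2 \<xi> = ennreal (sqrt (annulus_weight a b e \<xi>) * norm (dual_extension e F \<xi>))" for \<xi>
      have [measurable]: "dual_extension e F \<in> borel_measurable borel" unfolding dual_extension_def[abs_def]
        by (rule lborel.borel_measurable_lebesgue_integral) (simp add: case_prod_unfold)
      have [measurable]: "f2 \<in> borel_measurable borel" unfolding f2_def by measurable
      have f22: "(\<integral>\<^sup>+\<xi>. (f2 \<xi>)\<^sup>2 \<partial>lborel) \<le> ennreal (C0 * X powr (2 - \<alpha>))"
      proof -
        have "(f2 \<xi>)\<^sup>2 = ennreal (annulus_weight a b e \<xi> * (norm (dual_extension e F \<xi>))\<^sup>2)" for \<xi>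
          using annulus_weight_bounds(1)[OF e, of a b \<xi>] by (simp add: f2_def ennreal_power power_mult_distrib)
        then show ?thesis unfolding X_def
          using C0'[rule_format, OF e ab _ M r Fb] Fm unfolding borel_prod by simp
      qed
      have "ennreal X = ennreal (norm (complex_of_real X))" using X0 by simp
      also have "\<dots> \<le> (\<integral>\<^sup>+\<xi>. ennreal (norm (h \<xi> * dual_extension e F \<xi>)) \<partial>lborel)"
        unfolding XE by (rule norm_integral_le_nn_integral)
      also have "\<dots> \<le> (\<integral>\<^sup>+\<xi>. ennreal (norm (g \<xi>)) * f2 \<xi> \<partial>lborel)"
      proof (rule nn_integral_mono)
        fix \<xi>
        have "norm (h \<xi>) * norm (dual_extension e F \<xi>) \<le> (norm (g \<xi>) * sqrt (annulus_weight a b e \<xi>)) * norm (dual_extension e F \<xi>)"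
          by (rule mult_right_mono[OF hw]) simp
        then show "ennreal (norm (h \<xi> * dual_extension e F \<xi>)) \<le> ennreal (norm (g \<xi>)) * f2 \<xi>"
          unfolding f2_def using annulus_weight_bounds(1)[OF e, of a b \<xi>] by (subst ennreal_mult[symmetric]) (auto simp: norm_mult mult.assoc intro: ennreal_leI)
      qed
      finally have "(ennreal X)\<^sup>2 \<le> (\<integral>\<^sup>+\<xi>. ennreal (norm (g \<xi>)) * f2 \<xi> \<partial>lborel)\<^sup>2" by (rule power_mono) simp
      also have "\<dots> \<le> (\<integral>\<^sup>+\<xi>. (ennreal (norm (g \<xi>)))\<^sup>2 \<partial>lborel) * (\<integral>\<^sup>+\<xi>. (f2 \<xi>)\<^sup>2 \<partial>lborel)"
        by (rule Cauchy_Schwarz_nn_integral) auto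
      also have "(\<integral>\<^sup>+\<xi>. (ennreal (norm (g \<xi>)))\<^sup>2 \<partial>lborel) = ennreal (N\<^sup>2)" unfolding N2[symmetric] by (simp add: ennreal_power)
      also have "ennreal (N\<^sup>2) * (\<integral>\<^sup>+\<xi>. (f2 \<xi>)\<^sup>2 \<partial>lborel) \<le> ennreal (N\<^sup>2) * ennreal (C0 * X powr (2 - \<alpha>))"
        by (rule mult_left_mono[OF f22]) simp
      also have "\<dots> = ennreal ((C * N)\<^sup>2 * X powr (2 - \<alpha>))"
        using C0 by (simp add: ennreal_mult[symmetric] C_def power_mult_distrib mult_ac)
      finally have X2: "X\<^sup>2 \<le> (C * N)\<^sup>2 * X powr (2 - \<alpha>)" using X0 by (simp add: ennreal_power)
      have "X \<le> (C * N) powr p"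
      proof (cases "X = 0")
        case False
        then have Xp: "X > 0" using X0 by simp
        have "X\<^sup>2 = X powr (\<alpha> + (2 - \<alpha>))" using Xp by simp
        also have "\<dots> = X powr \<alpha> * X powr (2 - \<alpha>)" by (rule powr_add)
        finally have "X powr \<alpha> * X powr (2 - \<alpha>) \<le> (C * N)\<^sup>2 * X powr (2 - \<alpha>)" using X2 by simp
        then have le: "X powr \<alpha> \<le> (C * N)\<^sup>2" using Xp by simp
        then have "C * N \<noteq> 0" using Xp by (metis less_le_not_le powr_gt_zero zero_power2)
        then have CN: "C * N > 0" using C N by (simp add: zero_less_mult_iff less_le)
        have "X = (X powr \<alpha>) powr (1 / \<alpha>)" using Xp \<alpha> by (simp add: powr_powr)
        also have "\<dots> \<le> ((C * N)\<^sup>2) powr (1 / \<alpha>)" by (rule powr_mono2) (use le \<alpha> in auto)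
        also have "\<dots> = ((C * N) powr 2) powr (1 / \<alpha>)" using CN by simp
        also have "\<dots> = (C * N) powr p" unfolding powr_powr p by simp
        finally show ?thesis .
      qed simp
      then show ?thesis unfolding nX by (rule ennreal_leI)
    qed
    have "(\<integral>\<^sup>+z. ennreal (norm (extension h z) powr p) \<partial>lborel) = (\<integral>\<^sup>+z. ennreal (norm (W z) powr p) \<partial>lborel)"
      unfolding W_def by (rule nn_integral_coord_swap[OF e, symmetric]) measurable
    also have "\<dots> = (\<integral>\<^sup>+z. (SUP n. ennreal (norm (W z) powr p) * indicator (cball 0 (real (Suc n)) \<times> cball 0 (real (Suc n))) z) \<partial>lborel)"
    proof (rule nn_integral_cong, rule antisym)
      fix z :: "real \<times> 'a"
      obtain n where n: "norm z \<le> real n" using real_arch_simple by blast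
      have "norm (fst z) \<le> real (Suc n)" "norm (snd z) \<le> real (Suc n)"
        using norm_fst_le[of "fst z" "snd z"] norm_snd_le[of "snd z" "fst z"] n by auto
      then show "ennreal (norm (W z) powr p) \<le> (SUP n. ennreal (norm (W z) powr p) * indicator (cball 0 (real (Suc n)) \<times> cball 0 (real (Suc n))) z)"
        by (intro SUP_upper2[of n]) (auto simp: indicator_def mem_Times_iff)
    qed (auto intro!: SUP_least simp: indicator_def)
    also have "\<dots> = (SUP n. \<integral>\<^sup>+z. ennreal (norm (W z) powr p) * indicator (cball 0 (real (Suc n)) \<times> cball 0 (real (Suc n))) z \<partial>lborel)"
    proof (rule nn_integral_monotone_convergence_SUP)
      show "incseq (\<lambda>n z. ennreal (norm (W z) powr p) * indicator (cball 0 (real (Suc n)) \<times> cball 0 (real (Suc n))) z)"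
        by (auto simp: incseq_def le_fun_def indicator_def)
      fix n
      have [measurable]: "cball (0::real) (real (Suc n)) \<times> cball (0::'a) (real (Suc n)) \<in> sets borel" unfolding borel_prod[symmetric] by simp
      show "(\<lambda>z. ennreal (norm (W z) powr p) * indicator (cball 0 (real (Suc n)) \<times> cball 0 (real (Suc n))) z) \<in> borel_measurable lborel" by measurable
    qed
    also have "\<dots> \<le> ennreal ((C * N) powr p)" by (rule SUP_least, rule bd) simp
    finally show ?thesis by (simp add: h_def[abs_def] N_def)
  qed
  show ?thesis by (rule exI[of _ C], intro conjI allI impI C, rule main) (assumption | blast)+
qed

end

lemma L2norm_nonneg: "L2norm g \<ge> 0" by (simp add: L2norm_def)

lemma nn_integral_L2: "L2 g \<Longrightarrow> (\<integral>\<^sup>+\<xi>. ennreal ((norm (g \<xi>))\<^sup>2) \<partial>lborel) = ennreal ((L2norm g)\<^sup>2)"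
  unfolding L2norm_def by (simp add: L2_def nn_integral_eq_integral)

lemma integrable_L2_bounded_support:
  fixes g :: "'a::euclidean_space \<Rightarrow> complex"
  assumes g: "L2 g" and b: "\<And>\<xi>. g \<xi> \<noteq> 0 \<Longrightarrow> norm \<xi> \<le> b"
  shows "integrable lborel g"
proof (rule Bochner_Integration.integrable_bound)
  show "integrable lborel (\<lambda>\<xi>. (norm (g \<xi>))\<^sup>2 + indicator (cball 0 b) \<xi>)"
    using g integrable_indicator_compact by (intro Bochner_Integration.integrable_add) (auto simp: L2_def)
  show "g \<in> borel_measurable lborel" using g by (simp add: L2_def)
  show "AE \<xi> in lborel. norm (g \<xi>) \<le> norm ((norm (g \<xi>))\<^sup>2 + indicator (cball 0 b) \<xi>)"
  proof (rule AE_I2)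
    fix \<xi>
    show "norm (g \<xi>) \<le> norm ((norm (g \<xi>))\<^sup>2 + indicator (cball 0 b) \<xi>)"
      using le_square_plus_1[of "norm (g \<xi>)"] b[of \<xi>] by (cases "g \<xi> = 0") auto
  qed
qed

context
  assumes d2: "DIM('a::euclidean_space) \<ge> 2"
begin

lemma extension_annulus_bound:
  fixes p :: real
  defines "p \<equiv> 2 * (real DIM('a) + 1) / (real DIM('a) - 1)"
  shows "\<exists>C>0. \<forall>a b. \<forall>g :: 'a \<Rightarrow> complex. 1 \<le> a \<longrightarrow> a \<le> b \<longrightarrow> b \<le> 7 * a \<longrightarrow> b - a \<le> 6 \<longrightarrow>
     L2 g \<longrightarrow> (\<forall>\<xi>. g \<xi> \<noteq> 0 \<longrightarrow> a \<le> norm \<xi> \<and> norm \<xi> \<le> b) \<longrightarrow>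
     (\<integral>\<^sup>+z. ennreal (norm (extension g z) powr p) \<partial>lborel) \<le> ennreal ((C * L2norm g) powr p)"
proof -
  have p1: "p > 1" using d2 by (simp add: p_def field_simps)
  obtain C0 where C0: "C0 > 0" and C0': "\<forall>a b. \<forall>e::'a. \<forall>g. norm e = 1 \<longrightarrow> 1 \<le> a \<longrightarrow> a \<le> b \<longrightarrow> b \<le> 7 * a \<longrightarrow> b - a \<le> 6 \<longrightarrow>
     L2 g \<longrightarrow> integrable lborel g \<longrightarrow> (\<forall>\<xi>. g \<xi> \<noteq> 0 \<longrightarrow> a \<le> norm \<xi> \<and> norm \<xi> \<le> b) \<longrightarrow>
     (\<integral>\<^sup>+z. ennreal (norm (extension (\<lambda>\<xi>. g \<xi> * of_real ((e \<bullet> sgn \<xi>)\<^sup>2)) z) powr p) \<partial>lborel) \<le> ennreal ((C0 * L2norm g) powr p)"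
    using extension_directional_bound[OF d2, folded p_def] by (elim exE conjE) (rule that)
  define d where "d = real DIM('a)"
  have d: "d \<ge> 1" using d2 by (simp add: d_def)
  \<comment> \<open>One factor d bounds a sum of d terms by its largest. The other absorbs, through
    d \<le> d^p, the d terms that arise when the p-th power of the maximum is replaced by the sum of
    the p-th powers.\<close>
  define C where "C = d * d * C0"
  have C: "C > 0" using C0 d by (simp add: C_def)
  have main: "(\<integral>\<^sup>+z. ennreal (norm (extension g z) powr p) \<partial>lborel) \<le> ennreal ((C * L2norm g) powr p)"
    if ab: "1 \<le> a" "a \<le> b" "b \<le> 7 * a" "b - a \<le> 6" and g2: "L2 g"
      and supp: "\<forall>\<xi>. g \<xi> \<noteq> 0 \<longrightarrow> a \<le> norm \<xi> \<and> norm \<xi> \<le> b" for a b and g :: "'a \<Rightarrow> complex"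
  proof -
    have [measurable]: "g \<in> borel_measurable borel" using g2 L2_measurable by auto
    have gi: "integrable lborel g" by (rule integrable_L2_bounded_support[OF g2]) (use supp in auto)
    define gb where "gb e \<xi> = g \<xi> * of_real ((e \<bullet> sgn \<xi>)\<^sup>2)" for e \<xi> :: 'a
    have [measurable]: "gb e \<in> borel_measurable borel" for e unfolding gb_def by measurable
    have gbi: "integrable lborel (gb e)" if "e \<in> Basis" for e
    proof (rule Bochner_Integration.integrable_bound[OF gi])
      show "AE \<xi> in lborel. norm (gb e \<xi>) \<le> norm (g \<xi>)"
      proof (rule AE_I2)
        fix \<xi> :: 'a
        have "\<bar>e \<bullet> sgn \<xi>\<bar> \<le> 1" using Cauchy_Schwarz_ineq2[of e "sgn \<xi>"] that by (cases "\<xi> = 0") (auto simp: norm_sgn)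
        then have "\<bar>e \<bullet> sgn \<xi>\<bar>\<^sup>2 \<le> 1\<^sup>2" by (rule power_mono) simp
        then show "norm (gb e \<xi>) \<le> norm (g \<xi>)" by (simp add: gb_def norm_mult norm_power mult_left_le)
      qed
    qed simp
    have sum1: "(\<Sum>e\<in>Basis. gb e \<xi>) = g \<xi>" for \<xi>
    proof (cases "g \<xi> = 0")
      case False
      then have "norm (sgn \<xi>) = 1" using supp ab(1) by (auto simp: norm_sgn)
      then have "(\<Sum>e\<in>Basis. (e \<bullet> sgn \<xi>)\<^sup>2) = 1" using norm_squared_eq_sum[of "sgn \<xi>"] by (simp add: inner_commute)
      then show ?thesis unfolding gb_def by (simp add: sum_distrib_left[symmetric] flip: of_real_sum of_real_power)
    qed (simp add: gb_def)
    have ext: "extension g z = (\<Sum>e\<in>Basis. extension (gb e) z)" for z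
    proof -
      have "integrable lborel (\<lambda>\<xi>. cis (snd z \<bullet> \<xi> - fst z * (norm \<xi>)\<^sup>2) * gb e \<xi>)" if "e \<in> Basis" for e
        by (rule Bochner_Integration.integrable_bound[OF gbi[OF that]]) (auto simp: norm_mult)
      then have "(\<Sum>e\<in>Basis. extension (gb e) z) = (\<integral>\<xi>. (\<Sum>e\<in>Basis. cis (snd z \<bullet> \<xi> - fst z * (norm \<xi>)\<^sup>2) * gb e \<xi>) \<partial>lborel)"
        unfolding extension_def by (subst Bochner_Integration.integral_sum) auto
      then show ?thesis unfolding sum_distrib_left[symmetric] sum1 extension_def ..
    qed
    have pt: "norm (extension g z) powr p \<le> d powr p * (\<Sum>e\<in>Basis. norm (extension (gb e) z) powr p)" for z
    proof -
      define m where "m = Max ((\<lambda>e. norm (extension (gb e) z)) ` Basis)"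
      have mle: "norm (extension (gb e) z) \<le> m" if "e \<in> Basis" for e unfolding m_def using that by (intro Max_ge) auto
      have "m \<in> (\<lambda>e. norm (extension (gb e) z)) ` Basis" unfolding m_def by (rule Max_in) auto
      then obtain e0 where e0: "e0 \<in> Basis" "m = norm (extension (gb e0) z)" by blast
      have "norm (extension g z) \<le> (\<Sum>e\<in>(Basis::'a set). norm (extension (gb e) z))" unfolding ext by (rule norm_sum)
      also have "\<dots> \<le> (\<Sum>e\<in>(Basis::'a set). m)" by (rule sum_mono[OF mle])
      also have "\<dots> = d * m" by (simp add: d_def)
      finally have "norm (extension g z) powr p \<le> (d * m) powr p" using p1 by (intro powr_mono2) auto
      also have "\<dots> = d powr p * m powr p" using d e0 by (simp add: powr_mult)
      also have "m powr p \<le> (\<Sum>e\<in>Basis. norm (extension (gb e) z) powr p)"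
        unfolding e0(2) by (rule member_le_sum[OF e0(1)]) auto
      finally show ?thesis using d by (simp add: mult_left_mono)
    qed
    have "(\<integral>\<^sup>+z. ennreal (norm (extension g z) powr p) \<partial>lborel) \<le> (\<integral>\<^sup>+z. ennreal (d powr p) * (\<Sum>e\<in>Basis. ennreal (norm (extension (gb e) z) powr p)) \<partial>lborel)"
    proof (rule nn_integral_mono)
      fix z
      have "ennreal (norm (extension g z) powr p) \<le> ennreal (d powr p * (\<Sum>e\<in>Basis. norm (extension (gb e) z) powr p))" by (rule ennreal_leI[OF pt])
      also have "\<dots> = ennreal (d powr p) * ennreal (\<Sum>e\<in>Basis. norm (extension (gb e) z) powr p)" by (rule ennreal_mult) (auto intro: sum_nonneg)
      also have "ennreal (\<Sum>e\<in>Basis. norm (extension (gb e) z) powr p) = (\<Sum>e\<in>Basis. ennreal (norm (extension (gb e) z) powr p))" by (rule sum_ennreal[symmetric]) simp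
      finally show "ennreal (norm (extension g z) powr p) \<le> ennreal (d powr p) * (\<Sum>e\<in>Basis. ennreal (norm (extension (gb e) z) powr p))" .
    qed
    also have "\<dots> = ennreal (d powr p) * (\<Sum>e\<in>Basis. \<integral>\<^sup>+z. ennreal (norm (extension (gb e) z) powr p) \<partial>lborel)"
      by (subst nn_integral_cmult, measurable, subst nn_integral_sum) auto
    also have "\<dots> \<le> ennreal (d powr p) * (\<Sum>e\<in>(Basis::'a set). ennreal ((C0 * L2norm g) powr p))"
    proof (intro mult_left_mono sum_mono)
      fix e :: 'a assume "e \<in> Basis"
      then have e: "norm e = 1" by simp
      show "(\<integral>\<^sup>+z. ennreal (norm (extension (gb e) z) powr p) \<partial>lborel) \<le> ennreal ((C0 * L2norm g) powr p)"
        using C0'[rule_format, OF e ab g2 gi] supp unfolding gb_def[abs_def] by blast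
    qed simp
    also have "\<dots> = ennreal (d powr p * (d * (C0 * L2norm g) powr p))"
      using d by (simp add: d_def[symmetric] ennreal_mult ennreal_of_nat_eq_real_of_nat)
    also have "\<dots> \<le> ennreal ((C * L2norm g) powr p)"
    proof (rule ennreal_leI)
      have "d powr 1 \<le> d powr p" using d p1 by (intro powr_mono) auto
      then have "d * (C0 * L2norm g) powr p \<le> d powr p * (C0 * L2norm g) powr p" using d by (intro mult_right_mono) auto
      then have "d powr p * (d * (C0 * L2norm g) powr p) \<le> d powr p * (d powr p * (C0 * L2norm g) powr p)"
        by (rule mult_left_mono) simp
      also have "\<dots> = (C * L2norm g) powr p" using d C0 L2norm_nonneg[of g] by (simp add: C_def powr_mult mult_ac)
      finally show "d powr p * (d * (C0 * L2norm g) powr p) \<le> (C * L2norm g) powr p" .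
    qed
    finally show ?thesis .
  qed
  show ?thesis by (rule exI[of _ C], intro conjI allI impI C, rule main) (assumption | blast)+
qed

text \<open>Below \<open>R = 2\<close> the annulus may contain the origin; a Galilean boost moves it away.\<close>
lemma extension_bound:
  fixes p :: real
  defines "p \<equiv> 2 * (real DIM('a) + 1) / (real DIM('a) - 1)"
  shows "\<exists>C>0. \<forall>R. \<forall>g :: 'a \<Rightarrow> complex. 1 \<le> R \<longrightarrow>
     L2 g \<longrightarrow> (\<forall>\<xi>. g \<xi> \<noteq> 0 \<longrightarrow> R - 1 \<le> norm \<xi> \<and> norm \<xi> \<le> R + 1) \<longrightarrow>
     (\<integral>\<^sup>+z. ennreal (norm (extension g z) powr p) \<partial>lborel) \<le> ennreal ((C * L2norm g) powr p)"
proof -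
  obtain C where C: "C > 0" and C': "\<forall>a b. \<forall>g :: 'a \<Rightarrow> complex. 1 \<le> a \<longrightarrow> a \<le> b \<longrightarrow> b \<le> 7 * a \<longrightarrow> b - a \<le> 6 \<longrightarrow>
     L2 g \<longrightarrow> (\<forall>\<xi>. g \<xi> \<noteq> 0 \<longrightarrow> a \<le> norm \<xi> \<and> norm \<xi> \<le> b) \<longrightarrow>
     (\<integral>\<^sup>+z. ennreal (norm (extension g z) powr p) \<partial>lborel) \<le> ennreal ((C * L2norm g) powr p)"
    using extension_annulus_bound[folded p_def] by (elim exE conjE) (rule that)
  have main: "(\<integral>\<^sup>+z. ennreal (norm (extension g z) powr p) \<partial>lborel) \<le> ennreal ((C * L2norm g) powr p)"
    if R: "1 \<le> R" and g2: "L2 g" and supp: "\<forall>\<xi>. g \<xi> \<noteq> 0 \<longrightarrow> R - 1 \<le> norm \<xi> \<and> norm \<xi> \<le> R + 1" for R and g :: "'a \<Rightarrow> complex"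
  proof (cases "R \<ge> 2")
    case True
    then show ?thesis using C'[rule_format, of "R - 1" "R + 1" g] g2 supp by auto
  next
    case False
    have [measurable]: "g \<in> borel_measurable borel" using g2 L2_measurable by auto
    obtain e :: 'a where "e \<in> Basis" using nonempty_Basis by blast
    then have e: "norm e = 1" by simp
    \<comment> \<open>For R < 2 the support lies in the ball of radius 3, so a shift by a vector of
      length 4 brings it between the radii 1 and 7.\<close>
    define w where "w = 4 *\<^sub>R e"
    have w: "norm w = 4" by (simp add: w_def e)
    define h where "h \<eta> = g (\<eta> + - w)" for \<eta>
    have [measurable]: "h \<in> borel_measurable borel" unfolding h_def by measurable
    have nn: "(\<integral>\<^sup>+\<eta>. ennreal ((norm (h \<eta>))\<^sup>2) \<partial>lborel) = (\<integral>\<^sup>+\<xi>. ennreal ((norm (g \<xi>))\<^sup>2) \<partial>lborel)"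
      unfolding h_def by (rule nn_integral_lborel_translate) measurable
    have h2: "L2 h" unfolding L2_def
    proof
      show "integrable lborel (\<lambda>x. (norm (h x))\<^sup>2)"
        by (rule integrableI_nonneg) (auto simp: nn nn_integral_L2[OF g2])
    qed simp
    have "ennreal ((L2norm h)\<^sup>2) = ennreal ((L2norm g)\<^sup>2)" using nn unfolding nn_integral_L2[OF h2] nn_integral_L2[OF g2] .
    then have "L2norm h = L2norm g" using L2norm_nonneg[of g] L2norm_nonneg[of h] by simp
    moreover have "(\<integral>\<^sup>+z. ennreal (norm (extension h z) powr p) \<partial>lborel) \<le> ennreal ((C * L2norm h) powr p)"
    proof (rule C'[rule_format, of 1 7])
      fix \<xi> assume "h \<xi> \<noteq> 0"
      then have "norm (\<xi> - w) \<le> R + 1" using supp by (simp add: h_def)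
      then have n: "norm (\<xi> - w) \<le> 3" using False by simp
      show "1 \<le> norm \<xi> \<and> norm \<xi> \<le> 7"
        using n w norm_triangle_ineq2[of w "w - \<xi>"] norm_triangle_ineq[of "\<xi> - w" w] by (simp add: norm_minus_commute)
    qed (use h2 in auto)
    moreover have "(\<integral>\<^sup>+z. ennreal (norm (extension g z) powr p) \<partial>lborel) = (\<integral>\<^sup>+z. ennreal (norm (extension h z) powr p) \<partial>lborel)"
    proof -
      \<comment> \<open>Expanding |\<eta> - w|^2 shows that a frequency shift by w multiplies the
        extension by a unimodular factor and translates x by 2 t w; at each fixed time this
        translation preserves the integral in x.\<close>
      have eq: "norm (extension g (t, x)) = norm (extension h (t, x + (2 * t) *\<^sub>R w))" for t x
      proof -
        have "extension g (t, x) = (\<integral>\<eta>. cis (x \<bullet> (\<eta> + - w) - t * (norm (\<eta> + - w))\<^sup>2) * g (\<eta> + - w) \<partial>lborel)"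
          unfolding extension_def by (subst integral_lborel_translate[of _ "- w", symmetric]) auto
        also have "\<dots> = (\<integral>\<eta>. cis (- (x \<bullet> w) - t * (norm w)\<^sup>2) * (cis ((x + (2 * t) *\<^sub>R w) \<bullet> \<eta> - t * (norm \<eta>)\<^sup>2) * h \<eta>) \<partial>lborel)"
        proof (rule Bochner_Integration.integral_cong[OF refl])
          fix \<eta>
          have "x \<bullet> (\<eta> + - w) - t * (norm (\<eta> + - w))\<^sup>2 = (- (x \<bullet> w) - t * (norm w)\<^sup>2) + ((x + (2 * t) *\<^sub>R w) \<bullet> \<eta> - t * (norm \<eta>)\<^sup>2)"
            unfolding power2_norm_eq_inner by (simp add: inner_add_left inner_add_right inner_diff_left inner_diff_right inner_commute algebra_simps)
          then show "cis (x \<bullet> (\<eta> + - w) - t * (norm (\<eta> + - w))\<^sup>2) * g (\<eta> + - w) = cis (- (x \<bullet> w) - t * (norm w)\<^sup>2) * (cis ((x + (2 * t) *\<^sub>R w) \<bullet> \<eta> - t * (norm \<eta>)\<^sup>2) * h \<eta>)"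
            by (simp only: cis_mult[symmetric] h_def mult.assoc)
        qed
        also have "\<dots> = cis (- (x \<bullet> w) - t * (norm w)\<^sup>2) * extension h (t, x + (2 * t) *\<^sub>R w)"
          unfolding extension_def by simp
        finally show ?thesis by (simp add: norm_mult)
      qed
      have [measurable]: "(\<lambda>z. extension f z) \<in> borel_measurable (borel \<Otimes>\<^sub>M borel)" if "f \<in> borel_measurable borel" for f :: "'a \<Rightarrow> complex"
        unfolding borel_prod by (rule extension_measurable[OF that])
      have pm: "(\<lambda>z. ennreal (norm (extension f z) powr p)) \<in> borel_measurable (lborel \<Otimes>\<^sub>M lborel)" if [measurable]: "f \<in> borel_measurable borel" for f :: "'a \<Rightarrow> complex"
        by measurable
      have "(\<integral>\<^sup>+z. ennreal (norm (extension g z) powr p) \<partial>lborel) = (\<integral>\<^sup>+t. \<integral>\<^sup>+x. ennreal (norm (extension g (t, x)) powr p) \<partial>lborel \<partial>lborel)"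
        unfolding lborel_prod[symmetric] by (rule lborel.nn_integral_fst[OF pm, symmetric]) simp
      also have "\<dots> = (\<integral>\<^sup>+t. \<integral>\<^sup>+x. ennreal (norm (extension h (t, x + (2 * t) *\<^sub>R w)) powr p) \<partial>lborel \<partial>lborel)" unfolding eq ..
      also have "\<dots> = (\<integral>\<^sup>+t. \<integral>\<^sup>+x. ennreal (norm (extension h (t, x)) powr p) \<partial>lborel \<partial>lborel)"
      proof (rule nn_integral_cong)
        fix t :: real
        show "(\<integral>\<^sup>+x. ennreal (norm (extension h (t, x + (2 * t) *\<^sub>R w)) powr p) \<partial>lborel) = (\<integral>\<^sup>+x. ennreal (norm (extension h (t, x)) powr p) \<partial>lborel)"
          by (rule nn_integral_lborel_translate[where f="\<lambda>x. ennreal (norm (extension h (t, x)) powr p)"]) measurable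
      qed
      also have "\<dots> = (\<integral>\<^sup>+z. ennreal (norm (extension h z) powr p) \<partial>lborel)"
        unfolding lborel_prod[symmetric] by (rule lborel.nn_integral_fst[OF pm]) simp
      finally show ?thesis .
    qed
    ultimately show ?thesis by simp
  qed
  show ?thesis by (rule exI[of _ C], intro conjI allI impI C, rule main) (assumption | blast)+
qed

end

section \<open>The Schroedinger propagator\<close>

lemma L2_cnj:
  assumes f: "L2 f"
  shows "L2 (\<lambda>x. cnj (f x))"
proof -
  have [measurable]: "f \<in> borel_measurable borel" using f by (rule L2_measurable)
  have "(\<lambda>x. cnj (f x)) \<in> borel_measurable lborel" by measurable
  then show ?thesis using f unfolding L2_def complex_mod_cnj by blast
qed

lemma L2_diff:
  fixes f g :: "'a::euclidean_space \<Rightarrow> complex"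
  assumes f: "L2 f" and g: "L2 g"
  shows "L2 (\<lambda>x. f x - g x)"
proof -
  have [measurable]: "f \<in> borel_measurable borel" "g \<in> borel_measurable borel" using f g L2_measurable by auto
  have "integrable lborel (\<lambda>x. (norm (f x - g x))\<^sup>2)"
  proof (rule Bochner_Integration.integrable_bound)
    show "integrable lborel (\<lambda>x. 2 * (norm (f x))\<^sup>2 + 2 * (norm (g x))\<^sup>2)" using f g by (simp add: L2_def)
    show "AE x in lborel. norm ((norm (f x - g x))\<^sup>2) \<le> norm (2 * (norm (f x))\<^sup>2 + 2 * (norm (g x))\<^sup>2)"
    proof (rule AE_I2)
      fix x
      have "(norm (f x - g x))\<^sup>2 \<le> (norm (f x) + norm (g x))\<^sup>2" by (rule power_mono[OF norm_triangle_ineq4]) simp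
      also have "\<dots> = (norm (f x))\<^sup>2 + (norm (g x))\<^sup>2 + 2 * norm (f x) * norm (g x)" by (simp add: power2_sum)
      also have "\<dots> \<le> 2 * (norm (f x))\<^sup>2 + 2 * (norm (g x))\<^sup>2" using sum_squares_bound[of "norm (f x)" "norm (g x)"] by simp
      finally show "norm ((norm (f x - g x))\<^sup>2) \<le> norm (2 * (norm (f x))\<^sup>2 + 2 * (norm (g x))\<^sup>2)" by simp
    qed
  qed measurable
  then show ?thesis by (simp add: L2_def)
qed

lemma L2_indicator_mult:
  fixes f :: "'a::euclidean_space \<Rightarrow> complex"
  assumes f: "L2 f" and [measurable]: "A \<in> sets borel"
  shows "L2 (\<lambda>x. of_real (indicator A x) * f x)"
proof -
  have [measurable]: "f \<in> borel_measurable borel" using f L2_measurable by auto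
  have "integrable lborel (\<lambda>x. (norm (of_real (indicator A x) * f x))\<^sup>2)"
  proof (rule Bochner_Integration.integrable_bound)
    show "integrable lborel (\<lambda>x. (norm (f x))\<^sup>2)" using f by (simp add: L2_def)
    show "AE x in lborel. norm ((norm (of_real (indicator A x) * f x))\<^sup>2) \<le> norm ((norm (f x))\<^sup>2)"
      by (auto simp: norm_mult indicator_def)
  qed measurable
  then show ?thesis by (simp add: L2_def)
qed

text \<open>Each \<open>schrod t\<close> brings its own transform of \<phi>, which has to be
  identified with the given one. The difference w is tested against its conjugate cut off to a ball;
  this test function is admissible and yields the integral of |w|^2 over the ball.\<close>

lemma is_fourier_unique:
  fixes \<phi> g g' :: "'a::euclidean_space \<Rightarrow> complex"
  assumes g: "is_fourier \<phi> g" and g': "is_fourier \<phi> g'"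
  shows "AE \<xi> in lborel. g \<xi> = g' \<xi>"
proof -
  define w where "w \<xi> = g \<xi> - g' \<xi>" for \<xi>
  have L: "L2 g" "L2 g'" using g g' by (auto simp: is_fourier_def)
  have w: "L2 w" unfolding w_def by (rule L2_diff[OF L])
  have [measurable]: "w \<in> borel_measurable borel" using w L2_measurable by auto
  have "AE \<xi> in lborel. indicator (cball 0 (real n)) \<xi> * (norm (w \<xi>))\<^sup>2 = 0" for n :: nat
  proof -
    have [measurable]: "cball (0::'a) (real n) \<in> sets borel" by (simp add: borel_closed)
    define \<psi> where "\<psi> \<xi> = of_real (indicator (cball 0 (real n)) \<xi>) * cnj (w \<xi>)" for \<xi>
    have \<psi>2: "L2 \<psi>" unfolding \<psi>_def by (rule L2_indicator_mult[OF L2_cnj[OF w]]) simp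
    have \<psi>1: "integrable lborel \<psi>"
      by (rule integrable_L2_bounded_support[OF \<psi>2, of "real n"]) (auto simp: \<psi>_def indicator_def split: if_splits)
    have "(\<integral>\<xi>. g \<xi> * \<psi> \<xi> \<partial>lborel) = (\<integral>\<xi>. g' \<xi> * \<psi> \<xi> \<partial>lborel)"
      using g g' \<psi>1 \<psi>2 by (simp add: is_fourier_def)
    then have "(\<integral>\<xi>. g \<xi> * \<psi> \<xi> - g' \<xi> * \<psi> \<xi> \<partial>lborel) = 0"
      by (subst Bochner_Integration.integral_diff) (auto intro: integrable_mult_L2 L \<psi>2)
    moreover have "g \<xi> * \<psi> \<xi> - g' \<xi> * \<psi> \<xi> = complex_of_real (indicator (cball 0 (real n)) \<xi> * (norm (w \<xi>))\<^sup>2)" for \<xi>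
    proof -
      have "g \<xi> * \<psi> \<xi> - g' \<xi> * \<psi> \<xi> = of_real (indicator (cball 0 (real n)) \<xi>) * (w \<xi> * cnj (w \<xi>))"
        by (simp add: \<psi>_def w_def algebra_simps)
      then show ?thesis unfolding of_real_mult complex_norm_square .
    qed
    ultimately have z: "(\<integral>\<xi>. indicator (cball 0 (real n)) \<xi> * (norm (w \<xi>))\<^sup>2 \<partial>lborel) = 0"
      by (simp only: integral_complex_of_real of_real_eq_0_iff)
    have "integrable lborel (\<lambda>\<xi>. indicator (cball 0 (real n)) \<xi> * (norm (w \<xi>))\<^sup>2)"
    proof (rule Bochner_Integration.integrable_bound)
      show "integrable lborel (\<lambda>\<xi>. (norm (w \<xi>))\<^sup>2)" using w by (simp add: L2_def)
    qed (auto simp: indicator_def)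
    then show ?thesis using z by (subst (asm) integral_nonneg_eq_0_iff_AE) auto
  qed
  then have "AE \<xi> in lborel. \<forall>n::nat. indicator (cball 0 (real n)) \<xi> * (norm (w \<xi>))\<^sup>2 = 0"
    unfolding AE_all_countable by blast
  then show ?thesis
  proof eventually_elim
    fix \<xi> assume a: "\<forall>n::nat. indicator (cball 0 (real n)) \<xi> * (norm (w \<xi>))\<^sup>2 = 0"
    obtain n :: nat where "norm \<xi> \<le> n" using real_arch_simple by blast
    then show "g \<xi> = g' \<xi>" using a[rule_format, of n] by (simp add: w_def)
  qed
qed

text \<open>Testing with the conjugate of g0 produces the integral of |g0|^2. Cauchy-Schwarz, with
  \<open>Plancherel_le\<close> applied to the test function, bounds it by a constant times the norm
  of \<phi> times the norm of g0, and one norm of g0 is divided out.\<close>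

lemma L2norm_fourier_le:
  fixes \<phi> g g0 :: "'a::euclidean_space \<Rightarrow> complex"
  assumes g: "is_fourier \<phi> g" and ae: "AE \<xi> in lborel. g \<xi> = g0 \<xi>" and g02: "L2 g0" and g01: "integrable lborel g0"
  shows "L2norm g0 \<le> sqrt ((2 * pi) ^ DIM('a)) * L2norm \<phi>"
proof -
  define c where "c = (2 * pi) ^ DIM('a)"
  have c: "c > 0" by (simp add: c_def)
  have L: "L2 \<phi>" "L2 g" using g by (auto simp: is_fourier_def)
  have [measurable]: "g0 \<in> borel_measurable borel" "g \<in> borel_measurable borel" "\<phi> \<in> borel_measurable borel" using L g02 L2_measurable by auto
  define \<psi> where "\<psi> \<xi> = cnj (g0 \<xi>)" for \<xi>
  have \<psi>: "L2 \<psi>" "integrable lborel \<psi>" unfolding \<psi>_def using L2_cnj[OF g02] g01 by auto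
  have [measurable]: "\<psi> \<in> borel_measurable borel" unfolding \<psi>_def by measurable
  define G where "G = L2norm g0"
  define P where "P = L2norm \<phi>"
  have G: "G \<ge> 0" "P \<ge> 0" by (simp_all add: G_def P_def L2norm_nonneg)
  have G2: "G\<^sup>2 = (\<integral>\<xi>. (norm (g0 \<xi>))\<^sup>2 \<partial>lborel)" by (simp add: G_def L2norm_def)
  have "complex_of_real (G\<^sup>2) = (\<integral>\<xi>. complex_of_real ((norm (g0 \<xi>))\<^sup>2) \<partial>lborel)" unfolding G2 by (rule integral_complex_of_real[symmetric])
  also have "\<dots> = (\<integral>\<xi>. g \<xi> * \<psi> \<xi> \<partial>lborel)"
  proof (rule integral_cong_AE)
    show "AE \<xi> in lborel. complex_of_real ((norm (g0 \<xi>))\<^sup>2) = g \<xi> * \<psi> \<xi>"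
      using ae by eventually_elim (simp only: complex_norm_square \<psi>_def)
  qed measurable
  also have "\<dots> = (\<integral>x. \<phi> x * FT1 \<psi> x \<partial>lborel)" using g \<psi> by (simp add: is_fourier_def)
  finally have E: "complex_of_real (G\<^sup>2) = (\<integral>x. \<phi> x * FT1 \<psi> x \<partial>lborel)" .
  have "ennreal (G\<^sup>2) = ennreal (norm (complex_of_real (G\<^sup>2)))" by (simp add: norm_power)
  also have "\<dots> \<le> (\<integral>\<^sup>+x. ennreal (norm (\<phi> x)) * ennreal (norm (FT1 \<psi> x)) \<partial>lborel)"
    unfolding E by (rule order_trans[OF norm_integral_le_nn_integral]) (simp add: norm_mult ennreal_mult)
  finally have "(ennreal (G\<^sup>2))\<^sup>2 \<le> (\<integral>\<^sup>+x. ennreal (norm (\<phi> x)) * ennreal (norm (FT1 \<psi> x)) \<partial>lborel)\<^sup>2"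
    by (rule power_mono) simp
  also have "\<dots> \<le> (\<integral>\<^sup>+x. (ennreal (norm (\<phi> x)))\<^sup>2 \<partial>lborel) * (\<integral>\<^sup>+x. (ennreal (norm (FT1 \<psi> x)))\<^sup>2 \<partial>lborel)"
    by (rule Cauchy_Schwarz_nn_integral) auto
  also have "\<dots> = ennreal (P\<^sup>2) * (\<integral>\<^sup>+x. ennreal ((norm (FT1 \<psi> x))\<^sup>2) \<partial>lborel)"
    using nn_integral_L2[OF L(1)] by (simp add: ennreal_power P_def)
  also have "\<dots> \<le> ennreal (P\<^sup>2) * (ennreal c * (\<integral>\<^sup>+x. ennreal ((norm (\<psi> x))\<^sup>2) \<partial>lborel))"
    unfolding c_def by (intro mult_left_mono Plancherel_le \<psi>) simp
  also have "(\<integral>\<^sup>+x. ennreal ((norm (\<psi> x))\<^sup>2) \<partial>lborel) = ennreal (G\<^sup>2)"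
    using nn_integral_L2[OF g02] by (simp add: \<psi>_def G_def)
  also have "ennreal (P\<^sup>2) * (ennreal c * ennreal (G\<^sup>2)) = ennreal (c * P\<^sup>2 * G\<^sup>2)"
    using c by (simp add: ennreal_mult[symmetric] mult_ac)
  finally have "ennreal ((G\<^sup>2)\<^sup>2) \<le> ennreal (c * P\<^sup>2 * G\<^sup>2)" by (simp add: ennreal_power)
  then have "(G\<^sup>2)\<^sup>2 \<le> c * P\<^sup>2 * G\<^sup>2" using c by (subst (asm) ennreal_le_iff) auto
  then have "G\<^sup>2 * G\<^sup>2 \<le> c * P\<^sup>2 * G\<^sup>2" by (simp only: power2_eq_square)
  then have "G\<^sup>2 \<le> c * P\<^sup>2" if "G \<noteq> 0" by (rule mult_right_le_imp_le) (use that in simp)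
  then have "G\<^sup>2 \<le> c * P\<^sup>2" using c by (cases "G = 0") auto
  also have "\<dots> = (sqrt c * P)\<^sup>2" using c by (simp add: power_mult_distrib)
  finally have "G \<le> sqrt c * P" by (rule power2_le_imp_le) (use c G in simp)
  then show ?thesis by (simp add: G_def P_def c_def)
qed

text \<open>At each time the inversion formula identifies the propagator with the extension off a
  null set of x that may depend on t; joint measurability of u turns this into one null set of
  space-time.\<close>

lemma schrod_eq_extension:
  fixes \<phi> g g0 :: "'a::euclidean_space \<Rightarrow> complex" and u :: "real \<times> 'a \<Rightarrow> complex"
  assumes g: "is_fourier \<phi> g" and ae: "AE \<xi> in lborel. g \<xi> = g0 \<xi>" and g02: "L2 g0" and g01: "integrable lborel g0"
    and u[measurable]: "u \<in> borel_measurable (lborel \<Otimes>\<^sub>M lborel)" and S: "\<And>t. schrod t \<phi> (\<lambda>x. u (t, x))"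
  shows "AE z in lborel \<Otimes>\<^sub>M lborel. u z = extension g0 z / (2 * pi) ^ DIM('a)"
proof -
  have [measurable]: "g0 \<in> borel_measurable borel" using g02 L2_measurable by auto
  have [measurable]: "extension g0 \<in> borel_measurable (lborel \<Otimes>\<^sub>M lborel)" unfolding lborel_prod by simp
  have "AE x in lborel. u (t, x) = extension g0 (t, x) / (2 * pi) ^ DIM('a)" for t
  proof -
    obtain g' where g': "is_fourier \<phi> g'" "is_fourier (\<lambda>x. u (t, x)) (\<lambda>\<xi>. cis (- t * (norm \<xi>)\<^sup>2) * g' \<xi>)"
      using S[of t] by (auto simp: schrod_def)
    define h where "h \<xi> = cis (- t * (norm \<xi>)\<^sup>2) * g' \<xi>" for \<xi>
    define h0 where "h0 \<xi> = cis (- t * (norm \<xi>)\<^sup>2) * g0 \<xi>" for \<xi>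
    have h: "is_fourier (\<lambda>x. u (t, x)) h" using g'(2) by (simp add: h_def[abs_def])
    then have [measurable]: "h \<in> borel_measurable borel" using L2_measurable by (auto simp: is_fourier_def)
    have [measurable]: "h0 \<in> borel_measurable borel" unfolding h0_def by measurable
    have hh: "AE \<xi> in lborel. h \<xi> = h0 \<xi>"
      using is_fourier_unique[OF g g'(1)] ae by eventually_elim (simp add: h_def h0_def)
    have "integrable lborel h0"
      by (rule Bochner_Integration.integrable_bound[OF g01]) (auto simp: h0_def norm_mult)
    then have hi: "integrable lborel h" using integrable_cong_AE[OF _ _ hh] by simp
    have eq: "(\<integral>\<xi>. cis (x \<bullet> \<xi>) * h \<xi> \<partial>lborel) = extension g0 (t, x)" for x
    proof -
      have "(\<integral>\<xi>. cis (x \<bullet> \<xi>) * h \<xi> \<partial>lborel) = (\<integral>\<xi>. cis (x \<bullet> \<xi>) * h0 \<xi> \<partial>lborel)"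
      proof (rule integral_cong_AE)
        show "AE \<xi> in lborel. cis (x \<bullet> \<xi>) * h \<xi> = cis (x \<bullet> \<xi>) * h0 \<xi>" using hh by eventually_elim simp
      qed measurable
      also have "\<dots> = extension g0 (t, x)"
        unfolding extension_def h0_def by (rule Bochner_Integration.integral_cong[OF refl]) (simp add: mult.assoc[symmetric] cis_mult)
      finally show ?thesis .
    qed
    show ?thesis using is_fourier_AE_eq[OF h hi] unfolding eq .
  qed
  then show ?thesis
  proof (intro lborel_pair.AE_pair_measure)
    show "{z \<in> space (lborel \<Otimes>\<^sub>M lborel). u z = extension g0 z / (2 * pi) ^ DIM('a)} \<in> sets (lborel \<Otimes>\<^sub>M lborel)"
      by measurable
  qed auto
qed

theorem theorem1p1:
  fixes dummy :: "'a::euclidean_space"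
  defines "d \<equiv> DIM('a)"
  defines "p \<equiv> 2 * (real d + 1) / (real d - 1)"
  shows "\<exists>C::real. \<forall>R::real. \<forall>(\<phi>::'a \<Rightarrow> complex) g (u :: real \<times> 'a \<Rightarrow> complex).
     R \<ge> 1 \<longrightarrow> is_fourier \<phi> g \<longrightarrow>
     (AE \<xi> in lborel. g \<xi> \<noteq> 0 \<longrightarrow> R - 1 \<le> norm \<xi> \<and> norm \<xi> \<le> R + 1) \<longrightarrow>
     u \<in> borel_measurable (lborel \<Otimes>\<^sub>M lborel) \<longrightarrow>
     (\<forall>t. schrod t \<phi> (\<lambda>x. u (t, x))) \<longrightarrow>
     (if d = 1 then (AE z in lborel \<Otimes>\<^sub>M lborel. norm (u z) \<le> C * L2norm \<phi>)
      else (\<integral>\<^sup>+ z. ennreal (norm (u z) powr p) \<partial>(lborel \<Otimes>\<^sub>M lborel))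
              \<le> ennreal ((C * L2norm \<phi>) powr p))"
proof -
  define c where "c = (2 * pi) ^ DIM('a)"
  have c: "c > 0" by (simp add: c_def)
  \<comment> \<open>The support condition on g holds only almost everywhere. Multiplying by the
    indicator of the annulus gives a representative g0 that satisfies it at every point, and bounded
    support makes g0 integrable.\<close>
  have cut: "\<exists>g0. L2 g0 \<and> integrable lborel g0 \<and> (\<forall>\<xi>. g0 \<xi> \<noteq> 0 \<longrightarrow> R - 1 \<le> norm \<xi> \<and> norm \<xi> \<le> R + 1) \<and>
      L2norm g0 \<le> sqrt c * L2norm \<phi> \<and> (AE z in lborel \<Otimes>\<^sub>M lborel. u z = extension g0 z / of_real c)"
    if g: "is_fourier \<phi> g" and supp: "AE \<xi> in lborel. g \<xi> \<noteq> 0 \<longrightarrow> R - 1 \<le> norm \<xi> \<and> norm \<xi> \<le> R + 1"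
      and u: "u \<in> borel_measurable (lborel \<Otimes>\<^sub>M lborel)" and S: "\<forall>t. schrod t \<phi> (\<lambda>x. u (t, x))"
    for R and \<phi> g :: "'a \<Rightarrow> complex" and u
  proof -
    have g2: "L2 g" using g by (simp add: is_fourier_def)
    have [measurable]: "g \<in> borel_measurable borel" using g2 L2_measurable by auto
    define A where "A = {\<xi>::'a. R - 1 \<le> norm \<xi> \<and> norm \<xi> \<le> R + 1}"
    have [measurable]: "A \<in> sets borel" unfolding A_def by measurable
    define g0 where "g0 \<xi> = of_real (indicator A \<xi>) * g \<xi>" for \<xi>
    have ae: "AE \<xi> in lborel. g \<xi> = g0 \<xi>" using supp by eventually_elim (auto simp: g0_def A_def indicator_def)
    have g02: "L2 g0" unfolding g0_def by (rule L2_indicator_mult[OF g2]) simp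
    have s0: "g0 \<xi> \<noteq> 0 \<Longrightarrow> R - 1 \<le> norm \<xi> \<and> norm \<xi> \<le> R + 1" for \<xi> by (auto simp: g0_def A_def indicator_def split: if_splits)
    have g01: "integrable lborel g0" by (rule integrable_L2_bounded_support[OF g02, of "R + 1"]) (use s0 in auto)
    show ?thesis
      using g02 g01 s0 L2norm_fourier_le[OF g ae g02 g01] schrod_eq_extension[OF g ae g02 g01 u S[rule_format]]
      by (intro exI[of _ g0]) (simp add: c_def)
  qed
  show ?thesis
  \<comment> \<open>For d = 1 the formula for p has denominator 0, and the claim is a supremum
    bound: |u| is at most the L1 norm of g0 divided by c, and g0 is supported in two unit balls
    whose measure does not depend on R.\<close>
  proof (cases "d = 1")
    case True
    define B where "B = measure lborel (cball (0::'a) 1)"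
    \<comment> \<open>\<open>sqrt (2 * B)\<close> comes from Cauchy-Schwarz on the two balls,
      \<open>sqrt c\<close> from \<open>L2norm_fourier_le\<close> and 1 / c from the inversion
      formula.\<close>
    define C where "C = sqrt (2 * B) * sqrt c / c"
    have B: "B \<ge> 0" by (simp add: B_def)
    have "AE z in lborel \<Otimes>\<^sub>M lborel. norm (u z) \<le> C * L2norm \<phi>"
      if g: "is_fourier \<phi> g" and supp: "AE \<xi> in lborel. g \<xi> \<noteq> 0 \<longrightarrow> R - 1 \<le> norm \<xi> \<and> norm \<xi> \<le> R + 1"
        and u: "u \<in> borel_measurable (lborel \<Otimes>\<^sub>M lborel)" and S: "\<forall>t. schrod t \<phi> (\<lambda>x. u (t, x))"
      for R and \<phi> g :: "'a \<Rightarrow> complex" and u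
    proof -
      from cut[OF g supp u S] obtain g0 where g0: "L2 g0" "integrable lborel g0" "\<And>\<xi>. g0 \<xi> \<noteq> 0 \<Longrightarrow> R - 1 \<le> norm \<xi> \<and> norm \<xi> \<le> R + 1"
        "L2norm g0 \<le> sqrt c * L2norm \<phi>" "AE z in lborel \<Otimes>\<^sub>M lborel. u z = extension g0 z / of_real c" by blast
      have [measurable]: "g0 \<in> borel_measurable borel" using g0(1) L2_measurable by auto
      obtain e :: 'a where e: "Basis = {e}" using True card_1_singletonE[of "Basis :: 'a set"] unfolding d_def by blast
      have xe1: "\<xi> = (\<xi> \<bullet> e) *\<^sub>R e" for \<xi> using euclidean_representation[of \<xi>] by (simp add: e)
      have xe2: "norm e = 1" by (rule norm_Basis) (simp add: e)
      define D where "D = cball (R *\<^sub>R e) 1 \<union> cball (- (R *\<^sub>R e)) 1"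
      have [measurable]: "D \<in> sets borel" unfolding D_def by (intro sets.Un borel_closed) auto
      have gD: "\<xi> \<in> D" if "g0 \<xi> \<noteq> 0" for \<xi>
      proof -
        define s where "s = \<xi> \<bullet> e"
        have x: "\<xi> = s *\<^sub>R e" unfolding s_def by (rule xe1)
        have "norm \<xi> = \<bar>s\<bar>" using x xe2 by simp
        then have "\<bar>s - R\<bar> \<le> 1 \<or> \<bar>s + R\<bar> \<le> 1" using g0(3)[OF that] by linarith
        moreover have "dist (R *\<^sub>R e) \<xi> = \<bar>s - R\<bar>" unfolding x dist_norm scaleR_diff_left[symmetric] using xe2 by simp
        moreover have "dist (- (R *\<^sub>R e)) \<xi> = \<bar>s + R\<bar>"
        proof -
          have "- (R *\<^sub>R e) - s *\<^sub>R e = (- (s + R)) *\<^sub>R e" by (simp add: algebra_simps)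
          then show ?thesis unfolding x dist_norm using xe2 by (simp only: norm_scaleR) simp
        qed
        ultimately show ?thesis by (auto simp: D_def)
      qed
      have mball: "emeasure lborel (cball (x::'a) 1) = ennreal B" for x
      proof -
        have eq: "indicator (cball 0 1) (y + - x) = (indicator (cball x 1) y :: ennreal)" for y
          by (auto simp: indicator_def dist_norm norm_minus_commute)
        have "(\<integral>\<^sup>+y. indicator (cball 0 1) (y + - x) \<partial>lborel) = (\<integral>\<^sup>+y. indicator (cball (0::'a) 1) y \<partial>lborel)"
          by (rule nn_integral_lborel_translate, rule borel_measurable_indicator, rule borel_closed, simp)
        then have "emeasure lborel (cball x 1) = emeasure lborel (cball (0::'a) 1)"
          unfolding eq by (simp add: borel_closed)
        also have "\<dots> = ennreal B" unfolding B_def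
          by (rule emeasure_eq_ennreal_measure) (use emeasure_lborel_cball_finite[of "0::'a" 1] in auto)
        finally show ?thesis .
      qed
      define G where "G = L2norm g0"
      have G: "G \<ge> 0" by (simp add: G_def L2norm_nonneg)
      have "(\<integral>\<^sup>+\<xi>. ennreal (norm (g0 \<xi>)) \<partial>lborel)\<^sup>2 = (\<integral>\<^sup>+\<xi>. ennreal (norm (g0 \<xi>)) * indicator D \<xi> \<partial>lborel)\<^sup>2"
        using gD by (intro arg_cong[where f="\<lambda>x. x\<^sup>2"] nn_integral_cong) (auto simp: indicator_def)
      also have "\<dots> \<le> (\<integral>\<^sup>+\<xi>. (ennreal (norm (g0 \<xi>)))\<^sup>2 \<partial>lborel) * (\<integral>\<^sup>+\<xi>. (indicator D \<xi>)\<^sup>2 \<partial>lborel)"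
        by (rule Cauchy_Schwarz_nn_integral) auto
      also have "(\<integral>\<^sup>+\<xi>. (ennreal (norm (g0 \<xi>)))\<^sup>2 \<partial>lborel) = ennreal (G\<^sup>2)"
        using nn_integral_L2[OF g0(1)] by (simp add: ennreal_power G_def)
      also have "(\<integral>\<^sup>+\<xi>. (indicator D \<xi>)\<^sup>2 \<partial>lborel) = emeasure lborel D"
      proof -
        have "(\<integral>\<^sup>+\<xi>. (indicator D \<xi>)\<^sup>2 \<partial>lborel) = (\<integral>\<^sup>+\<xi>. indicator D \<xi> \<partial>lborel)" by (rule nn_integral_cong) (auto simp: indicator_def)
        then show ?thesis by simp
      qed
      also have "ennreal (G\<^sup>2) * emeasure lborel D \<le> ennreal (G\<^sup>2) * (ennreal B + ennreal B)"
      proof (rule mult_left_mono)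
        have "emeasure lborel D \<le> emeasure lborel (cball (R *\<^sub>R e) 1) + emeasure lborel (cball (- (R *\<^sub>R e)) 1)"
          unfolding D_def by (rule emeasure_subadditive) (simp_all add: borel_closed)
        then show "emeasure lborel D \<le> ennreal B + ennreal B" unfolding mball .
      qed simp
      also have "\<dots> = ennreal ((sqrt (2 * B) * G)\<^sup>2)"
        using B by (simp add: ennreal_plus[symmetric] ennreal_mult[symmetric] power_mult_distrib mult_ac del: ennreal_plus)
      also have "(\<integral>\<^sup>+\<xi>. ennreal (norm (g0 \<xi>)) \<partial>lborel) = ennreal (\<integral>\<xi>. norm (g0 \<xi>) \<partial>lborel)"
        by (rule nn_integral_eq_integral) (use g0(2) in auto)
      finally have "(\<integral>\<xi>. norm (g0 \<xi>) \<partial>lborel)\<^sup>2 \<le> (sqrt (2 * B) * G)\<^sup>2" by (simp add: ennreal_power)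
      then have int: "(\<integral>\<xi>. norm (g0 \<xi>) \<partial>lborel) \<le> sqrt (2 * B) * G" by (rule power2_le_imp_le) (use B G in simp)
      show ?thesis using g0(5)
      proof eventually_elim
        fix z assume z: "u z = extension g0 z / of_real c"
        have "norm (u z) \<le> (\<integral>\<xi>. norm (g0 \<xi>) \<partial>lborel) / c" unfolding z using c norm_extension_le[of g0 z] by (simp add: norm_divide divide_right_mono)
        also have "\<dots> \<le> (sqrt (2 * B) * (sqrt c * L2norm \<phi>)) / c"
          using c B by (intro divide_right_mono order_trans[OF int] mult_left_mono g0(4)[folded G_def]) auto
        finally show "norm (u z) \<le> C * L2norm \<phi>" by (simp add: C_def)
      qed
    qed
    then show ?thesis using True by (intro exI[of _ C]) auto
  next
    case False
    have d2: "DIM('a) \<ge> 2" using False DIM_positive[where 'a='a] unfolding d_def by linarith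
    have p0: "p > 0" using d2 by (simp add: p_def d_def)
    obtain C0 where C0: "C0 > 0" and C0': "\<forall>R. \<forall>g :: 'a \<Rightarrow> complex. 1 \<le> R \<longrightarrow>
     L2 g \<longrightarrow> (\<forall>\<xi>. g \<xi> \<noteq> 0 \<longrightarrow> R - 1 \<le> norm \<xi> \<and> norm \<xi> \<le> R + 1) \<longrightarrow>
     (\<integral>\<^sup>+z. ennreal (norm (extension g z) powr p) \<partial>lborel) \<le> ennreal ((C0 * L2norm g) powr p)"
      using extension_bound[OF d2, folded d_def, folded p_def] by (elim exE conjE) (rule that)
    define C where "C = C0 * sqrt c / c"
    have "(\<integral>\<^sup>+ z. ennreal (norm (u z) powr p) \<partial>(lborel \<Otimes>\<^sub>M lborel)) \<le> ennreal ((C * L2norm \<phi>) powr p)"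
      if R: "R \<ge> 1" and g: "is_fourier \<phi> g" and supp: "AE \<xi> in lborel. g \<xi> \<noteq> 0 \<longrightarrow> R - 1 \<le> norm \<xi> \<and> norm \<xi> \<le> R + 1"
        and u: "u \<in> borel_measurable (lborel \<Otimes>\<^sub>M lborel)" and S: "\<forall>t. schrod t \<phi> (\<lambda>x. u (t, x))"
      for R and \<phi> g :: "'a \<Rightarrow> complex" and u
    proof -
      from cut[OF g supp u S] obtain g0 where g0: "L2 g0" "integrable lborel g0" "\<forall>\<xi>. g0 \<xi> \<noteq> 0 \<longrightarrow> R - 1 \<le> norm \<xi> \<and> norm \<xi> \<le> R + 1"
        "L2norm g0 \<le> sqrt c * L2norm \<phi>" "AE z in lborel \<Otimes>\<^sub>M lborel. u z = extension g0 z / of_real c" by blast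
      have [measurable]: "g0 \<in> borel_measurable borel" using g0(1) L2_measurable by auto
      have "(\<integral>\<^sup>+ z. ennreal (norm (u z) powr p) \<partial>(lborel \<Otimes>\<^sub>M lborel)) = (\<integral>\<^sup>+ z. ennreal ((1 / c) powr p) * ennreal (norm (extension g0 z) powr p) \<partial>lborel)"
        unfolding lborel_prod
      proof (rule nn_integral_cong_AE, use g0(5)[unfolded lborel_prod] in eventually_elim)
        fix z assume z: "u z = extension g0 z / of_real c"
        have "norm (u z) powr p = (1 / c) powr p * norm (extension g0 z) powr p"
          unfolding z using c by (simp add: norm_divide powr_mult[symmetric] del: powr_mult)
        then show "ennreal (norm (u z) powr p) = ennreal ((1 / c) powr p) * ennreal (norm (extension g0 z) powr p)"
          by (simp only: ennreal_mult powr_ge_zero)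
      qed
      also have "\<dots> = ennreal ((1 / c) powr p) * (\<integral>\<^sup>+ z. ennreal (norm (extension g0 z) powr p) \<partial>lborel)"
        by (rule nn_integral_cmult) measurable
      also have "\<dots> \<le> ennreal ((1 / c) powr p) * ennreal ((C0 * L2norm g0) powr p)"
        by (rule mult_left_mono, rule C0'[rule_format, OF R g0(1)]) (use g0(3) in auto)
      also have "\<dots> = ennreal ((1 / c * (C0 * L2norm g0)) powr p)"
        using c C0 L2norm_nonneg[of g0] by (simp only: ennreal_mult[symmetric] powr_ge_zero) (subst powr_mult, simp_all)
      also have "\<dots> \<le> ennreal ((C * L2norm \<phi>) powr p)"
      proof (rule ennreal_leI, rule powr_mono2)
        have "1 / c * (C0 * L2norm g0) \<le> 1 / c * (C0 * (sqrt c * L2norm \<phi>))"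
          using c C0 g0(4) by (intro mult_left_mono) auto
        then show "1 / c * (C0 * L2norm g0) \<le> C * L2norm \<phi>" by (simp add: C_def)
      qed (use c C0 p0 L2norm_nonneg[of g0] in auto)
      finally show ?thesis .
    qed
    then show ?thesis using False by (intro exI[of _ C]) auto
  qed
qed

end
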